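(* Let $k$ be a field, $S=k[x_1,\dots,x_n]$, and let $I=J_1\cap J_2\cap J_3$ be a type three monomial ideal, primary to $(x_1,\dots,x_n)$, with $J_i=(x_1^{a_{i1}},\dots,x_n^{a_{in}})$ for $i=1,2,3$ (all $a_{ij}\geq 1$). Let $R=S/I$, with maximal ideal $\mathfrak m$ and canonical module $\omega$. Then the following three conditions are equivalent for $R$: (1) $\mathfrak m\subseteq\omega^*(\omega)$. (2) For all ideals $K$ of $R$ generated by a system of parameters and for all ideals $\mathfrak a\supseteq K$ of $R$, $K:(K:\mathfrak a)\subseteq\mathfrak a:\mathfrak m$. (3) For all ideals $K$ of $R$ generated by a system of parameters whose members are not contained in any prime of a given finite (or countable, if $R$ is complete or $k$ is uncountable) set of primes not equal to $\mathfrak m$, and for all ideals $\mathfrak a\supseteq K$ of $R$, $K:(K:\mathfrak a)\subseteq\mathfrak a:\mathfrak m$. (Since $R$ is Artinian, $K=0$ in (2) and (3), so both say that $0:(0:\mathfrak a)\subseteq\mathfrak a:\mathfrak m$ for every ideal $\mathfrak a$ of $R$.) Moreover, these conditions hold if and only if $R$ is isomorphic to a ring $k[x_1,\dots,x_m]/I'$, where, for some $m$ and some positive integer exponents, $I'$ is one of the following: 1. $I'=(x_1^{a_1},\dots,x_m^{a_m},\,x_1^{a_1-1}\cdots x_m^{a_m-1})$. 2. $I'=J_1'\cap J_2'\cap J_3'$ with $J_1'=(x_1^a,x_2^b,x_3^{c_3},\dots,x_m^{c_m})$, $J_2'=(x_1^{a+1},x_2,x_3,\dots,x_m)$, $J_3'=(x_1,x_2^{b+1},x_3,\dots,x_m)$,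 where $m\ge 3$ and $c_3,\dots,c_m>1$. 3. $I'=J_1'\cap J_2'\cap J_3'$ with $J_1'=(x_1^a,x_2^{b+1},x_3,\dots,x_m)$, $J_2'=(x_1^{a+1},x_2^b,x_3,\dots,x_m)$, $J_3'=(x_1,x_2,x_3^{c_3},\dots,x_m^{c_m})$, where $m\ge 3$. 4. $I'=J_1'\cap J_2'\cap J_3'$ with $J_1'=(x_1^a,x_2,\dots,x_s,x_{s+1}^{b_{s+1}},\dots,x_m^{b_m})$, $J_2'=(x_1^{a+1},x_2,\dots,x_m)$, $J_3'=(x_1,x_2^{c_2},\dots,x_s^{c_s},x_{s+1},\dots,x_m)$, where $2\le s<m$. 5. $I'=J_1'\cap J_2'\cap J_3'$ with $J_1'=(x_1,\dots,x_s,x_{s+1},\dots,x_t,x_{t+1}^{c_{t+1}},\dots,x_m^{c_m})$, $J_2'=(x_1,\dots,x_s,x_{s+1}^{b_{s+1}},\dots,x_t^{b_t},x_{t+1},\dots,x_m)$, $J_3'=(x_1^{a_1},\dots,x_s^{a_s},x_{s+1},\dots,x_t,x_{t+1},\dots,x_m)$, where $1\le s<t<m$.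
   Context: For an Artinian local ring $R$ with maximal ideal $\mathfrak m$, the type is the dimension of the socle $0:_R\mathfrak m$ over the residue field, and an ideal $I$ is of type three if $S/I$ has type three. For an $R$-module $M$, $M^*=\operatorname{Hom}_R(M,R)$, and $M^*(M)$ is the ideal of $R$ generated by all elements $f(x)$ with $x\in M$, $f\in M^*$. For $R$ Artinian local, the canonical module $\omega$ is the injective hull of the residue field. Colon ideals in conditions (2) and (3) are taken in $R$. *)

theory Defs
  imports
    "HOL-Library.Poly_Mapping"
    "HOL-Library.Countable_Set"
    "HOL-Library.Extended_Nat"
    "HOL-Algebra.Ideal_Product"
    "HOL-Algebra.QuotRing"
    "Jordan_Normal_Form.Missing_VectorSpace"
begin

section \<open>Ideals\<close>

definition colon :: "('r, 'b) ring_scheme \<Rightarrow> 'r set \<Rightarrow> 'r set \<Rightarrow> 'r set" where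
  "colon R I J = {r \<in> carrier R. \<forall>x\<in>J. r \<otimes>\<^bsub>R\<^esub> x \<in> I}"

definition ideal_radical :: "('r, 'b) ring_scheme \<Rightarrow> 'r set \<Rightarrow> 'r set" where
  "ideal_radical R I = {x \<in> carrier R. \<exists>e::nat. x [^]\<^bsub>R\<^esub> e \<in> I}"

definition primary_ideal :: "('r, 'b) ring_scheme \<Rightarrow> 'r set \<Rightarrow> bool" where
  "primary_ideal R Q \<longleftrightarrow> ideal Q R \<and> Q \<noteq> carrier R \<and>
     (\<forall>x\<in>carrier R. \<forall>y\<in>carrier R. x \<otimes>\<^bsub>R\<^esub> y \<in> Q \<longrightarrow> x \<in> Q \<or> y \<in> ideal_radical R Q)"

definition primary_to :: "('r, 'b) ring_scheme \<Rightarrow> 'r set \<Rightarrow> 'r set \<Rightarrow> bool" where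
  "primary_to R Q p \<longleftrightarrow> primary_ideal R Q \<and> ideal_radical R Q = p"

primrec ideal_power :: "('r, 'b) ring_scheme \<Rightarrow> 'r set \<Rightarrow> nat \<Rightarrow> 'r set" where
  "ideal_power R I 0 = carrier R"
| "ideal_power R I (Suc e) = I \<cdot>\<^bsub>R\<^esub> ideal_power R I e"

definition krull_dim :: "('r, 'b) ring_scheme \<Rightarrow> enat" where
  "krull_dim R = Sup {enat d | d. \<exists>p :: nat \<Rightarrow> 'r set.
     (\<forall>i\<le>d. primeideal (p i) R) \<and> (\<forall>i<d. p i \<subset> p (Suc i))}"

text \<open>Systems of parameters of a local ring with maximal ideal \<open>\<mm>\<close>.\<close>

definition system_of_parameters :: "('r, 'b) ring_scheme \<Rightarrow> 'r set \<Rightarrow> 'r list \<Rightarrow> bool" where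
  "system_of_parameters R \<mm> xs \<longleftrightarrow>
     set xs \<subseteq> \<mm> \<and> enat (length xs) = krull_dim R \<and> primary_to R (Idl\<^bsub>R\<^esub> (set xs)) \<mm>"

text \<open>Bijectivity of the natural map from \<open>R\<close> to the inverse limit of the rings \<open>R/\<mm>\<^sup>e\<close>:
  a coherent family of residue classes is given by representatives \<open>f e\<close>.\<close>

definition adically_complete :: "('r, 'b) ring_scheme \<Rightarrow> 'r set \<Rightarrow> bool" where
  "adically_complete R \<mm> \<longleftrightarrow>
     (\<forall>f :: nat \<Rightarrow> 'r. (\<forall>e. f e \<in> carrier R \<and> f (Suc e) \<ominus>\<^bsub>R\<^esub> f e \<in> ideal_power R \<mm> e) \<longrightarrow>
        (\<exists>!x. x \<in> carrier R \<and> (\<forall>e. x \<ominus>\<^bsub>R\<^esub> f e \<in> ideal_power R \<mm> e)))"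


section \<open>Modules, type and canonical module\<close>

definition with_smult :: "('s, 'b) ring_scheme \<Rightarrow> ('r \<Rightarrow> 's \<Rightarrow> 's) \<Rightarrow> ('r, 's) module" where
  "with_smult Q s = \<lparr>carrier = carrier Q, monoid.mult = monoid.mult Q, one = \<one>\<^bsub>Q\<^esub>,
     ring.zero = \<zero>\<^bsub>Q\<^esub>, ring.add = add Q, smult = s\<rparr>"

definition self_module :: "('r, 'b) ring_scheme \<Rightarrow> ('r, 'r) module" where
  "self_module R = with_smult R (monoid.mult R)"

definition residue_module :: "('r, 'b) ring_scheme \<Rightarrow> 'r set \<Rightarrow> ('r, 'r set) module" where
  "residue_module R \<mm> =
     with_smult (R Quot \<mm>) (\<lambda>r C. (\<mm> +>\<^bsub>R\<^esub> r) \<otimes>\<^bsub>R Quot \<mm>\<^esub> C)"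

text \<open>The socle is annihilated by \<open>\<mm>\<close>, so for a residue class \<open>C\<close> the product \<open>r \<otimes> x\<close>
  is the same for all \<open>r \<in> C\<close>.\<close>

definition socle_space :: "('r, 'b) ring_scheme \<Rightarrow> 'r set \<Rightarrow> ('r set, 'r) module" where
  "socle_space R \<mm> = with_smult (R\<lparr>carrier := colon R {\<zero>\<^bsub>R\<^esub>} \<mm>\<rparr>)
     (\<lambda>C x. THE y. \<exists>r\<in>C. y = r \<otimes>\<^bsub>R\<^esub> x)"

text \<open>Meaningful for an Artinian local ring, whose socle is finite-dimensional.\<close>

definition ring_type :: "('r, 'b) ring_scheme \<Rightarrow> 'r set \<Rightarrow> nat" where
  "ring_type R \<mm> = vectorspace.dim (R Quot \<mm>) (socle_space R \<mm>)"

definition trace_ideal :: "('r, 'b) ring_scheme \<Rightarrow> ('r, 'm, 'c) module_scheme \<Rightarrow> 'r set" where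
  "trace_ideal R M =
     Idl\<^bsub>R\<^esub> {f x | f x. f \<in> LinearCombinations.module_hom R M (self_module R) \<and> x \<in> carrier M}"

text \<open>HOL cannot quantify over the types of the carriers of \<open>A\<close> and \<open>B\<close>. They range over the
  element type of \<open>R\<close>; this includes \<open>R\<close> and its ideals, so by Baer's criterion nothing is lost.\<close>

definition injective_module :: "('r, 'b) ring_scheme \<Rightarrow> ('r, 'm, 'c) module_scheme \<Rightarrow> bool" where
  "injective_module R E \<longleftrightarrow> Module.module R E \<and>
     (\<forall>(A :: ('r, 'r) module) (B :: ('r, 'r) module) i g.
        Module.module R A \<and> Module.module R B \<and>
        i \<in> LinearCombinations.module_hom R A B \<and> inj_on i (carrier A) \<and>
        g \<in> LinearCombinations.module_hom R A E \<longrightarrow>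
        (\<exists>h \<in> LinearCombinations.module_hom R B E. \<forall>x\<in>carrier A. h (i x) = g x))"

text \<open>An injective hull is an injective module that is an essential extension of (an isomorphic
  copy of) \<open>M\<close>.\<close>

definition injective_hull ::
  "('r, 'b) ring_scheme \<Rightarrow> ('r, 'm, 'c) module_scheme \<Rightarrow> ('r, 'e, 'd) module_scheme \<Rightarrow> bool" where
  "injective_hull R M E \<longleftrightarrow> injective_module R E \<and>
     (\<exists>i \<in> LinearCombinations.module_hom R M E. inj_on i (carrier M) \<and>
        (\<forall>N. LinearCombinations.submodule R N E \<and> N \<noteq> {\<zero>\<^bsub>E\<^esub>} \<longrightarrow> N \<inter> i ` carrier M \<noteq> {\<zero>\<^bsub>E\<^esub>}))"

text \<open>For an Artinian local ring with maximal ideal \<open>\<mm>\<close>.\<close>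

definition canonical_module ::
  "('r, 'b) ring_scheme \<Rightarrow> 'r set \<Rightarrow> ('r, 'w, 'c) module_scheme \<Rightarrow> bool" where
  "canonical_module R \<mm> \<omega> \<longleftrightarrow> injective_hull R (residue_module R \<mm>) \<omega>"


section \<open>Polynomial rings and monomial ideals\<close>

text \<open>A polynomial in the variables \<open>x\<^sub>1, x\<^sub>2, \<dots>\<close> is a finitely supported map from exponent
  vectors to coefficients. All variables live in one type, so that the number of variables can be
  quantified over.\<close>

type_synonym 'k mpoly = "(nat \<Rightarrow>\<^sub>0 nat) \<Rightarrow>\<^sub>0 'k"

definition mpoly_ring :: "nat \<Rightarrow> 'k::field mpoly ring" where
  "mpoly_ring n = \<lparr>carrier = {p. \<forall>t\<in>Poly_Mapping.keys p. Poly_Mapping.keys t \<subseteq> {1..n}},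
     monoid.mult = (*), one = 1, ring.zero = 0, ring.add = (+)\<rparr>"

definition Var :: "nat \<Rightarrow> 'k::field mpoly" where
  "Var i = Poly_Mapping.single (Poly_Mapping.single i 1) 1"

definition is_monomial :: "'k::field mpoly \<Rightarrow> bool" where
  "is_monomial p \<longleftrightarrow> (\<exists>t. p = Poly_Mapping.single t 1)"

definition monomial_ideal :: "nat \<Rightarrow> 'k::field mpoly set \<Rightarrow> bool" where
  "monomial_ideal n I \<longleftrightarrow>
     (\<exists>G. G \<subseteq> {p \<in> carrier (mpoly_ring n). is_monomial p} \<and> I = Idl\<^bsub>mpoly_ring n\<^esub> G)"

text \<open>The ideal \<open>(x\<^sub>1\<^bsup>e 1\<^esup>, \<dots>, x\<^sub>n\<^bsup>e n\<^esup>)\<close> of \<open>k[x\<^sub>1, \<dots>, x\<^sub>n]\<close>.\<close>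

definition pow_ideal :: "nat \<Rightarrow> (nat \<Rightarrow> nat) \<Rightarrow> 'k::field mpoly set" where
  "pow_ideal n e = Idl\<^bsub>mpoly_ring n\<^esub> {Var i ^ e i | i. i \<in> {1..n}}"

text \<open>\<open>listed_ideal m I'\<close>: the ideal \<open>I'\<close> of \<open>k[x\<^sub>1, \<dots>, x\<^sub>m]\<close> is one of the five ideals of the
  classification.\<close>

inductive listed_ideal :: "nat \<Rightarrow> 'k::field mpoly set \<Rightarrow> bool" where
  item1: "listed_ideal m
      (Idl\<^bsub>mpoly_ring m\<^esub> ({Var i ^ a i | i. i \<in> {1..m}} \<union> {\<Prod>i\<in>{1..m}. Var i ^ (a i - 1)}))"
  if "\<forall>i\<in>{1..m}. 1 \<le> a i"
| item2: "listed_ideal m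
      (pow_ideal m (c(1 := a, 2 := b)) \<inter>
       pow_ideal m ((\<lambda>_. 1)(1 := a + 1)) \<inter>
       pow_ideal m ((\<lambda>_. 1)(2 := b + 1)))"
  if "3 \<le> m" "1 \<le> a" "1 \<le> b" "\<forall>i\<in>{3..m}. 1 < c i"
| item3: "listed_ideal m
      (pow_ideal m ((\<lambda>_. 1)(1 := a, 2 := b + 1)) \<inter>
       pow_ideal m ((\<lambda>_. 1)(1 := a + 1, 2 := b)) \<inter>
       pow_ideal m (c(1 := 1, 2 := 1)))"
  if "3 \<le> m" "1 \<le> a" "1 \<le> b" "\<forall>i\<in>{3..m}. 1 \<le> c i"
| item4: "listed_ideal m
      (pow_ideal m (\<lambda>i. if i = 1 then a else if i \<le> s then 1 else b i) \<inter>
       pow_ideal m ((\<lambda>_. 1)(1 := a + 1)) \<inter>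
       pow_ideal m (\<lambda>i. if 2 \<le> i \<and> i \<le> s then c i else 1))"
  if "2 \<le> s" "s < m" "1 \<le> a" "\<forall>i\<in>{s+1..m}. 1 \<le> b i" "\<forall>i\<in>{2..s}. 1 \<le> c i"
| item5: "listed_ideal m
      (pow_ideal m (\<lambda>i. if i \<le> t then 1 else c i) \<inter>
       pow_ideal m (\<lambda>i. if s < i \<and> i \<le> t then b i else 1) \<inter>
       pow_ideal m (\<lambda>i. if i \<le> s then a i else 1))"
  if "1 \<le> s" "s < t" "t < m"
     "\<forall>i\<in>{1..s}. 1 \<le> a i" "\<forall>i\<in>{s+1..t}. 1 \<le> b i" "\<forall>i\<in>{t+1..m}. 1 \<le> c i"

lemma cring_mpoly_ring: "cring (mpoly_ring n :: 'k::field mpoly ring)"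
proof -
  let ?R = "mpoly_ring n :: 'k mpoly ring"
  have mem: "p \<in> carrier ?R \<longleftrightarrow> (\<forall>t\<in>Poly_Mapping.keys p. Poly_Mapping.keys t \<subseteq> {1..n})" for p
    by (simp add: mpoly_ring_def)
  have ops: "x \<otimes>\<^bsub>?R\<^esub> y = x * y" "x \<oplus>\<^bsub>?R\<^esub> y = x + y" "\<one>\<^bsub>?R\<^esub> = 1" "\<zero>\<^bsub>?R\<^esub> = 0" for x y
    by (simp_all add: mpoly_ring_def)
  have add: "p + q \<in> carrier ?R" if "p \<in> carrier ?R" "q \<in> carrier ?R" for p q
    using that Poly_Mapping.keys_add[of p q] unfolding mem by blast
  have mult: "p * q \<in> carrier ?R" if p: "p \<in> carrier ?R" and q: "q \<in> carrier ?R" for p q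
    unfolding mem
  proof (intro ballI subsetI)
    fix t j assume t: "t \<in> Poly_Mapping.keys (p * q)" and j: "j \<in> Poly_Mapping.keys t"
    obtain u v where uv: "u \<in> Poly_Mapping.keys p" "v \<in> Poly_Mapping.keys q" "t = u + v"
      using t keys_mult[of p q] by blast
    have "j \<in> Poly_Mapping.keys u \<union> Poly_Mapping.keys v"
      using j uv(3) Poly_Mapping.keys_add[of u v] by blast
    then show "j \<in> {1..n}" using p q uv(1,2) unfolding mem by blast
  qed
  have one: "1 \<in> carrier ?R" and zero: "0 \<in> carrier ?R" by (simp_all add: mem)
  have inv: "- p \<in> carrier ?R" if "p \<in> carrier ?R" for p
    using that by (simp add: mem)
  show ?thesis
  proof (rule cringI)
    show "abelian_group ?R"
    proof (rule abelian_groupI, unfold ops)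
      show "\<exists>y\<in>carrier ?R. y + x = 0" if "x \<in> carrier ?R" for x
        using inv[OF that] by (intro bexI[of _ "- x"]) simp_all
    qed (rule add zero add.assoc add.commute add_0; assumption?)+
    show "comm_monoid ?R"
      by (rule comm_monoidI, unfold ops) (rule mult one mult.assoc mult.commute mult_1; assumption?)+
    show "(x \<oplus>\<^bsub>?R\<^esub> y) \<otimes>\<^bsub>?R\<^esub> z = x \<otimes>\<^bsub>?R\<^esub> z \<oplus>\<^bsub>?R\<^esub> y \<otimes>\<^bsub>?R\<^esub> z" for x y z
      unfolding ops by (rule distrib_right)
  qed
qed

end

theory Submission
  imports Defs
begin

text \<open>Write \<open>w\<^sub>i\<close> for the exponent vector of the socle monomial of \<open>S/J\<^sub>i\<close>, so that \<open>R\<close> has as basis the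
  monomials dividing some \<open>x\<^bsup>w\<^sub>i\<^esup>\<close>; type three means that the \<open>w\<^sub>i\<close> form an antichain. The three
  conditions are linked in a cycle.

  The canonical module is the \<open>k\<close>-dual of \<open>R\<close>. If \<open>z \<in> \<omega>\<close> is killed by \<open>\<aa>\<close> and \<open>f \<in> \<omega>\<^sup>*\<close>, then
  \<open>x \<mapsto> f x \<odot> z\<close> is an endomorphism of \<open>\<omega>\<close>, hence multiplication by some \<open>s \<in> 0 : \<aa>\<close>; so
  \<open>0 : (0 : \<aa>)\<close> times \<open>f x\<close> kills \<open>z\<close>, and letting \<open>z\<close> vary gives \<open>\<omega>\<^sup>*(\<omega>) (0 : (0 : \<aa>)) \<subseteq> \<aa>\<close>.

  The colon condition for the irreducible ideals \<open>\<aa> = (x\<^sub>j\<^bsup>w\<^sub>p(j)+1\<^esup> : j)\<close> is a condition on the \<open>w\<^sub>i\<close>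
  alone, and an elementary case analysis of three vectors leaves exactly the five families.

  Conversely, for each member of the families and each variable \<open>x\<^sub>j\<close> some shift \<open>x\<^sup>-\<^sup>u \<mapsto> x\<^sup>d\<^sup>-\<^sup>u\<close> with
  \<open>d = w\<^sub>i + e\<^sub>j\<close> is a homomorphism from the dual of \<open>R\<close> to \<open>R\<close>; it takes the value \<open>x\<^sub>j\<close>.\<close>

section \<open>Three incomparable exponent vectors\<close>

text \<open>Conditions (2) and (3) coincide because \<open>R\<close> is Artinian: its only prime is
  the maximal ideal, so the empty list is the only system of parameters and has no members to
  restrict.

  The canonical module comes as an arbitrary injective hull. Its isomorphism with the dual of
  \<open>R\<close> is encoded by one k-linear functional \<tau> on \<omega>, equal to 1 on a
  generator of the residue field, as x \<mapsto> (r \<mapsto> \<tau>(r x)). Essentiality makes this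
  map one-to-one; injectivity makes \<omega> faithful, and faithfulness makes the map onto.

  One ring is presented in several ways: as given, with variables dropped and renamed, and through
  an abstract isomorphism with a listed ring. So \<open>R\<close> stays fixed, the surjection from a
  polynomial ring is a parameter, and \<omega> is never transported.

  The colon condition becomes a labelled graph on the three vectors, with an arrow from
  \<open>p\<close> to \<open>i\<close> labelled \<open>j\<close> when the monomial of
  \<open>w p\<close> divides \<open>x\<^sub>j\<close> times that of \<open>w i\<close>, but not that
  of \<open>w i\<close> itself. The scarcity of arrows among three vertices, played against the
  antichain property, leaves few shapes.\<close>

definition lef :: "nat set \<Rightarrow> (nat \<Rightarrow> nat) \<Rightarrow> (nat \<Rightarrow> nat) \<Rightarrow> bool" where
  "lef N f g \<longleftrightarrow> (\<forall>x\<in>N. f x \<le> g x)"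

definition inc :: "(nat \<Rightarrow> nat) \<Rightarrow> nat \<Rightarrow> nat \<Rightarrow> nat" where
  "inc f j = f(j := Suc (f j))"

text \<open>For \<open>j \<in> N\<close>: \<open>x^f\<close> divides \<open>x\<^sub>j x^g\<close>
  but not \<open>x^g\<close>. These labelled arrows carry the whole case analysis.\<close>

definition arrow :: "nat set \<Rightarrow> nat \<Rightarrow> (nat \<Rightarrow> nat) \<Rightarrow> (nat \<Rightarrow> nat) \<Rightarrow> bool" where
  "arrow N j f g \<longleftrightarrow> f j = Suc (g j) \<and> (\<forall>x\<in>N. x \<noteq> j \<longrightarrow> f x \<le> g x)"

text \<open>The case \<open>\<aa> = (x\<^sub>j\<^bsup>w\<^sub>p(j)+1\<^esup> : j)\<close> of the colon condition, tested on the monomials \<open>x\<^bsup>w\<^sub>p\<^esup>/x\<^sub>j\<close>.\<close>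

definition colon_cond :: "nat set \<Rightarrow> 'i set \<Rightarrow> ('i \<Rightarrow> nat \<Rightarrow> nat) \<Rightarrow> bool" where
  "colon_cond N T w \<longleftrightarrow> (\<forall>p\<in>T. \<forall>j\<in>N. 0 < w p j \<longrightarrow>
     (\<exists>i\<in>T. lef N (w p) (inc (w i) j) \<and>
       (\<forall>q\<in>T. lef N (inc (w i) j) (\<lambda>x. w q x + w p x) \<longrightarrow> lef N (w q) (inc (w i) j))))"

lemma arrow_of_lef:
  assumes "lef N f (inc g j)" "\<not> lef N f g" "j \<in> N"
  shows "arrow N j f g"
proof -
  have off: "\<forall>x\<in>N. x \<noteq> j \<longrightarrow> f x \<le> g x"
    using assms(1) unfolding lef_def inc_def by auto
  have "f j \<le> Suc (g j)" using assms(1,3) unfolding lef_def inc_def by auto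
  moreover have "\<not> f j \<le> g j" using off assms(2) unfolding lef_def by metis
  ultimately show ?thesis using off unfolding arrow_def by auto
qed

locale antichain3 =
  fixes N :: "nat set" and T :: "'i set" and w :: "'i \<Rightarrow> nat \<Rightarrow> nat"
  assumes anti: "\<And>p q. p \<in> T \<Longrightarrow> q \<in> T \<Longrightarrow> p \<noteq> q \<Longrightarrow> \<not> lef N (w p) (w q)"
    and cc: "colon_cond N T w"
begin

abbreviation edge :: "nat \<Rightarrow> 'i \<Rightarrow> 'i \<Rightarrow> bool" where
  "edge j p i \<equiv> arrow N j (w p) (w i)"

text \<open>The index that the colon condition supplies for \<open>(p, j)\<close> is either
  \<open>p\<close> itself or the head of an arrow leaving \<open>p\<close>. In the first case the
  inner hypothesis on \<open>q\<close> reduces to \<open>0 < w q j\<close>, so every other vector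
  involving \<open>x\<^sub>j\<close> points to \<open>p\<close>. In the second it holds at
  \<open>j\<close> for free, because \<open>inc (w i) j\<close> and \<open>w p\<close> agree
  there.\<close>

lemma cc_cases:
  assumes p: "p \<in> T" and j: "j \<in> N" and pos: "0 < w p j"
  obtains (self) "\<And>q. q \<in> T \<Longrightarrow> q \<noteq> p \<Longrightarrow> 0 < w q j \<Longrightarrow> edge j q p"
  | (other) i where "i \<in> T" "i \<noteq> p" "edge j p i"
      "\<And>q. q \<in> T \<Longrightarrow> q \<noteq> i \<Longrightarrow> (\<And>x. x \<in> N \<Longrightarrow> x \<noteq> j \<Longrightarrow> w i x \<le> w q x + w p x) \<Longrightarrow>
        edge j q i"
proof -
  obtain i where i: "i \<in> T" "lef N (w p) (inc (w i) j)"
    and third: "\<And>q. q \<in> T \<Longrightarrow> lef N (inc (w i) j) (\<lambda>x. w q x + w p x) \<Longrightarrow> lef N (w q) (inc (w i) j)"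
    using cc p j pos unfolding colon_cond_def by blast
  show thesis
  proof (cases "i = p")
    case True
    have "edge j q p" if q: "q \<in> T" "q \<noteq> p" "0 < w q j" for q
    proof (rule arrow_of_lef)
      show "lef N (w q) (inc (w p) j)"
        using third[OF q(1)] q(3) True unfolding lef_def inc_def by auto
    qed (use q p j anti in auto)
    then show thesis by (rule self)
  next
    case False
    have ar: "edge j p i"
      using arrow_of_lef[OF i(2) _ j] anti[OF p i(1)] False by auto
    have "edge j q i"
      if q: "q \<in> T" "q \<noteq> i" and le: "\<And>x. x \<in> N \<Longrightarrow> x \<noteq> j \<Longrightarrow> w i x \<le> w q x + w p x" for q
    proof (rule arrow_of_lef)
      show "lef N (w q) (inc (w i) j)"
        using ar le by (intro third[OF q(1)]) (auto simp: lef_def inc_def arrow_def)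
    qed (use q i j anti in auto)
    then show thesis by (rule other[OF i(1) False ar])
  qed
qed

lemma arrow_unique:
  assumes "edge j p i" "edge k p i" "j \<in> N" "k \<in> N"
  shows "j = k"
  using assms unfolding arrow_def by (metis Suc_n_not_le_n)

definition meeting_edges :: bool where
  "meeting_edges \<longleftrightarrow> (\<exists>i p q j. T = {i, p, q} \<and> i \<noteq> p \<and> i \<noteq> q \<and> p \<noteq> q \<and> j \<in> N \<and>
     edge j p i \<and> edge j q i)"

text \<open>Off \<open>j\<close> and \<open>k\<close> the arrows in both directions between
  \<open>i\<close> and \<open>p\<close> force \<open>w i\<close> and \<open>w p\<close> to agree. A
  positive coordinate of \<open>w i\<close> there can only be served by an arrow from
  \<open>i\<close> to \<open>q\<close>, and two vertices determine the label of an arrow, so there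
  is at most one such coordinate.\<close>

lemma two_arrows_aux:
  assumes T: "T = {i, p, q}" and dist: "i \<noteq> p" "i \<noteq> q" "p \<noteq> q" and j: "j \<in> N"
    and ap: "edge j p i" and aq: "edge j q i"
    and k: "k \<in> N" "k \<noteq> j" and ik: "edge k i p"
  shows "\<exists>l\<in>N. l \<noteq> j \<and> l \<noteq> k \<and> edge l i q \<and>
           (\<forall>x\<in>N. x \<notin> {j, k, l} \<longrightarrow> w i x = 0 \<and> w p x = 0 \<and> w q x = 0)"
proof -
  have mem: "i \<in> T" "p \<in> T" "q \<in> T" using T by auto
  have step: "edge x i q" if x: "x \<in> N" "x \<noteq> j" "x \<noteq> k" "0 < w i x" for x
  proof -
    have eq: "w p x = w i x" using ap ik x unfolding arrow_def by (auto intro: antisym)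
    from mem(1) x(1,4) show ?thesis
    proof (cases rule: cc_cases)
      case self
      have "edge x p i" using self[OF mem(2)] dist eq x by auto
      then show ?thesis using arrow_unique[OF ap] x j by blast
    next
      case (other i')
      then have "i' = p \<or> i' = q" using T by auto
      moreover have "i' \<noteq> p" using other(3) eq unfolding arrow_def by auto
      ultimately show ?thesis using other(3) by blast
    qed
  qed
  \<comment> \<open>If \<open>w i\<close> vanished off \<open>j\<close> and \<open>k\<close>, so
    would \<open>w q\<close>, and its value at \<open>k\<close> would decide whether it lies above
    \<open>w i\<close> or below \<open>w p\<close>.\<close>
  have "\<exists>l\<in>N. l \<noteq> j \<and> l \<noteq> k \<and> 0 < w i l"
  proof (rule ccontr)
    assume "\<not> ?thesis"
    then have z: "w i x = 0" if "x \<in> N" "x \<noteq> j" "x \<noteq> k" for x using that by auto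
    show False
    proof (cases "w q k = w i k")
      case True
      have "w i x \<le> w q x" if "x \<in> N" for x
        using that z[of x] True aq unfolding arrow_def by (cases "x = j"; cases "x = k") auto
      then have "lef N (w i) (w q)" unfolding lef_def by blast
      then show False using anti[OF mem(1,3)] dist by auto
    next
      case False
      then have lt: "w q k < w i k" using aq k unfolding arrow_def by (meson le_neq_implies_less)
      have "w q x \<le> w p x" if "x \<in> N" for x
        using that z[of x] lt ap aq ik unfolding arrow_def by (cases "x = j"; cases "x = k") auto
      then have "lef N (w q) (w p)" unfolding lef_def by blast
      then show False using anti[OF mem(3,2)] dist by auto
    qed
  qed
  then obtain l where l: "l \<in> N" "l \<noteq> j" "l \<noteq> k" "0 < w i l" by blast
  have al: "edge l i q" using step l by blast
  have zero: "w i x = 0" if "x \<in> N" "x \<notin> {j, k, l}" for x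
    using step[of x] arrow_unique[OF al _ l(1)] that by blast
  have "w i x = 0 \<and> w p x = 0 \<and> w q x = 0" if "x \<in> N" "x \<notin> {j, k, l}" for x
    using zero[OF that] that ap aq unfolding arrow_def by fastforce
  then show ?thesis using l al by blast
qed

text \<open>Some arrow with a label other than \<open>j\<close> must leave \<open>i\<close>:
  otherwise the colon condition at \<open>i\<close> makes \<open>w p\<close> and \<open>w q\<close>
  vanish wherever \<open>w i\<close> is positive off \<open>j\<close>, so that they agree
  everywhere. The outcome describes three quotients of the single monomial
  \<open>x\<^sub>j x^(w i)\<close>, by \<open>x\<^sub>j\<close>, \<open>x\<^sub>k\<close> and
  \<open>x\<^sub>l\<close>.\<close>

lemma two_arrows:
  assumes T: "T = {i, p, q}" and dist: "i \<noteq> p" "i \<noteq> q" "p \<noteq> q" and j: "j \<in> N"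
    and ap: "edge j p i" and aq: "edge j q i"
  shows "\<exists>k\<in>N. \<exists>l\<in>N. k \<noteq> j \<and> l \<noteq> j \<and> l \<noteq> k \<and> edge k i p \<and> edge l i q \<and>
           (\<forall>x\<in>N. x \<notin> {j, k, l} \<longrightarrow> w i x = 0 \<and> w p x = 0 \<and> w q x = 0)"
proof -
  have mem: "i \<in> T" "p \<in> T" "q \<in> T" using T by auto
  have "\<exists>k\<in>N. k \<noteq> j \<and> (edge k i p \<or> edge k i q)"
  proof (rule ccontr)
    assume no: "\<not> ?thesis"
    have "w p x = w q x" if x: "x \<in> N" for x
    proof (cases "x = j \<or> w i x = 0")
      case True
      then show ?thesis using ap aq x unfolding arrow_def by (metis bot_nat_0.extremum_unique)
    next
      case False
      then have "0 < w i x" by simp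
      with mem(1) x have "w p x = 0 \<and> w q x = 0"
      proof (cases rule: cc_cases)
        case self
        have "\<not> edge x p i" "\<not> edge x q i"
          using arrow_unique ap aq False x j by blast+
        then show ?thesis using self[OF mem(2) dist(1)[symmetric]] self[OF mem(3) dist(2)[symmetric]] by blast
      next
        case (other i')
        then show ?thesis using no False x T by auto
      qed
      then show ?thesis by simp
    qed
    then have "lef N (w p) (w q)" unfolding lef_def by auto
    then show False using anti[OF mem(2,3) dist(3)] by blast
  qed
  then obtain k where k: "k \<in> N" "k \<noteq> j" "edge k i p \<or> edge k i q" by blast
  from k(3) show ?thesis
  proof
    assume "edge k i p"
    from two_arrows_aux[OF T dist j ap aq k(1,2) this] this k show ?thesis by blast
  next
    assume a: "edge k i q"
    have T': "T = {i, q, p}" using T by auto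
    obtain l where "l \<in> N" "l \<noteq> j" "l \<noteq> k" "edge l i p"
      "\<forall>x\<in>N. x \<notin> {j, k, l} \<longrightarrow> w i x = 0 \<and> w q x = 0 \<and> w p x = 0"
      using two_arrows_aux[OF T' dist(2,1) dist(3)[symmetric] j aq ap k(1,2) a] by blast
    with a k show ?thesis by (intro bexI[of _ l] bexI[of _ k]) auto
  qed
qed

text \<open>Take \<open>p\<close> with the largest exponent at \<open>j\<close>. An arrow labelled
  \<open>j\<close> into \<open>p\<close> would exceed this maximum, so the colon condition gives one
  out of \<open>p\<close>. A second such arrow into its head is excluded by \<open>no\<close>, and
  the reason for its absence is the coordinate \<open>k\<close> at the end.\<close>

lemma shared_coordinate:
  assumes T: "T = {p1, p2, p3}" and dist: "p1 \<noteq> p2" "p1 \<noteq> p3" "p2 \<noteq> p3"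
    and no: "\<not> meeting_edges"
    and j: "j \<in> N" and ab: "a \<in> T" "b \<in> T" "a \<noteq> b" "0 < w a j" "0 < w b j"
  obtains p i s where "T = {p, i, s}" "p \<noteq> i" "p \<noteq> s" "i \<noteq> s" "edge j p i"
    "0 < w i j" "w s j = 0" "\<exists>k\<in>N. k \<noteq> j \<and> w s k + w p k < w i k"
proof -
  have fin: "finite T" "T \<noteq> {}" using T by auto
  obtain p where p: "p \<in> T" and mx: "\<And>q. q \<in> T \<Longrightarrow> w q j \<le> w p j"
  proof -
    have "Max ((\<lambda>q. w q j) ` T) \<in> (\<lambda>q. w q j) ` T" using fin by (intro Max_in) auto
    then obtain p where "p \<in> T" "Max ((\<lambda>q. w q j) ` T) = w p j" by blast
    with that fin show thesis by (metis Max_ge finite_imageI imageI)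
  qed
  obtain q where q: "q \<in> T" "q \<noteq> p" "0 < w q j" using ab by metis
  have ppos: "0 < w p j" using q mx[of q] by linarith
  obtain i where i: "i \<in> T" "i \<noteq> p" "edge j p i"
    and third: "\<And>q. q \<in> T \<Longrightarrow> q \<noteq> i \<Longrightarrow> (\<And>x. x \<in> N \<Longrightarrow> x \<noteq> j \<Longrightarrow> w i x \<le> w q x + w p x) \<Longrightarrow>
        edge j q i"
  proof -
    from p j ppos show thesis
    proof (cases rule: cc_cases)
      case self
      from self[OF q] mx[OF q(1)] show thesis unfolding arrow_def by simp
    next
      case (other i)
      then show thesis using that by blast
    qed
  qed
  obtain s where s: "T = {p, i, s}" "s \<noteq> p" "s \<noteq> i"
    using T dist p i(1,2) by auto
  have no': "\<not> edge j s i"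
  proof
    assume "edge j s i"
    moreover have "T = {i, p, s}" using s by auto
    ultimately show False using no s i j unfolding meeting_edges_def by metis
  qed
  have sm: "s \<in> T" using s by auto
  \<comment> \<open>An arrow labelled \<open>j\<close> changes the exponent at \<open>j\<close> by
    exactly one. If \<open>w i j\<close> were zero or \<open>w s j\<close> positive, the colon
    condition at \<open>i\<close> or \<open>s\<close> would produce an arrow of the wrong height, or
    one that enters \<open>i\<close> beside the arrow from \<open>p\<close>.\<close>
  have "0 < w i j \<and> w s j = 0"
  proof (cases "0 < w i j")
    case True
    from i(1) j True have "w s j = 0"
    proof (cases rule: cc_cases)
      case self
      then show ?thesis using no' sm s by auto
    next
      case (other i')
      then have "i' = p \<or> i' = s" using s by auto
      moreover have "i' \<noteq> p" using other(3) i(3) unfolding arrow_def by auto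
      ultimately have is': "edge j i s" using other(3) by blast
      show ?thesis
      proof (rule ccontr)
        assume "w s j \<noteq> 0"
        then have "0 < w s j" by simp
        with sm j show False
        proof (cases rule: cc_cases)
          case self
          from self[OF p] s ppos have "edge j p s" by auto
          then show False using i(3) is' unfolding arrow_def by auto
        next
          case (other i')
          then have "i' = p \<or> i' = i" using s by auto
          then show False using other(3) i(3) is' unfolding arrow_def by auto
        qed
      qed
    qed
    then show ?thesis using True by blast
  next
    case False
    then have p1: "w p j = 1" using i(3) unfolding arrow_def by auto
    have qs: "q = s" using q False s by auto
    have s1: "w s j = 1" using q mx[of q] p1 qs by auto
    then have "0 < w s j" by simp
    with sm j show ?thesis
    proof (cases rule: cc_cases)
      case self
      from self[OF p] s ppos have "edge j p s" by auto
      then show ?thesis using p1 s1 unfolding arrow_def by auto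
    next
      case (other i')
      then have "i' = p \<or> i' = i" using s by auto
      moreover have "i' \<noteq> p" using other(3) p1 s1 unfolding arrow_def by auto
      ultimately show ?thesis using other(3) no' by blast
    qed
  qed
  moreover have "\<exists>k\<in>N. k \<noteq> j \<and> w s k + w p k < w i k"
  proof (rule ccontr)
    assume "\<not> ?thesis"
    then have "edge j s i" using sm s by (intro third) auto
    with no' show False by blast
  qed
  ultimately show thesis using that s i by blast
qed

text \<open>Every further coordinate \<open>k\<close> of \<open>w p\<close> is shared with
  \<open>w i\<close>, because the arrow gives \<open>w p k \<le> w i k\<close>. The arrow that this
  shared coordinate provides joins the same two vectors; since its label differs from
  \<open>j\<close>, it runs in the opposite direction. Hence there is at most one such
  \<open>k\<close>.\<close>

lemma shared_cases:
  assumes T: "T = {p1, p2, p3}" and dist: "p1 \<noteq> p2" "p1 \<noteq> p3" "p2 \<noteq> p3"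
    and no: "\<not> meeting_edges"
    and j: "j \<in> N" and E: "T = {p, i, s}" "p \<noteq> i" "p \<noteq> s" "i \<noteq> s" "edge j p i"
      "0 < w i j" "w s j = 0"
  shows "(\<forall>k\<in>N. k \<noteq> j \<longrightarrow> w p k = 0) \<or>
    (\<exists>k\<in>N. k \<noteq> j \<and> edge k i p \<and> 0 < w p k \<and> w s k = 0 \<and>
      (\<forall>x\<in>N. x \<notin> {j, k} \<longrightarrow> w p x = 0 \<and> w i x = 0))"
proof -
  have sw: "edge k i p \<and> w s k = 0" if k: "k \<in> N" "k \<noteq> j" "0 < w p k" for k
  proof -
    have ik: "0 < w i k" using E(5) k unfolding arrow_def by (metis gr0I leD)
    obtain p' i' s' where e: "T = {p', i', s'}" "p' \<noteq> i'" "p' \<noteq> s'" "i' \<noteq> s'"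
        "edge k p' i'" "w s' k = 0"
      by (rule shared_coordinate[OF T dist no k(1), of p i]) (use E k ik in auto)
    have "s' \<in> {p, i, s}" using e(1) E(1) by blast
    then have "s' = s" using e(6) k(3) ik by auto
    moreover have "\<not> (p' = p \<and> i' = i)" using e(5) arrow_unique[OF E(5)] k j by blast
    moreover have "p' \<in> {p, i, s}" "i' \<in> {p, i, s}" using e(1) E(1) by blast+
    ultimately have "p' = i" "i' = p" using e(2-4) by auto
    then show ?thesis using e \<open>s' = s\<close> by auto
  qed
  show ?thesis
  proof (cases "\<forall>k\<in>N. k \<noteq> j \<longrightarrow> w p k = 0")
    case False
    then obtain k where k: "k \<in> N" "k \<noteq> j" "0 < w p k" by auto
    have "w p x = 0 \<and> w i x = 0" if x: "x \<in> N" "x \<notin> {j, k}" for x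
    proof -
      have "w p x = 0"
        using sw[of x] sw[OF k] arrow_unique[of k i p x] x k by auto
      moreover have "w i x \<le> w p x" using sw[OF k] x unfolding arrow_def by auto
      ultimately show ?thesis by simp
    qed
    then show ?thesis using sw[OF k] k by blast
  qed blast
qed

text \<open>The cases are numbered like the listed ideals. Case 1 is that of two arrows meeting with
  one label, case 5 that of disjoint supports. Otherwise a shared coordinate gives an arrow from
  \<open>p\<close> to \<open>i\<close>. A second coordinate of \<open>w p\<close> leads to case 3;
  without one, a further coordinate shared by \<open>i\<close> and \<open>s\<close> leads to case 2,
  or again to case 3 with \<open>s\<close> in the role of \<open>p\<close>, and its absence to case
  4.\<close>

theorem classification:
  assumes T: "T = {p1, p2, p3}" and dist: "p1 \<noteq> p2" "p1 \<noteq> p3" "p2 \<noteq> p3"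
  obtains
    (1) i p q j k l where "T = {i, p, q}" "j \<in> N" "k \<in> N" "l \<in> N" "k \<noteq> j" "l \<noteq> j" "l \<noteq> k"
      "edge j p i" "edge j q i" "edge k i p" "edge l i q"
      "\<And>x. x \<in> N \<Longrightarrow> x \<notin> {j, k, l} \<Longrightarrow> w i x = 0 \<and> w p x = 0 \<and> w q x = 0"
  | (2) p i s j k where "T = {p, i, s}" "j \<in> N" "k \<in> N" "k \<noteq> j"
      "w p j = Suc (w i j)" "w s k = Suc (w i k)" "\<And>x. x \<in> N \<Longrightarrow> x \<noteq> j \<Longrightarrow> w p x = 0"
      "\<And>x. x \<in> N \<Longrightarrow> x \<noteq> k \<Longrightarrow> w s x = 0" "\<exists>x\<in>N. x \<noteq> j \<and> x \<noteq> k \<and> 0 < w i x"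
  | (3) p i s j k where "T = {p, i, s}" "j \<in> N" "k \<in> N" "k \<noteq> j"
      "w p j = Suc (w i j)" "w i k = Suc (w p k)" "w s j = 0" "w s k = 0"
      "\<And>x. x \<in> N \<Longrightarrow> x \<notin> {j, k} \<Longrightarrow> w p x = 0 \<and> w i x = 0" "\<exists>x\<in>N. 0 < w s x"
  | (4) p i s j where "T = {p, i, s}" "j \<in> N" "w p j = Suc (w i j)" "w s j = 0"
      "\<And>x. x \<in> N \<Longrightarrow> x \<noteq> j \<Longrightarrow> w p x = 0" "\<And>x. x \<in> N \<Longrightarrow> x \<noteq> j \<Longrightarrow> w i x = 0 \<or> w s x = 0"
      "\<exists>x\<in>N. 0 < w s x" "\<exists>x\<in>N. x \<noteq> j \<and> 0 < w i x"
  | (5) "\<And>x p q. x \<in> N \<Longrightarrow> p \<in> T \<Longrightarrow> q \<in> T \<Longrightarrow> p \<noteq> q \<Longrightarrow> w p x = 0 \<or> w q x = 0"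
      "\<And>p. p \<in> T \<Longrightarrow> \<exists>x\<in>N. 0 < w p x"
proof (cases meeting_edges)
  case True
  then obtain i p q j where *: "T = {i, p, q}" "i \<noteq> p" "i \<noteq> q" "p \<noteq> q" "j \<in> N"
      "edge j p i" "edge j q i"
    unfolding meeting_edges_def by blast
  obtain k l where "k \<in> N" "l \<in> N" "k \<noteq> j" "l \<noteq> j" "l \<noteq> k" "edge k i p"
    "edge l i q" "\<forall>x\<in>N. x \<notin> {j, k, l} \<longrightarrow> w i x = 0 \<and> w p x = 0 \<and> w q x = 0"
    using two_arrows[OF *] by blast
  then show thesis using 1[OF *(1,5) _ _ _ _ _ *(6,7)] by blast
next
  case no: False
  have nz: "\<exists>x\<in>N. 0 < w p x" if p: "p \<in> T" for p
  proof -
    obtain q where "q \<in> T" "q \<noteq> p" using T dist by blast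
    then have "\<not> lef N (w p) (w q)" using anti p by blast
    then show ?thesis unfolding lef_def by (metis gr0I le0)
  qed
  show thesis
  proof (cases "\<exists>j\<in>N. \<exists>a\<in>T. \<exists>b\<in>T. a \<noteq> b \<and> 0 < w a j \<and> 0 < w b j")
    case False
    show thesis
    proof (rule 5)
      show "w p x = 0 \<or> w q x = 0" if "x \<in> N" "p \<in> T" "q \<in> T" "p \<noteq> q" for x p q
        using False that by (metis gr0I)
    qed (rule nz)
  next
    case True
    then obtain j a b where j: "j \<in> N" and ab: "a \<in> T" "b \<in> T" "a \<noteq> b" "0 < w a j" "0 < w b j"
      by blast
    obtain p i s where E: "T = {p, i, s}" "p \<noteq> i" "p \<noteq> s" "i \<noteq> s" "edge j p i"
      "0 < w i j" "w s j = 0" and ex: "\<exists>k\<in>N. k \<noteq> j \<and> w s k + w p k < w i k"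
      by (rule shared_coordinate[OF T dist no j ab])
    have three: thesis if j: "j \<in> N" and E: "T = {p, i, s}" "edge j p i" "w s j = 0"
      and ex: "\<exists>k\<in>N. k \<noteq> j \<and> edge k i p \<and> 0 < w p k \<and> w s k = 0 \<and>
        (\<forall>x\<in>N. x \<notin> {j, k} \<longrightarrow> w p x = 0 \<and> w i x = 0)" for p i s j
    proof -
      obtain k where k: "k \<in> N" "k \<noteq> j" "edge k i p" "w s k = 0"
        "\<forall>x\<in>N. x \<notin> {j, k} \<longrightarrow> w p x = 0 \<and> w i x = 0" using ex by blast
      have "w p j = Suc (w i j)" "w i k = Suc (w p k)" using k(3) E(2) unfolding arrow_def by blast+
      moreover have "s \<in> T" using E(1) by blast
      ultimately show thesis using 3[OF E(1) j k(1,2) _ _ E(3) k(4)] k(5) nz by blast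
    qed
    from shared_cases[OF T dist no j E] show thesis
    proof
      assume p0: "\<forall>k\<in>N. k \<noteq> j \<longrightarrow> w p k = 0"
      show thesis
      proof (cases "\<exists>x\<in>N. x \<noteq> j \<and> 0 < w i x \<and> 0 < w s x")
        case True
        then obtain x where x: "x \<in> N" "x \<noteq> j" "0 < w i x" "0 < w s x" by blast
        obtain p' i' s' where e: "T = {p', i', s'}" "p' \<noteq> i'" "p' \<noteq> s'" "i' \<noteq> s'"
            "edge x p' i'" "w s' x = 0"
          by (rule shared_coordinate[OF T dist no x(1), of i s]) (use E x in auto)
        have "s' \<in> {p, i, s}" using e(1) E(1) by blast
        then have "s' = p" using e(6) x by auto
        \<comment> \<open>An arrow from \<open>i\<close> to \<open>s\<close> labelled
          \<open>x\<close> would need \<open>w i j \<le> w s j\<close>, but \<open>w i j\<close> is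
          positive and \<open>w s j\<close> is zero.\<close>
        moreover have "\<not> (p' = i \<and> i' = s)"
          using e(5) E(6,7) x(2) j unfolding arrow_def by auto
        moreover have "p' \<in> {p, i, s}" "i' \<in> {p, i, s}" using e(1) E(1) by blast+
        ultimately have ar: "edge x s i" using e(2-5) by auto
        have T': "T = {s, i, p}" using E(1) by auto
        have "w p x = 0" using p0 x by blast
        from shared_cases[OF T dist no x(1) T' E(4)[symmetric] E(3)[symmetric] E(2)[symmetric] ar x(3) this]
        show thesis
        proof
          assume s0: "\<forall>k\<in>N. k \<noteq> x \<longrightarrow> w s k = 0"
          \<comment> \<open>The third coordinate that case 2 requires. It differs from
            \<open>x\<close> because \<open>w i x < w s x\<close>.\<close>
          obtain k where k: "k \<in> N" "k \<noteq> j" "w s k + w p k < w i k" using ex by blast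
          have kx: "k \<noteq> x" using k(3) ar unfolding arrow_def by auto
          have "0 < w i k" using k(3) by simp
          moreover have "w p j = Suc (w i j)" "w s x = Suc (w i x)"
            using E(5) ar unfolding arrow_def by blast+
          ultimately show thesis using 2[OF E(1) j x(1,2)] p0 s0 k(1,2) kx by blast
        next
          assume "\<exists>k\<in>N. k \<noteq> x \<and> edge k i s \<and> 0 < w s k \<and> w p k = 0 \<and>
            (\<forall>xa\<in>N. xa \<notin> {x, k} \<longrightarrow> w s xa = 0 \<and> w i xa = 0)"
          from three[OF x(1) T' ar \<open>w p x = 0\<close> this] show thesis .
        qed
      next
        case False
        have "w p j = Suc (w i j)" using E(5) unfolding arrow_def by blast
        moreover have "\<exists>x\<in>N. x \<noteq> j \<and> 0 < w i x" using ex by fastforce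
        moreover have "s \<in> T" using E(1) by blast
        ultimately show thesis using 4[OF E(1) j _ E(7)] p0 False nz by (metis gr0I)
      qed
    qed (rule three[OF j E(1,5,7)])
  qed
qed

end

section \<open>Polynomials and monomial ideals\<close>

abbreviation lookup where "lookup \<equiv> Poly_Mapping.lookup"
abbreviation keys where "keys \<equiv> Poly_Mapping.keys"
abbreviation single where "single \<equiv> Poly_Mapping.single"

lemma carrier_mpoly_iff: "p \<in> carrier (mpoly_ring n) \<longleftrightarrow> (\<forall>t\<in>keys p. keys t \<subseteq> {1..n})"
  by (simp add: mpoly_ring_def)

lemma mpoly_ring_ops [simp]:
  "x \<otimes>\<^bsub>mpoly_ring n\<^esub> y = x * y" "x \<oplus>\<^bsub>mpoly_ring n\<^esub> y = x + y"
  "\<one>\<^bsub>mpoly_ring n\<^esub> = 1" "\<zero>\<^bsub>mpoly_ring n\<^esub> = 0"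
  by (simp_all add: mpoly_ring_def)

lemma single_in_mpoly: "keys t \<subseteq> {1..n} \<Longrightarrow> single t c \<in> carrier (mpoly_ring n)"
  by (simp add: carrier_mpoly_iff)

lemma mpoly_closed:
  assumes "p \<in> carrier (mpoly_ring n)" "q \<in> carrier (mpoly_ring n)"
  shows "p + q \<in> carrier (mpoly_ring n)" "p * q \<in> carrier (mpoly_ring n)"
    "p - q \<in> carrier (mpoly_ring n)"
proof -
  interpret cring "mpoly_ring n" by (rule cring_mpoly_ring)
  show "p + q \<in> carrier (mpoly_ring n)" using add.m_closed[OF assms] by simp
  show "p * q \<in> carrier (mpoly_ring n)" using m_closed[OF assms] by simp
  show "p - q \<in> carrier (mpoly_ring n)"
    using assms keys_diff[of p q] unfolding carrier_mpoly_iff by blast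
qed

lemma sum_in_mpoly:
  "(\<And>i. i \<in> A \<Longrightarrow> f i \<in> carrier (mpoly_ring n)) \<Longrightarrow> sum f A \<in> carrier (mpoly_ring n)"
  by (induction A rule: infinite_finite_induct) (auto simp: mpoly_closed carrier_mpoly_iff[of 0])

lemma poly_mapping_sum_singles: "finite A \<Longrightarrow> keys p \<subseteq> A \<Longrightarrow> p = (\<Sum>t\<in>A. single t (lookup p t))"
  by (rule poly_mapping_eqI)
    (auto simp: lookup_sum lookup_single when_def in_keys_iff sum.delta' intro: ccontr)

lemma lookup_sum_singles: "finite A \<Longrightarrow> t \<in> A \<Longrightarrow> lookup (\<Sum>t\<in>A. single t (c t)) t = c t"
  by (simp add: lookup_sum lookup_single when_def sum.delta')

text \<open>The library's \<open>\<le>\<close> on polynomial mappings is lexicographic.\<close>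

definition dvs :: "('a \<Rightarrow>\<^sub>0 nat) \<Rightarrow> ('a \<Rightarrow>\<^sub>0 nat) \<Rightarrow> bool" where
  "dvs s t \<longleftrightarrow> (\<forall>i. lookup s i \<le> lookup t i)"

lemma dvs_add_diff: "dvs s t \<Longrightarrow> s + (t - s) = t"
  by (rule poly_mapping_eqI) (simp add: dvs_def lookup_add lookup_minus)

lemma dvs_add: "dvs s (s + t)" "dvs t (s + t)"
  by (simp_all add: dvs_def lookup_add)

lemma dvs_refl: "dvs t t" by (simp add: dvs_def)

lemma dvs_trans: "dvs s t \<Longrightarrow> dvs t u \<Longrightarrow> dvs s u"
  unfolding dvs_def by (meson le_trans)

lemma dvs_keys: "dvs s t \<Longrightarrow> keys s \<subseteq> keys t"
  unfolding dvs_def by (metis bot_nat_0.extremum_uniqueI in_keys_iff subsetI)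

lemma lookup_single_mult:
  fixes p :: "('a \<Rightarrow>\<^sub>0 nat) \<Rightarrow>\<^sub>0 'k::comm_ring_1"
  shows "lookup (single v c * p) t = (if dvs v t then c * lookup p (t - v) else 0)"
proof -
  have p: "p = (\<Sum>s\<in>keys p. single s (lookup p s))"
    by (rule poly_mapping_sum_singles) auto
  have "lookup (single v c * p) t = (\<Sum>s\<in>keys p. (c * lookup p s) when (v + s = t))"
    by (subst p) (simp add: sum_distrib_left mult_single lookup_sum lookup_single)
  also have "\<dots> = (if dvs v t then c * lookup p (t - v) else 0)"
  proof (cases "dvs v t")
    case True
    have "v + s = t \<longleftrightarrow> s = t - v" for s
      using dvs_add_diff[OF True] by auto
    then show ?thesis using True by (simp add: when_def sum.delta in_keys_iff)
  next
    case False
    then have "v + s \<noteq> t" for s using dvs_add(1) by metis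
    then show ?thesis using False by (simp add: when_def)
  qed
  finally show ?thesis .
qed

lemma keys_mult_dvs: "t \<in> keys (p * q) \<Longrightarrow> \<exists>s\<in>keys p. dvs s t"
  using keys_mult[of p q] dvs_add(1) by fastforce

text \<open>For \<open>B\<close> closed under divisors this is the monomial ideal with standard
  monomials \<open>B\<close>. Working with the complement turns intersections of ideals into unions
  and exhibits a basis of the quotient.\<close>

definition vanishing :: "nat \<Rightarrow> (nat \<Rightarrow>\<^sub>0 nat) set \<Rightarrow> 'k::field mpoly set" where
  "vanishing n B = {p \<in> carrier (mpoly_ring n). keys p \<inter> B = {}}"

lemma vanishing_cong:
  "(\<And>t. keys t \<subseteq> {1..n} \<Longrightarrow> t \<in> A \<longleftrightarrow> t \<in> B) \<Longrightarrow> vanishing n A = vanishing n B"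
  unfolding vanishing_def carrier_mpoly_iff by blast

lemma ideal_vanishing:
  assumes down: "\<And>s t. t \<in> A \<Longrightarrow> dvs s t \<Longrightarrow> s \<in> A"
  shows "ideal (vanishing n A :: 'k::field mpoly set) (mpoly_ring n)" (is "ideal ?V ?S")
proof -
  interpret S: cring "?S :: 'k mpoly ring" by (rule cring_mpoly_ring)
  show ?thesis
  proof (rule idealI)
    show "ring ?S" by unfold_locales
    show "subgroup ?V (add_monoid ?S)"
    proof (rule subgroup.intro)
      show "x \<otimes>\<^bsub>add_monoid ?S\<^esub> y \<in> ?V" if "x \<in> ?V" "y \<in> ?V" for x y
        using that mpoly_closed(1)[of x n y] Poly_Mapping.keys_add[of x y] unfolding vanishing_def by auto
      fix x assume x: "x \<in> ?V"
      have "inv\<^bsub>add_monoid ?S\<^esub> x = \<ominus>\<^bsub>?S\<^esub> x" by (simp add: a_inv_def)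
      also have "\<dots> = - x"
        by (rule S.minus_equality) (use x in \<open>auto simp: vanishing_def carrier_mpoly_iff\<close>)
      finally show "inv\<^bsub>add_monoid ?S\<^esub> x \<in> ?V" using x by (auto simp: vanishing_def carrier_mpoly_iff)
    qed (auto simp: vanishing_def carrier_mpoly_iff)
    fix a x assume ax: "a \<in> ?V" "x \<in> carrier ?S"
    have "keys (a * x) \<inter> A = {}"
      using ax(1) keys_mult_dvs[of _ a x] down unfolding vanishing_def by fast
    then show "a \<otimes>\<^bsub>?S\<^esub> x \<in> ?V" "x \<otimes>\<^bsub>?S\<^esub> a \<in> ?V"
      using ax mpoly_closed(2)[of a n x] by (auto simp: vanishing_def mult.commute)
  qed
qed

text \<open>A monomial \<open>x^t\<close> divisible by a generator \<open>x^g\<close> is the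
  multiple of \<open>x^g\<close> by \<open>x^(t - g)\<close>, so every term of a polynomial on the
  right lies in the ideal. Conversely the right side is itself an ideal, and it contains the
  generators.\<close>

lemma Idl_monomials:
  assumes G: "\<And>t. t \<in> G \<Longrightarrow> keys t \<subseteq> {1..n}"
  shows "Idl\<^bsub>mpoly_ring n\<^esub> ((\<lambda>t. single t (1::'k::field)) ` G) = vanishing n {t. \<forall>g\<in>G. \<not> dvs g t}"
    (is "Idl\<^bsub>?S\<^esub> ?G = ?V")
proof -
  interpret S: cring "?S :: 'k mpoly ring" by (rule cring_mpoly_ring)
  have GS: "?G \<subseteq> carrier ?S" using single_in_mpoly[OF G] by blast
  have "ideal ?V ?S" by (rule ideal_vanishing) (use dvs_trans in blast)
  moreover have "?G \<subseteq> ?V" using GS by (auto simp: vanishing_def intro: dvs_refl)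
  ultimately have "Idl\<^bsub>?S\<^esub> ?G \<subseteq> ?V" by (rule S.genideal_minimal)
  moreover have "?V \<subseteq> Idl\<^bsub>?S\<^esub> ?G"
  proof
    fix p :: "'k mpoly" assume p: "p \<in> ?V"
    interpret J: ideal "Idl\<^bsub>?S\<^esub> ?G" ?S by (rule S.genideal_ideal[OF GS])
    have mono: "single t c \<in> Idl\<^bsub>?S\<^esub> ?G" if t: "t \<in> keys p" for t c
    proof -
      obtain g where g: "g \<in> G" "dvs g t" using p t by (auto simp: vanishing_def)
      have kt: "keys t \<subseteq> {1..n}" using p t by (auto simp: vanishing_def carrier_mpoly_iff)
      have "single (t - g) c \<in> carrier ?S"
        using kt by (intro single_in_mpoly) (auto simp: in_keys_iff lookup_minus)
      moreover have "single g 1 \<in> Idl\<^bsub>?S\<^esub> ?G" using S.genideal_self[OF GS] g(1) by blast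
      ultimately have "single g 1 \<otimes>\<^bsub>?S\<^esub> single (t - g) c \<in> Idl\<^bsub>?S\<^esub> ?G" by (rule J.I_r_closed[rotated])
      then show ?thesis using dvs_add_diff[OF g(2)] by (simp add: mult_single)
    qed
    have "(\<Sum>t\<in>A. single t (lookup p t)) \<in> Idl\<^bsub>?S\<^esub> ?G" if "A \<subseteq> keys p" for A
      using finite_subset[OF that finite_keys] that
    proof (induction A rule: finite_induct)
      case empty
      show ?case using J.zero_closed by simp
    next
      case (insert t A)
      have "single t (lookup p t) \<in> Idl\<^bsub>?S\<^esub> ?G" using insert.prems by (intro mono) auto
      from J.a_closed[OF this] insert show ?case by simp
    qed
    then show "p \<in> Idl\<^bsub>?S\<^esub> ?G"
      by (subst poly_mapping_sum_singles[OF finite_keys order.refl]) blast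
  qed
  ultimately show ?thesis by (rule antisym)
qed

section \<open>The ideals of the theorem through their standard monomials\<close>

lemma Var_power: "Var i ^ e = single (single i e) (1::'k::field)"
  by (induction e) (auto simp: Var_def mult_single simp flip: single_add)

lemma prod_Var_powers:
  "finite A \<Longrightarrow> (\<Prod>i\<in>A. Var i ^ f i) = single (\<Sum>i\<in>A. single i (f i)) (1::'k::field)"
  by (induction A rule: finite_induct) (auto simp: Var_power mult_single)

text \<open>The exponents of all divisors of the monomials \<open>x^w\<close>. The members of
  \<open>W\<close> are plain functions, whose values outside \<open>{1..n}\<close> are
  ignored.\<close>

definition down_set :: "nat \<Rightarrow> (nat \<Rightarrow> nat) set \<Rightarrow> (nat \<Rightarrow>\<^sub>0 nat) set" where
  "down_set n W = {u. keys u \<subseteq> {1..n} \<and> (\<exists>w\<in>W. \<forall>i\<in>{1..n}. lookup u i \<le> w i)}"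

lemma dvs_single: "dvs (single i e) t \<longleftrightarrow> e \<le> lookup t i"
  by (auto simp: dvs_def lookup_single when_def)

text \<open>The largest exponent of the \<open>i\<close>-th variable outside the ideal is
  \<open>e i - 1\<close>. For \<open>e i = 0\<close> the ideal is the whole ring and truncated
  subtraction would give the wrong answer, hence the assumption.\<close>

lemma pow_ideal_eq:
  assumes "\<And>i. i \<in> {1..n} \<Longrightarrow> 1 \<le> e i"
  shows "pow_ideal n e = (vanishing n (down_set n {\<lambda>i. e i - 1}) :: 'k::field mpoly set)"
proof -
  have "{Var i ^ e i | i. i \<in> {1..n}} = (\<lambda>t. single t (1::'k)) ` ((\<lambda>i. single i (e i)) ` {1..n})"
    by (auto simp: Var_power)
  then have "pow_ideal n e = (vanishing n {t. \<forall>g\<in>(\<lambda>i. single i (e i)) ` {1..n}. \<not> dvs g t} :: 'k mpoly set)"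
    unfolding pow_ideal_def by (simp only:, intro Idl_monomials) (auto split: if_splits)
  also have "\<dots> = vanishing n (down_set n {\<lambda>i. e i - 1})"
  proof -
    have "(\<forall>i\<in>{1..n}. \<not> e i \<le> lookup t i) \<longleftrightarrow> (\<forall>i\<in>{1..n}. lookup t i \<le> e i - 1)" for t
      using assms by (intro ball_cong refl) force
    then show ?thesis by (intro vanishing_cong) (simp add: down_set_def dvs_single)
  qed
  finally show ?thesis .
qed

lemma vanishing_Int: "vanishing n A \<inter> vanishing n B = vanishing n (A \<union> B)"
  by (auto simp: vanishing_def)

lemma down_set_Un: "down_set n V \<union> down_set n W = down_set n (V \<union> W)"
  by (auto simp: down_set_def)

lemma pow_ideal_Int3:
  assumes "\<And>i. i \<in> {1..n} \<Longrightarrow> 1 \<le> e i" "\<And>i. i \<in> {1..n} \<Longrightarrow> 1 \<le> f i" "\<And>i. i \<in> {1..n} \<Longrightarrow> 1 \<le> g i"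
  shows "pow_ideal n e \<inter> pow_ideal n f \<inter> pow_ideal n g =
    (vanishing n (down_set n {\<lambda>i. e i - 1, \<lambda>i. f i - 1, \<lambda>i. g i - 1}) :: 'k::field mpoly set)"
proof -
  have *: "pow_ideal n h = (vanishing n (down_set n {\<lambda>i. h i - 1}) :: 'k mpoly set)"
    if "h \<in> {e, f, g}" for h
    by (rule pow_ideal_eq) (use that assms in auto)
  have "{\<lambda>i. e i - 1} \<union> {\<lambda>i. f i - 1} \<union> {\<lambda>i. g i - 1} = {\<lambda>i. e i - 1, \<lambda>i. f i - 1, \<lambda>i. g i - 1}"
    by blast
  then show ?thesis using *[of e] *[of f] *[of g] by (simp add: vanishing_Int down_set_Un)
qed

text \<open>The added generator is the socle monomial of the complete intersection defined by the
  powers \<open>x\<^sub>i^(a i)\<close>. Removing it leaves its proper divisors, whose maximal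
  members are its quotients by one variable. A variable with \<open>a j = 1\<close> does not occur
  in it, hence \<open>2 \<le> a j\<close>.\<close>

lemma Idl_item1:
  assumes "\<forall>i\<in>{1..m}. 1 \<le> a i"
  shows "Idl\<^bsub>mpoly_ring m\<^esub> ({Var i ^ a i | i. i \<in> {1..m}} \<union> {\<Prod>i\<in>{1..m}. Var i ^ (a i - 1)}) =
    (vanishing m (down_set m {(\<lambda>i. a i - 1)(j := a j - 2) | j. j \<in> {1..m} \<and> 2 \<le> a j}) :: 'k::field mpoly set)"
    (is "_ = vanishing m (down_set m ?W)")
proof -
  let ?s = "\<Sum>i\<in>{1..m}. single i (a i - 1)"
  let ?G = "(\<lambda>i. single i (a i)) ` {1..m} \<union> {?s}"
  have ls: "lookup ?s i = (if i \<in> {1..m} then a i - 1 else 0)" for i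
    by (simp add: lookup_sum lookup_single when_def)
  have ks: "keys ?s \<subseteq> {1..m}" unfolding in_keys_iff subset_iff ls by simp
  have "{Var i ^ a i | i. i \<in> {1..m}} \<union> {\<Prod>i\<in>{1..m}. Var i ^ (a i - 1)} = (\<lambda>t. single t (1::'k)) ` ?G"
    unfolding prod_Var_powers[OF finite_atLeastAtMost] by (auto simp: Var_power)
  then have "Idl\<^bsub>mpoly_ring m\<^esub> ({Var i ^ a i | i. i \<in> {1..m}} \<union> {\<Prod>i\<in>{1..m}. Var i ^ (a i - 1)}) =
      (vanishing m {t. \<forall>g\<in>?G. \<not> dvs g t} :: 'k mpoly set)"
    using ks by (simp only:, intro Idl_monomials) (auto split: if_splits)
  also have "\<dots> = vanishing m (down_set m ?W)"
  proof -
    have ds: "dvs ?s t \<longleftrightarrow> (\<forall>i\<in>{1..m}. a i - 1 \<le> lookup t i)" for t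
      unfolding dvs_def ls by auto
    have G: "(\<forall>g\<in>?G. \<not> dvs g t) \<longleftrightarrow> (\<forall>i\<in>{1..m}. lookup t i < a i) \<and> (\<exists>j\<in>{1..m}. lookup t j < a j - 1)" for t
      using ds[of t] by (auto simp: dvs_single not_le)
    have "(\<forall>g\<in>?G. \<not> dvs g t) \<longleftrightarrow> (\<exists>w\<in>?W. \<forall>i\<in>{1..m}. lookup t i \<le> w i)" for t
      unfolding G
    proof safe
      fix j assume all: "\<forall>i\<in>{1..m}. lookup t i < a i" and j: "j \<in> {1..m}" "lookup t j < a j - 1"
      have "lookup t i \<le> ((\<lambda>i. a i - 1)(j := a j - 2)) i" if "i \<in> {1..m}" for i
        using bspec[OF all that] j(2) by (cases "i = j") auto
      moreover have "(\<lambda>i. a i - 1)(j := a j - 2) \<in> ?W" using j by auto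
      ultimately show "\<exists>w\<in>?W. \<forall>i\<in>{1..m}. lookup t i \<le> w i" by blast
    next
      fix j assume j: "j \<in> {1..m}" "2 \<le> a j"
        and le: "\<forall>i\<in>{1..m}. lookup t i \<le> ((\<lambda>i. a i - 1)(j := a j - 2)) i"
      have "lookup t j < a j - 1" using bspec[OF le j(1)] j by simp
      then show "\<exists>j\<in>{1..m}. lookup t j < a j - 1" using j(1) by blast
      show "lookup t i < a i" if "i \<in> {1..m}" for i
        using bspec[OF le that] bspec[OF assms that] j by (cases "i = j") auto
    qed
    then show ?thesis by (intro vanishing_cong) (simp add: down_set_def)
  qed
  finally show ?thesis .
qed

text \<open>Needed at two levels: \<open>push \<sigma>\<close> renames variables inside an exponent
  vector, and \<open>push (push \<sigma>)\<close> renames them in a polynomial.\<close>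

definition push :: "('a \<Rightarrow> 'b) \<Rightarrow> ('a \<Rightarrow>\<^sub>0 'c::comm_monoid_add) \<Rightarrow> ('b \<Rightarrow>\<^sub>0 'c)" where
  "push g p = (\<Sum>t\<in>keys p. single (g t) (lookup p t))"

lemma push_superset: "finite A \<Longrightarrow> keys p \<subseteq> A \<Longrightarrow> push g p = (\<Sum>t\<in>A. single (g t) (lookup p t))"
  unfolding push_def by (rule sum.mono_neutral_left) (auto simp: in_keys_iff)

lemma push_zero [simp]: "push g 0 = 0" by (simp add: push_def)

lemma push_single [simp]: "push g (single t c) = single (g t) c"
  by (cases "c = 0") (auto simp: push_def)

lemma push_add: "push g (p + q) = push g p + push g q"
proof -
  let ?A = "keys p \<union> keys q"
  have "push g (p + q) = (\<Sum>t\<in>?A. single (g t) (lookup (p + q) t))"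
    by (rule push_superset) (use Poly_Mapping.keys_add[of p q] in auto)
  also have "\<dots> = push g p + push g q"
    using push_superset[of ?A p g] push_superset[of ?A q g]
    by (simp add: lookup_add single_add sum.distrib)
  finally show ?thesis .
qed

lemma push_sum: "push g (sum f A) = (\<Sum>x\<in>A. push g (f x))"
  by (induction A rule: infinite_finite_induct) (auto simp: push_add)

lemma push_mult:
  fixes p q :: "'a::comm_monoid_add \<Rightarrow>\<^sub>0 'k::comm_ring_1"
  assumes "\<And>s t. g (s + t) = g s + g t"
  shows "push g (p * q) = push g p * push g q"
proof -
  have "p * q = (\<Sum>s\<in>keys p. single s (lookup p s)) * (\<Sum>t\<in>keys q. single t (lookup q t))"
    using poly_mapping_sum_singles[OF finite_keys order.refl] by (intro arg_cong2[of _ _ _ _ "(*)"])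
  also have "\<dots> = (\<Sum>s\<in>keys p. \<Sum>t\<in>keys q. single (s + t) (lookup p s * lookup q t))"
    by (simp add: sum_product mult_single)
  finally have "p * q = (\<Sum>s\<in>keys p. \<Sum>t\<in>keys q. single (s + t) (lookup p s * lookup q t))" .
  then show ?thesis
    by (simp add: push_sum assms) (simp add: push_def sum_product mult_single)
qed

lemma lookup_push:
  assumes "inj_on g A" "keys p \<subseteq> A" "t \<in> A"
  shows "lookup (push g p) (g t) = lookup p t"
proof -
  have "lookup (push g p) (g t) = (\<Sum>s\<in>keys p. lookup p s when s = t)"
    unfolding push_def lookup_sum
    by (rule sum.cong) (use assms in \<open>auto simp: lookup_single when_def inj_on_def\<close>)
  also have "\<dots> = lookup p t" by (simp add: when_def sum.delta' in_keys_iff)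
  finally show ?thesis .
qed

lemma keys_push:
  assumes "inj_on g A" "keys p \<subseteq> A"
  shows "keys (push g p) = g ` keys p"
proof
  show "keys (push g p) \<subseteq> g ` keys p"
    using keys_sum[of "\<lambda>t. single (g t) (lookup p t)" "keys p"] unfolding push_def
    by (auto split: if_splits)
  show "g ` keys p \<subseteq> keys (push g p)"
    using lookup_push[OF assms] assms(2) by (auto simp: in_keys_iff)
qed

section \<open>Quotients by monomial ideals\<close>

text \<open>A subspace maximal among those that contain \<open>E\<close> and avoid \<open>v\<close>
  is a complement of the line through \<open>v\<close>, and \<phi> reads off the coefficient of
  \<open>v\<close>. Zorn's lemma replaces a basis: the spaces in question are the polynomial ring
  and \<omega>, about whose dimension nothing is known at that stage.\<close>

lemma linear_functional_exists:
  fixes V (structure) and s :: "'k::field \<Rightarrow> 'v \<Rightarrow> 'v"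
  assumes V: "abelian_group V"
    and s_closed: "\<And>c x. x \<in> carrier V \<Longrightarrow> s c x \<in> carrier V"
    and s_add: "\<And>c x y. x \<in> carrier V \<Longrightarrow> y \<in> carrier V \<Longrightarrow> s c (x \<oplus> y) = s c x \<oplus> s c y"
    and s_plus: "\<And>c d x. x \<in> carrier V \<Longrightarrow> s (c + d) x = s c x \<oplus> s d x"
    and s_mult: "\<And>c d x. x \<in> carrier V \<Longrightarrow> s (c * d) x = s c (s d x)"
    and s_one: "\<And>x. x \<in> carrier V \<Longrightarrow> s 1 x = x"
    and E: "E \<subseteq> carrier V" "\<zero> \<in> E" "\<And>x y. x \<in> E \<Longrightarrow> y \<in> E \<Longrightarrow> x \<oplus> y \<in> E"
      "\<And>c x. x \<in> E \<Longrightarrow> s c x \<in> E"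
    and v: "v \<in> carrier V" "v \<notin> E"
  obtains \<phi> :: "'v \<Rightarrow> 'k"
    where "\<And>x y. x \<in> carrier V \<Longrightarrow> y \<in> carrier V \<Longrightarrow> \<phi> (x \<oplus> y) = \<phi> x + \<phi> y"
      "\<And>c x. x \<in> carrier V \<Longrightarrow> \<phi> (s c x) = c * \<phi> x" "\<And>x. x \<in> E \<Longrightarrow> \<phi> x = 0" "\<phi> v = 1"
proof -
  interpret V: abelian_group V by (rule V)
  have s_zero: "s 0 x = \<zero>" if x: "x \<in> carrier V" for x
  proof -
    have "s 0 x \<oplus> s 0 x = s 0 x" using s_plus[OF x, of 0 0] by simp
    then show ?thesis using V.add.l_cancel_one[OF s_closed[OF x] s_closed[OF x]] by simp
  qed
  define sub where "sub M \<longleftrightarrow> E \<subseteq> M \<and> M \<subseteq> carrier V \<and> (\<forall>x\<in>M. \<forall>y\<in>M. x \<oplus> y \<in> M) \<and>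
    (\<forall>c. \<forall>x\<in>M. s c x \<in> M)" for M
  define \<A> where "\<A> = {M. sub M \<and> v \<notin> M}"
  have "\<exists>M\<in>\<A>. \<forall>X\<in>\<A>. M \<subseteq> X \<longrightarrow> X = M"
  proof (rule subset_Zorn_nonempty)
    have "sub E" unfolding sub_def using E by simp
    then show "\<A> \<noteq> {}" using v(2) unfolding \<A>_def by auto
    fix C assume C: "C \<noteq> {}" "subset.chain \<A> C"
    then have sub: "sub M" "v \<notin> M" if "M \<in> C" for M
      using that unfolding \<A>_def subset.chain_def by auto
    have "x \<oplus> y \<in> \<Union>C" if xy: "x \<in> \<Union>C" "y \<in> \<Union>C" for x y
    proof -
      obtain M N where MN: "M \<in> C" "N \<in> C" "x \<in> M" "y \<in> N" using xy by blast
      then have "M \<subseteq> N \<or> N \<subseteq> M" using C(2) unfolding subset.chain_def by blast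
      then obtain X where "X \<in> C" "x \<in> X" "y \<in> X" using MN by blast
      moreover from this have "x \<oplus> y \<in> X" using sub(1) unfolding sub_def by simp
      ultimately show ?thesis by blast
    qed
    moreover have "s c x \<in> \<Union>C" if "x \<in> \<Union>C" for c x
    proof -
      obtain X where X: "X \<in> C" "x \<in> X" using \<open>x \<in> \<Union>C\<close> by blast
      then have "s c x \<in> X" using sub(1)[OF X(1)] unfolding sub_def by simp
      then show ?thesis using X(1) by blast
    qed
    moreover have "E \<subseteq> \<Union>C" "\<Union>C \<subseteq> carrier V"
    proof -
      have "E \<subseteq> M" "M \<subseteq> carrier V" if "M \<in> C" for M
        using sub(1)[OF that] unfolding sub_def by simp_all
      then show "E \<subseteq> \<Union>C" "\<Union>C \<subseteq> carrier V" using C(1) by blast+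
    qed
    ultimately show "\<Union>C \<in> \<A>" using sub(2) unfolding \<A>_def sub_def by auto
  qed
  then obtain M where M: "sub M" "v \<notin> M" and max: "\<And>X. sub X \<Longrightarrow> v \<notin> X \<Longrightarrow> M \<subseteq> X \<Longrightarrow> X = M"
    unfolding \<A>_def by auto
  have M_add: "x \<oplus> y \<in> M" if "x \<in> M" "y \<in> M" for x y using M(1) that unfolding sub_def by blast
  have M_s: "s c x \<in> M" if "x \<in> M" for c x using M(1) that unfolding sub_def by blast
  have M_sub: "x \<in> carrier V" if "x \<in> M" for x using M(1) that unfolding sub_def by blast
  have M0: "\<zero> \<in> M" using M(1) E(2) unfolding sub_def by blast
  have ex: "\<exists>c. \<exists>m\<in>M. x = m \<oplus> s c v" if x: "x \<in> carrier V" for x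
  proof (cases "x \<in> M")
    case True
    then show ?thesis using s_zero[OF v(1)] x by (intro exI[of _ 0] bexI[of _ x]) auto
  next
    case False
    \<comment> \<open>The subspace \<open>M + k x\<close> is strictly larger than \<open>M\<close>,
      so it contains \<open>v\<close>. There \<open>x\<close> has a nonzero coefficient, and the
      relation can be solved for \<open>x\<close>.\<close>
    define X where "X = {m \<oplus> s d x | m d. m \<in> M}"
    have MX: "M \<subseteq> X"
    proof
      fix m assume m: "m \<in> M"
      then have "m = m \<oplus> s 0 x" using s_zero[OF x] M_sub by simp
      then show "m \<in> X" using m unfolding X_def by blast
    qed
    have "sub X"
      unfolding sub_def
    proof (intro conjI ballI allI)
      show "E \<subseteq> X" using MX M(1) unfolding sub_def by blast
      show "X \<subseteq> carrier V" using M_sub s_closed[OF x] unfolding X_def by auto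
      fix y assume "y \<in> X"
      then obtain m d where y: "y = m \<oplus> s d x" "m \<in> M" unfolding X_def by blast
      show "s c y \<in> X" for c
      proof -
        have "s c y = s c m \<oplus> s (c * d) x" using y x M_sub s_add s_mult s_closed by simp
        then show ?thesis using M_s[OF y(2)] unfolding X_def by blast
      qed
      fix z assume "z \<in> X"
      then obtain m' d' where z: "z = m' \<oplus> s d' x" "m' \<in> M" unfolding X_def by blast
      have "y \<oplus> z = (m \<oplus> m') \<oplus> s (d + d') x"
        using y z x M_sub s_plus s_closed by (simp add: V.a_ac)
      then show "y \<oplus> z \<in> X" using M_add[OF y(2) z(2)] unfolding X_def by blast
    qed
    moreover have "x \<in> X"
    proof -
      have "x = \<zero> \<oplus> s 1 x" using x s_one by simp
      then show ?thesis using M0 unfolding X_def by blast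
    qed
    ultimately have "v \<in> X" using max MX False by blast
    then obtain m d where vm: "v = m \<oplus> s d x" "m \<in> M" unfolding X_def by blast
    have d: "d \<noteq> 0" using vm M(2) s_zero[OF x] M_sub by auto
    have "s (inverse d) v = s (inverse d) m \<oplus> x"
      using vm d x M_sub s_closed s_add s_one by (simp flip: s_mult)
    moreover have mm: "s (- inverse d) m \<in> M" "s (inverse d) m \<in> M" using M_s vm by auto
    moreover have "s (- inverse d) m \<oplus> s (inverse d) m = \<zero>"
      using s_plus[of m "- inverse d" "inverse d"] s_zero M_sub vm by simp
    ultimately have "x = s (- inverse d) m \<oplus> s (inverse d) v"
      using x M_sub V.a_assoc[of "s (- inverse d) m" "s (inverse d) m" x] by simp
    then show ?thesis using mm by blast
  qed
  \<comment> \<open>Two different coefficients would put a nonzero multiple of \<open>v\<close> into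
    \<open>M\<close>.\<close>
  have uniq: "c = d" if "m \<in> M" "m' \<in> M" "m \<oplus> s c v = m' \<oplus> s d v" for m m' c d
  proof (rule ccontr)
    assume "c \<noteq> d"
    have c: "s a v \<in> carrier V" for a using s_closed v(1) by blast
    have inv: "s (-1) m' \<oplus> m' = \<zero>"
      using s_plus[of m' "-1" 1] s_zero[of m'] s_one[of m'] M_sub[OF that(2)] by simp
    have mm: "s (-1) m' \<in> M" "s (-1) m' \<oplus> m \<in> M" using that M_s M_add by auto
    have "s (-1) m' \<oplus> m \<oplus> s c v = s d v"
      using that inv mm M_sub c V.a_assoc by (metis V.l_zero)
    then have "s (-1) m' \<oplus> m \<oplus> s c v \<oplus> s (- c) v = s d v \<oplus> s (- c) v" by simp
    moreover have "s c v \<oplus> s (- c) v = \<zero>" using s_plus[OF v(1), of c "-c"] s_zero[OF v(1)] by simp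
    ultimately have "s (-1) m' \<oplus> m = s (d - c) v"
      using mm M_sub c V.a_assoc s_plus[OF v(1), of d "-c"] by (metis V.r_zero diff_conv_add_uminus)
    then have "s (inverse (d - c)) (s (d - c) v) \<in> M" using mm M_s by metis
    then show False using \<open>c \<noteq> d\<close> M(2) s_one[OF v(1)] by (simp flip: s_mult[OF v(1)])
  qed
  define \<phi> where "\<phi> x = (THE c. \<exists>m\<in>M. x = m \<oplus> s c v)" for x
  have \<phi>I: "\<phi> x = c" if "m \<in> M" "x = m \<oplus> s c v" for x m c
    unfolding \<phi>_def using that uniq by (intro the_equality) blast+
  have \<phi>E: "\<exists>m\<in>M. x = m \<oplus> s (\<phi> x) v" if "x \<in> carrier V" for x
    using ex[OF that] \<phi>I by metis
  show thesis
  proof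
    fix x y assume xy: "x \<in> carrier V" "y \<in> carrier V"
    obtain m m' where m: "m \<in> M" "x = m \<oplus> s (\<phi> x) v" "m' \<in> M" "y = m' \<oplus> s (\<phi> y) v"
      using \<phi>E xy by metis
    have "(m \<oplus> s a v) \<oplus> (m' \<oplus> s b v) = (m \<oplus> m') \<oplus> s (a + b) v" for a b
      using m(1,3) M_sub s_closed v(1) s_plus by (simp add: V.a_ac)
    then show "\<phi> (x \<oplus> y) = \<phi> x + \<phi> y" using m M_add by (metis \<phi>I)
  next
    fix x c assume x: "x \<in> carrier V"
    obtain m where m: "m \<in> M" "x = m \<oplus> s (\<phi> x) v" using \<phi>E x by metis
    have "s c (m \<oplus> s a v) = s c m \<oplus> s (c * a) v" for a
      using m(1) M_sub s_closed v(1) s_add s_mult by simp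
    then show "\<phi> (s c x) = c * \<phi> x" using m M_s by (metis \<phi>I)
  next
    fix x assume "x \<in> E"
    then have "x \<in> M" using M(1) unfolding sub_def by blast
    moreover have "x = x \<oplus> s 0 v" using s_zero[OF v(1)] M_sub[OF \<open>x \<in> M\<close>] by simp
    ultimately show "\<phi> x = 0" by (rule \<phi>I)
  next
    show "\<phi> v = 1" using \<phi>I[OF M0, of v 1] s_one v(1) by simp
  qed
qed

text \<open>Lets a statement about all multipliers in an ideal be checked on generators; applied to
  the trace ideal and to the maximal ideal.\<close>

lemma (in cring) ideal_mult_into:
  assumes "ideal \<aa> R" and y: "y \<in> carrier R"
  shows "ideal {r \<in> carrier R. r \<otimes> y \<in> \<aa>} R" (is "ideal ?I R")
proof (rule idealI[OF ring_axioms])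
  interpret A: ideal \<aa> R by fact
  show "subgroup ?I (add_monoid R)"
  proof (rule subgroup.intro)
    show "x \<otimes>\<^bsub>add_monoid R\<^esub> x' \<in> ?I" if "x \<in> ?I" "x' \<in> ?I" for x x'
      using that y by (simp add: l_distr A.a_closed)
    show "inv\<^bsub>add_monoid R\<^esub> x \<in> ?I" if "x \<in> ?I" for x
      unfolding a_inv_def[symmetric] using that y by (simp add: l_minus A.a_inv_closed)
  qed (use y A.zero_closed in auto)
  fix r s assume rs: "r \<in> ?I" "s \<in> carrier R"
  have "s \<otimes> (r \<otimes> y) \<in> \<aa>" using rs A.I_l_closed[of "r \<otimes> y" s] by simp
  then show "s \<otimes> r \<in> ?I" "r \<otimes> s \<in> ?I" using rs y by (simp_all add: m_assoc m_comm[of r s])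
qed

text \<open>A presentation of \<open>R\<close> in which \<open>B\<close> becomes a k-basis: the
  kernel of \<psi> is spanned by the monomials outside \<open>B\<close>. With \<psi> as a parameter,
  one ring can have several presentations, with different numbers of variables.\<close>

locale monomial_quotient = cring R for R :: "'r ring" (structure) +
  fixes n :: nat and B :: "(nat \<Rightarrow>\<^sub>0 nat) set" and \<psi> :: "'k::field mpoly \<Rightarrow> 'r"
  assumes finite_B: "finite B"
    and zero_B: "0 \<in> B"
    and keys_B: "t \<in> B \<Longrightarrow> keys t \<subseteq> {1..n}"
    and down_B: "t \<in> B \<Longrightarrow> dvs s t \<Longrightarrow> s \<in> B"
    and hom: "\<psi> \<in> ring_hom (mpoly_ring n) R"
    and surj: "\<psi> ` carrier (mpoly_ring n) = carrier R"
    and ker: "p \<in> carrier (mpoly_ring n) \<Longrightarrow> \<psi> p = \<zero> \<longleftrightarrow> keys p \<inter> B = {}"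
begin

section \<open>Calculating with representatives\<close>

abbreviation "S \<equiv> carrier (mpoly_ring n) :: 'k mpoly set"

lemma psi_closed [simp]: "p \<in> S \<Longrightarrow> \<psi> p \<in> carrier R"
  using ring_hom_closed[OF hom] .

lemma psi_add: "p \<in> S \<Longrightarrow> q \<in> S \<Longrightarrow> \<psi> (p + q) = \<psi> p \<oplus> \<psi> q"
  using ring_hom_add[OF hom] by simp

lemma psi_mult: "p \<in> S \<Longrightarrow> q \<in> S \<Longrightarrow> \<psi> (p * q) = \<psi> p \<otimes> \<psi> q"
  using ring_hom_mult[OF hom] by simp

lemma one_S [simp]: "1 \<in> S" and zero_S [simp]: "0 \<in> S"
  by (simp_all add: carrier_mpoly_iff)

lemma const_S [simp]: "single 0 c \<in> S" by (simp add: single_in_mpoly)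

lemma psi_one [simp]: "\<psi> 1 = \<one>" using ring_hom_one[OF hom] by simp

lemma psi_zero [simp]: "\<psi> 0 = \<zero>" by (simp add: ker)

lemma psi_power: "p \<in> S \<Longrightarrow> p ^ e \<in> S \<and> \<psi> (p ^ e) = \<psi> p [^] (e::nat)"
proof (induction e)
  case (Suc e)
  then show ?case using mpoly_closed(2)[of p n "p ^ e"] by (simp add: psi_mult m_comm)
qed simp

lemma psi_eq_iff:
  assumes "p \<in> S" "q \<in> S"
  shows "\<psi> p = \<psi> q \<longleftrightarrow> (\<forall>t\<in>B. lookup p t = lookup q t)"
proof -
  have "\<psi> p = \<psi> q \<longleftrightarrow> \<psi> (p - q) = \<zero>"
    using psi_add[of "p - q" q] mpoly_closed(3)[OF assms] assms add.r_cancel_one[of "\<psi> q" "\<psi> (p - q)"]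
    by auto
  also have "\<dots> \<longleftrightarrow> (\<forall>t\<in>B. lookup p t = lookup q t)"
    using ker[OF mpoly_closed(3)[OF assms]] by (auto simp: disjoint_iff in_keys_iff lookup_minus)
  finally show ?thesis .
qed

lemma obtain_rep:
  assumes "r \<in> carrier R"
  obtains p where "p \<in> S" "r = \<psi> p"
  using assms surj by blast

lemma single_B: "t \<in> B \<Longrightarrow> single t c \<in> S"
  using keys_B by (intro single_in_mpoly)

lemma one_not_zero: "\<one> \<noteq> \<zero>"
  using ker[OF one_S] zero_B by simp

section \<open>The maximal ideal, nilpotence and systems of parameters\<close>

definition m0 :: "'r set" where "m0 = \<psi> ` {p \<in> S. lookup p 0 = 0}"

text \<open>Since \<open>0 \<in> B\<close>, the constant term is the same for all representatives of
  a class.\<close>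

lemma psi_m0_iff: "p \<in> S \<Longrightarrow> \<psi> p \<in> m0 \<longleftrightarrow> lookup p 0 = 0"
  unfolding m0_def using psi_eq_iff zero_B by fastforce

lemma Var_S: "j \<in> {1..n} \<Longrightarrow> single (single j 1) 1 \<in> S"
  by (rule single_in_mpoly) auto

lemma psi_Var_m0:
  assumes "j \<in> {1..n}"
  shows "\<psi> (single (single j 1) 1) \<in> m0"
proof -
  have "single j (1::nat) \<noteq> 0" by (metis lookup_single_eq lookup_zero one_neq_zero)
  then show ?thesis using psi_m0_iff[OF Var_S[OF assms]] by (simp add: lookup_single_not_eq)
qed

lemma m0_subset:
  assumes P: "ideal P R" and X: "\<And>j. j \<in> {1..n} \<Longrightarrow> \<psi> (single (single j 1) 1) \<in> P"
  shows "m0 \<subseteq> P"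
proof
  fix r assume "r \<in> m0"
  then obtain p where p: "p \<in> S" "lookup p 0 = 0" "r = \<psi> p" unfolding m0_def by blast
  interpret P: ideal P R by (rule P)
  have mono: "single t c \<in> S \<and> \<psi> (single t c) \<in> P" if t: "t \<in> keys p" for t c
  proof -
    have "t \<noteq> 0" using t p(2) by (metis in_keys_iff)
    then obtain j where j: "j \<in> keys t" by (metis equals0I keys_eq_empty)
    have kt: "keys t \<subseteq> {1..n}" using t p(1) by (auto simp: carrier_mpoly_iff)
    have d: "dvs (single j 1) t" using j by (simp add: dvs_single in_keys_iff Suc_leI)
    have "keys (t - single j 1) \<subseteq> {1..n}"
      using kt by (auto simp: in_keys_iff lookup_minus)
    then have S: "single (t - single j 1) c \<in> S" "single (single j 1) 1 \<in> S"
      using j kt by (auto intro!: single_in_mpoly split: if_splits)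
    have "single t c = single (single j 1) 1 * single (t - single j 1) c"
      using dvs_add_diff[OF d] by (simp add: mult_single)
    moreover have "\<psi> (single (single j 1) 1) \<otimes> \<psi> (single (t - single j 1) c) \<in> P"
      using j kt S by (intro P.I_r_closed X psi_closed) auto
    ultimately show ?thesis
      using mpoly_closed(2)[OF S(2,1)] psi_mult[OF S(2,1)] by simp
  qed
  have "(\<Sum>t\<in>A. single t (lookup p t)) \<in> S \<and> \<psi> (\<Sum>t\<in>A. single t (lookup p t)) \<in> P"
    if "A \<subseteq> keys p" for A
    using finite_subset[OF that finite_keys] that
  proof (induction A rule: finite_induct)
    case (insert t A)
    have "single t (lookup p t) \<in> S \<and> \<psi> (single t (lookup p t)) \<in> P" using mono insert.prems by blast
    then show ?case using insert by (simp add: mpoly_closed psi_add P.a_closed)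
  qed (simp add: P.zero_closed)
  from this[OF order.refl] have "\<psi> (\<Sum>t\<in>keys p. single t (lookup p t)) \<in> P" by blast
  then show "r \<in> P"
    unfolding p(3) poly_mapping_sum_singles[OF finite_keys order.refl, of p, symmetric] .
qed

definition deg :: "(nat \<Rightarrow>\<^sub>0 nat) \<Rightarrow> nat" where "deg t = (\<Sum>i\<in>{1..n}. lookup t i)"

lemma deg_add: "deg (s + t) = deg s + deg t"
  by (simp add: deg_def lookup_add sum.distrib)

lemma deg_pos: "keys t \<subseteq> {1..n} \<Longrightarrow> t \<noteq> 0 \<Longrightarrow> 0 < deg t"
proof (rule ccontr)
  assume t: "keys t \<subseteq> {1..n}" "t \<noteq> 0" "\<not> 0 < deg t"
  then obtain i where "i \<in> keys t" by (metis equals0I keys_eq_empty)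
  moreover from this have "i \<in> {1..n}" using t(1) by blast
  ultimately show False using t(3) by (auto simp: deg_def in_keys_iff)
qed

text \<open>Every monomial of \<open>p ^ e\<close> has degree at least \<open>e\<close>, while
  degrees in the finite set \<open>B\<close> are bounded.\<close>

lemma m0_nilpotent:
  assumes "r \<in> m0"
  shows "\<exists>e::nat. r [^] e = \<zero>"
proof -
  obtain p where p: "p \<in> S" "lookup p 0 = 0" "r = \<psi> p" using assms unfolding m0_def by blast
  have ge: "e \<le> deg t" if "t \<in> keys (p ^ e)" for e t
    using that
  proof (induction e arbitrary: t)
    case (Suc e)
    then obtain u v where uv: "u \<in> keys p" "v \<in> keys (p ^ e)" "t = u + v"
      using keys_mult[of p "p ^ e"] by auto
    have "u \<noteq> 0" using uv(1) p(2) by (metis in_keys_iff)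
    then have "0 < deg u" using p(1) uv(1) by (intro deg_pos) (auto simp: carrier_mpoly_iff)
    then show ?case using Suc.IH[OF uv(2)] uv(3) by (simp add: deg_add)
  qed simp
  define e where "e = Suc (Max (deg ` B))"
  have "keys (p ^ e) \<inter> B = {}"
  proof (rule ccontr)
    assume "keys (p ^ e) \<inter> B \<noteq> {}"
    then obtain t where t: "t \<in> keys (p ^ e)" "t \<in> B" by blast
    then have "deg t \<le> Max (deg ` B)" using finite_B by simp
    then show False using ge[OF t(1)] unfolding e_def by simp
  qed
  then have "\<psi> (p ^ e) = \<zero>" using ker psi_power p(1) by blast
  then show ?thesis using psi_power[OF p(1), of e] p(3) by auto
qed

text \<open>A prime contains all nilpotent elements, hence \<open>m0\<close>. If it also contained
  an element with constant term \<open>c \<noteq> 0\<close>, subtracting a member of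
  \<open>m0\<close> would leave the unit \<open>c\<close>.\<close>

lemma prime_eq_m0:
  assumes "primeideal P R"
  shows "P = m0"
proof
  interpret P: primeideal P R by (rule assms)
  have nil: "r \<in> P" if r: "r \<in> carrier R" "r [^] (e::nat) = \<zero>" for r e
  proof -
    have "r [^] e \<in> P" using r(2) P.zero_closed by simp
    then show ?thesis
    proof (induction e)
      case 0
      then show ?case using P.one_imp_carrier P.I_notcarr by simp
    next
      case (Suc e)
      then show ?case using P.I_prime[of "r [^] e" r] r(1) by auto
    qed
  qed
  have m0c: "m0 \<subseteq> carrier R" unfolding m0_def by auto
  show sub: "m0 \<subseteq> P" using nil m0_nilpotent m0c by blast
  show "P \<subseteq> m0"
  proof
    fix r assume r: "r \<in> P"
    obtain p where p: "p \<in> S" "r = \<psi> p" using r P.a_subset obtain_rep by blast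
    let ?c = "lookup p 0"
    show "r \<in> m0"
    proof (rule ccontr)
      assume "r \<notin> m0"
      then have c: "?c \<noteq> 0" using p psi_m0_iff by blast
      have q: "single 0 ?c - p \<in> S" using mpoly_closed(3)[OF const_S p(1)] .
      have "\<psi> (single 0 ?c - p) \<in> m0" using psi_m0_iff[OF q] by (simp add: lookup_minus)
      then have "\<psi> (single 0 ?c - p) \<oplus> \<psi> p \<in> P" using sub r p P.a_closed by blast
      then have "\<psi> (single 0 ?c) \<in> P" using psi_add[OF q p(1)] by simp
      then have "\<psi> (single 0 ?c) \<otimes> \<psi> (single 0 (inverse ?c)) \<in> P" by (rule P.I_r_closed) simp
      then have "\<one> \<in> P" using c by (simp add: mult_single flip: psi_mult)
      then show False using P.one_imp_carrier P.I_notcarr by blast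
    qed
  qed
qed

lemma maximal_eq_m0: "maximalideal M R \<Longrightarrow> M = m0"
  using prime_eq_m0 maximalideal_prime by blast

lemma Idl_empty: "Idl {} = {\<zero>}"
proof
  show "Idl {} \<subseteq> {\<zero>}" by (rule genideal_minimal[OF zeroideal]) simp
  show "{\<zero>} \<subseteq> Idl {}"
    using additive_subgroup.zero_closed[OF ideal.axioms(1)[OF genideal_ideal[of "{}"]]] by simp
qed

lemma krull_dim_zero:
  assumes "maximalideal M R"
  shows "krull_dim R = 0"
proof -
  have prime: "primeideal m0 R" using maximalideal_prime[OF assms] maximal_eq_m0[OF assms] by simp
  have "(\<exists>p :: nat \<Rightarrow> 'r set. (\<forall>i\<le>d. primeideal (p i) R) \<and> (\<forall>i<d. p i \<subset> p (Suc i))) \<longleftrightarrow> d = 0" for d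
  proof
    assume "\<exists>p :: nat \<Rightarrow> 'r set. (\<forall>i\<le>d. primeideal (p i) R) \<and> (\<forall>i<d. p i \<subset> p (Suc i))"
    then obtain p :: "nat \<Rightarrow> 'r set"
      where p: "\<forall>i\<le>d. primeideal (p i) R" "\<forall>i<d. p i \<subset> p (Suc i)" by blast
    show "d = 0"
    proof (rule ccontr)
      assume "d \<noteq> 0"
      then have "p 0 = m0" "p (Suc 0) = m0" "p 0 \<subset> p (Suc 0)" using p prime_eq_m0 by simp_all
      then show False by blast
    qed
  next
    assume "d = 0"
    then show "\<exists>p :: nat \<Rightarrow> 'r set. (\<forall>i\<le>d. primeideal (p i) R) \<and> (\<forall>i<d. p i \<subset> p (Suc i))"
      using prime by (intro exI[of _ "\<lambda>_. m0"]) simp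
  qed
  then have "{enat d | d. \<exists>p :: nat \<Rightarrow> 'r set.
     (\<forall>i\<le>d. primeideal (p i) R) \<and> (\<forall>i<d. p i \<subset> p (Suc i))} = {0}"
    by (auto simp: zero_enat_def)
  then show ?thesis unfolding krull_dim_def by simp
qed

lemma const_decomp:
  assumes "r \<in> carrier R"
  obtains c m where "m \<in> m0" "r = \<psi> (single 0 c) \<oplus> m" "r \<in> m0 \<longleftrightarrow> c = 0"
proof -
  obtain p where p: "p \<in> S" "r = \<psi> p" using assms by (rule obtain_rep)
  have S: "p - single 0 (lookup p 0) \<in> S" using mpoly_closed(3)[OF p(1) const_S] .
  show thesis
  proof
    show "\<psi> (p - single 0 (lookup p 0)) \<in> m0" using psi_m0_iff[OF S] by (simp add: lookup_minus)
    show "r = \<psi> (single 0 (lookup p 0)) \<oplus> \<psi> (p - single 0 (lookup p 0))"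
    using psi_add[OF const_S[of "lookup p 0"] S] p(2) by simp
    show "r \<in> m0 \<longleftrightarrow> lookup p 0 = 0" using psi_m0_iff[OF p(1)] p(2) by simp
  qed
qed

lemma m0_carrier: "m0 \<subseteq> carrier R" unfolding m0_def by auto

lemma const_unit:
  assumes "c \<noteq> 0"
  shows "\<psi> (single 0 (inverse c)) \<otimes> \<psi> (single 0 c) = \<one>"
  using assms psi_mult[OF const_S const_S, of "inverse c" c] by (simp add: mult_single)

text \<open>\<open>y\<close> is a nonzero constant \<open>c\<close> plus a nilpotent
  \<open>m\<close>. Then \<open>x m = - c x\<close>, so the vanishing of \<open>x m^(k+1)\<close>
  forces that of \<open>x m^k\<close>. Starting from a power of \<open>m\<close> that is zero, this
  descends to \<open>x\<close>.\<close>

lemma unit_annihilates: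
  assumes x: "x \<in> carrier R" and y: "y \<in> carrier R" "y \<notin> m0" and xy: "x \<otimes> y = \<zero>"
  shows "x = \<zero>"
proof -
  obtain c m where cm: "m \<in> m0" "y = \<psi> (single 0 c) \<oplus> m" "y \<in> m0 \<longleftrightarrow> c = 0"
    using y(1) by (rule const_decomp)
  define u where "u = \<ominus> (\<psi> (single 0 (inverse c)) \<otimes> m)"
  have mc: "m \<in> carrier R" using cm(1) m0_carrier by blast
  obtain e :: nat where e: "m [^] e = \<zero>" using m0_nilpotent[OF cm(1)] by blast
  have c0: "c \<noteq> 0" using cm(3) y(2) by blast
  have xm: "x \<otimes> m = \<ominus> (x \<otimes> \<psi> (single 0 c))"
    using xy cm(2) x mc by (simp add: r_distr minus_equality a_comm)
  have "x \<otimes> m [^] (k::nat) = \<zero> \<Longrightarrow> x = \<zero>" for k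
  proof (induction k)
    case (Suc k)
    have "\<zero> = (x \<otimes> m) \<otimes> m [^] k" using Suc.prems x mc by (simp add: m_ac)
    also have "\<dots> = \<ominus> ((x \<otimes> m [^] k) \<otimes> \<psi> (single 0 c))"
      unfolding xm using x mc by (simp add: l_minus r_minus m_ac)
    finally have "(x \<otimes> m [^] k) \<otimes> \<psi> (single 0 c) = \<zero>"
      using x mc by (metis const_S m_closed minus_minus minus_zero nat_pow_closed psi_closed)
    then have "(x \<otimes> m [^] k) \<otimes> \<psi> (single 0 c) \<otimes> \<psi> (single 0 (inverse c)) = \<zero>" by simp
    then have "x \<otimes> m [^] k = \<zero>"
      using const_unit[OF c0] x mc by (simp add: m_assoc m_comm[of "\<psi> (single 0 c)"])
    then show ?case by (rule Suc.IH)
  qed (use x in simp)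
  then show ?thesis using e x by (metis r_null)
qed

text \<open>Dimension zero forces length zero. The empty list qualifies because the zero ideal is
  primary to \<open>m0\<close>: elements outside \<open>m0\<close> are not zero divisors, and those
  inside are nilpotent.\<close>

lemma system_of_parameters_iff:
  assumes M: "maximalideal M R"
  shows "system_of_parameters R M xs \<longleftrightarrow> xs = []"
proof
  assume "system_of_parameters R M xs"
  then show "xs = []"
    using krull_dim_zero[OF M] unfolding system_of_parameters_def by (simp add: zero_enat_def)
next
  assume xs: "xs = []"
  have M0: "M = m0" using maximal_eq_m0[OF M] .
  interpret P: primeideal m0 R using maximalideal_prime[OF M] M0 by simp
  have rad: "ideal_radical R {\<zero>} = m0"
  proof
    show "m0 \<subseteq> ideal_radical R {\<zero>}"
      using m0_nilpotent m0_carrier unfolding ideal_radical_def by blast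
    have "x \<in> m0" if "x \<in> carrier R" "x [^] (e::nat) \<in> m0" for x e
      using that(2)
    proof (induction e)
      case 0
      then show ?case using P.one_imp_carrier P.I_notcarr by simp
    next
      case (Suc e)
      then show ?case using P.I_prime[of "x [^] e" x] that(1) by auto
    qed
    note rad = this
    show "ideal_radical R {\<zero>} \<subseteq> m0"
    proof
      fix x assume "x \<in> ideal_radical R {\<zero>}"
      then obtain e :: nat where "x \<in> carrier R" "x [^] e = \<zero>" unfolding ideal_radical_def by blast
      then show "x \<in> m0" using rad[of x e] P.zero_closed by simp
    qed
  qed
  have "primary_ideal R {\<zero>}"
    unfolding primary_ideal_def rad
  proof (intro conjI ballI impI)
    show "{\<zero>} \<noteq> carrier R" using one_not_zero one_closed by blast
    show "x \<in> {\<zero>} \<or> y \<in> m0" if "x \<in> carrier R" "y \<in> carrier R" "x \<otimes> y \<in> {\<zero>}" for x y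
      using unit_annihilates[OF that(1,2)] that(3) by blast
  qed (rule zeroideal)
  then show "system_of_parameters R M xs"
    unfolding system_of_parameters_def primary_to_def
    using krull_dim_zero[OF M] rad by (simp add: xs M0 Idl_empty zero_enat_def)
qed

definition double_colon_cond :: bool where
  "double_colon_cond \<longleftrightarrow>
    (\<forall>\<aa>. ideal \<aa> R \<longrightarrow> colon R {\<zero>} (colon R {\<zero>} \<aa>) \<subseteq> colon R \<aa> m0)"

text \<open>A condition \<open>P\<close> on the members of the empty list is vacuous, so one lemma
  serves both (2), with \<open>P\<close> constantly true, and (3).\<close>

lemma double_colon_cond_iff:
  assumes M: "maximalideal M R"
  shows "(\<forall>xs K \<aa>. system_of_parameters R M xs \<and> (\<forall>x\<in>set xs. P x) \<and> K = Idl (set xs) \<and> ideal \<aa> R \<and> K \<subseteq> \<aa> \<longrightarrow>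
              colon R K (colon R K \<aa>) \<subseteq> colon R \<aa> M) \<longleftrightarrow> double_colon_cond"
proof -
  have z: "{\<zero>} \<subseteq> \<aa>" if "ideal \<aa> R" for \<aa>
    using additive_subgroup.zero_closed[OF ideal.axioms(1)[OF that]] by blast
  have M0: "M = m0" by (rule maximal_eq_m0[OF M])
  have sop: "system_of_parameters R m0 xs \<longleftrightarrow> xs = []" for xs
    using system_of_parameters_iff[OF M] M0 by simp
  show ?thesis
    unfolding M0 sop double_colon_cond_def using z by (simp add: Idl_empty) blast
qed

section \<open>The dual of \<open>R\<close>, as functionals on polynomials that kill the
  ideal\<close>

definition dual_form :: "('k mpoly \<Rightarrow> 'k) \<Rightarrow> bool" where
  "dual_form \<phi> \<longleftrightarrow> (\<forall>p\<in>S. \<forall>q\<in>S. \<phi> (p + q) = \<phi> p + \<phi> q) \<and>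
    (\<forall>c. \<forall>p\<in>S. \<phi> (single 0 c * p) = c * \<phi> p) \<and> (\<forall>p\<in>vanishing n B. \<phi> p = 0)"

lemma dual_form_sum:
  assumes "dual_form \<phi>" "p \<in> S"
  shows "\<phi> p = (\<Sum>t\<in>B. lookup p t * \<phi> (single t 1))"
proof -
  have add: "\<phi> (p + q) = \<phi> p + \<phi> q" if "p \<in> S" "q \<in> S" for p q
    using assms(1) that unfolding dual_form_def by blast
  have smult: "\<phi> (single 0 c * p) = c * \<phi> p" if "p \<in> S" for c p
    using assms(1) that unfolding dual_form_def by blast
  have zero: "\<phi> 0 = 0" using smult[OF zero_S, of 0] by simp
  let ?q = "\<Sum>t\<in>B. single t (lookup p t)"
  have q: "(\<Sum>t\<in>A. single t (lookup p t)) \<in> S" if "A \<subseteq> B" for A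
    using that single_B by (intro sum_in_mpoly) auto
  have d: "p - ?q \<in> S" using mpoly_closed(3)[OF assms(2) q] by blast
  have "lookup ?q t = lookup p t" if "t \<in> B" for t
    using that by (rule lookup_sum_singles[OF finite_B])
  then have "p - ?q \<in> vanishing n B"
    using d by (auto simp: vanishing_def in_keys_iff lookup_minus)
  then have "\<phi> (p - ?q) = 0" using assms(1) unfolding dual_form_def by blast
  then have "\<phi> p = \<phi> ?q" using add[OF d q[OF order.refl]] by simp
  also have "\<phi> (\<Sum>t\<in>A. single t (lookup p t)) = (\<Sum>t\<in>A. lookup p t * \<phi> (single t 1))" if "A \<subseteq> B" for A
    using finite_subset[OF that finite_B] that
  proof (induction A rule: finite_induct)
    case (insert t A)
    have "\<phi> (single t (lookup p t)) = lookup p t * \<phi> (single t 1)"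
      using smult[of "single t 1" "lookup p t"] single_B insert.prems by (simp add: mult_single)
    then show ?case using insert q add single_B by simp
  qed (simp add: zero)
  finally show ?thesis by blast
qed

lemma dual_form_exists:
  assumes E: "E \<subseteq> S" "vanishing n B \<subseteq> E" "\<And>p q. p \<in> E \<Longrightarrow> q \<in> E \<Longrightarrow> p + q \<in> E"
      "\<And>c p. p \<in> E \<Longrightarrow> single 0 c * p \<in> E"
    and q: "q \<in> S" "q \<notin> E"
  obtains \<phi> where "dual_form \<phi>" "\<And>p. p \<in> E \<Longrightarrow> \<phi> p = 0" "\<phi> q = 1"
proof -
  interpret P: cring "mpoly_ring n :: 'k mpoly ring" by (rule cring_mpoly_ring)
  obtain \<phi> :: "'k mpoly \<Rightarrow> 'k"
    where add: "\<And>p q. p \<in> S \<Longrightarrow> q \<in> S \<Longrightarrow> \<phi> (p \<oplus>\<^bsub>mpoly_ring n\<^esub> q) = \<phi> p + \<phi> q"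
      and smult: "\<And>c p. p \<in> S \<Longrightarrow> \<phi> (single 0 c * p) = c * \<phi> p"
      and E0: "\<And>p. p \<in> E \<Longrightarrow> \<phi> p = 0" and q1: "\<phi> q = 1"
  proof (rule linear_functional_exists[of "mpoly_ring n" "\<lambda>c p. single 0 c * p" E q])
    show "abelian_group (mpoly_ring n :: 'k mpoly ring)" by unfold_locales
    show "\<zero>\<^bsub>mpoly_ring n\<^esub> \<in> E" using E(2) by (auto simp: vanishing_def)
    show "p \<oplus>\<^bsub>mpoly_ring n\<^esub> q \<in> E" if "p \<in> E" "q \<in> E" for p q using E(3)[OF that] by simp
  qed (use E(1,4) q in \<open>auto simp: mpoly_closed(2) distrib_left distrib_right single_add mult_single
      simp flip: mult.assoc\<close>)
  have "dual_form \<phi>"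
    unfolding dual_form_def
  proof (intro conjI ballI allI)
    show "\<phi> p = 0" if "p \<in> vanishing n B" for p using that E(2) E0 by blast
  qed (use add smult in auto)
  then show thesis using E0 q1 by (rule that)
qed

text \<open>The hypothesis on \<open>d\<close> says that \<open>x\<^sup>-\<^sup>u \<mapsto> x\<^sup>d\<^sup>-\<^sup>u\<close> (for \<open>u\<close> and \<open>d - u\<close> in \<open>B\<close>, and zero
  otherwise) is a homomorphism from the dual of \<open>R\<close> to \<open>R\<close>.\<close>

definition shift_ok :: "(nat \<Rightarrow>\<^sub>0 nat) \<Rightarrow> bool" where
  "shift_ok d \<longleftrightarrow> keys d \<subseteq> {1..n} \<and> (\<forall>t\<in>B. \<forall>u\<in>B. dvs d (t + u) \<longrightarrow> dvs t d)"

text \<open>In the dual basis, \<phi> has coefficient \<open>\<phi> (x^u)\<close> at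
  \<open>x^(-u)\<close>.\<close>

definition shift :: "(nat \<Rightarrow>\<^sub>0 nat) \<Rightarrow> ('k mpoly \<Rightarrow> 'k) \<Rightarrow> 'k mpoly" where
  "shift d \<phi> = (\<Sum>u | u \<in> B \<and> dvs u d \<and> d - u \<in> B. single (d - u) (\<phi> (single u 1)))"

lemma shift_S: "shift d \<phi> \<in> S"
  unfolding shift_def by (intro sum_in_mpoly single_B) simp

text \<open>This is \<open>R\<close>-linearity of the shift in coordinates: the right side is the
  coefficient of the shift of the functional \<open>q \<mapsto> \<phi> (q * p)\<close>, that is, of
  \<open>p\<close> acting on \<phi>. The case \<open>p = 1\<close> gives the coefficients of the
  shift itself.\<close>

lemma lookup_shift_mult:
  assumes ok: "shift_ok d" and \<phi>: "dual_form \<phi>" and p: "p \<in> S" and t: "t \<in> B"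
  shows "lookup (shift d \<phi> * p) t = (if dvs t d then \<phi> (single (d - t) 1 * p) else 0)"
proof -
  let ?U = "{u \<in> B. dvs u d \<and> d - u \<in> B}"
  \<comment> \<open>\<open>shift_ok\<close> speaks only of the first summand; exchanging the
    summands gives the second.\<close>
  have H: "dvs s d" "dvs u d" if "s \<in> B" "u \<in> B" "dvs d (s + u)" for s u
    using ok that unfolding shift_ok_def by (metis add.commute)+
  have L: "lookup (shift d \<phi> * p) t =
      (\<Sum>u\<in>?U. if dvs (d - u) t then \<phi> (single u 1) * lookup p (t - (d - u)) else 0)"
    unfolding shift_def sum_distrib_right lookup_sum lookup_single_mult ..
  show ?thesis
  proof (cases "dvs t d")
    case True
    \<comment> \<open>With truncated subtraction, both sides say that \<open>d\<close> divides
      \<open>t + u\<close>.\<close>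
    have sw: "dvs (d - u) t \<longleftrightarrow> dvs (d - t) u" if "dvs u d" for u
      unfolding dvs_def lookup_minus by (simp add: le_diff_conv add.commute)
    have eq: "t - (d - u) = u - (d - t)" if "dvs u d" "dvs (d - u) t" for u
      by (rule poly_mapping_eqI) (use True that in \<open>auto simp: dvs_def lookup_minus\<close>)
    have "keys (d - t) \<subseteq> {1..n}"
      using ok by (auto simp: shift_ok_def in_keys_iff lookup_minus)
    then have "single (d - t) 1 * p \<in> S" using p by (intro mpoly_closed(2) single_in_mpoly)
    then have "\<phi> (single (d - t) 1 * p) =
        (\<Sum>s\<in>B. (if dvs (d - t) s then lookup p (s - (d - t)) else 0) * \<phi> (single s 1))"
      using dual_form_sum[OF \<phi>] by (simp add: lookup_single_mult cong: if_cong)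
    \<comment> \<open>Terms outside \<open>?U\<close> contribute zero: if \<open>d - t\<close>
      divided \<open>s\<close>, then \<open>d\<close> would divide \<open>t + s\<close>, and
      \<open>shift_ok\<close> would place \<open>s\<close> in \<open>?U\<close>.\<close>
    also have "\<dots> = (\<Sum>s\<in>?U. (if dvs (d - t) s then lookup p (s - (d - t)) else 0) * \<phi> (single s 1))"
    proof (rule sum.mono_neutral_right[OF finite_B _ ballI])
      fix s assume "s \<in> B - ?U"
      then have s: "s \<in> B" "s \<notin> ?U" by blast+
      have "\<not> dvs (d - t) s"
      proof
        assume ds: "dvs (d - t) s"
        then have "dvs d (t + s)"
          unfolding dvs_def lookup_add lookup_minus by (simp add: le_diff_conv add.commute)
        then have "dvs s d" using H(2)[OF t s(1)] by blast
        moreover from this have "d - s \<in> B" using down_B[OF t] sw ds by blast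
        ultimately show False using s by blast
      qed
      then show "(if dvs (d - t) s then lookup p (s - (d - t)) else 0) * \<phi> (single s 1) = 0" by simp
    qed blast
    also have "\<dots> = lookup (shift d \<phi> * p) t"
      unfolding L
    proof (rule sum.cong[OF refl])
      fix u assume "u \<in> ?U"
      then have "dvs u d" by simp
      then show "(if dvs (d - t) u then lookup p (u - (d - t)) else 0) * \<phi> (single u 1) =
          (if dvs (d - u) t then \<phi> (single u 1) * lookup p (t - (d - u)) else 0)"
        using sw[of u] eq[of u] by simp
    qed
    finally show ?thesis using True by simp
  next
    case False
    have "\<not> dvs (d - u) t" if u: "u \<in> ?U" for u
    proof
      assume "dvs (d - u) t"
      then have "dvs d (t + u)"
        unfolding dvs_def lookup_add lookup_minus by (simp add: le_diff_conv)
      then show False using H(1)[OF t] u False by blast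
    qed
    then show ?thesis using False by (simp add: L)
  qed
qed

end

section \<open>The canonical module as a dual\<close>

lemma (in cring) self_module_simps [simp]:
  "carrier (self_module R) = carrier R" "add (self_module R) = add R" "ring.zero (self_module R) = \<zero>"
  "smult (self_module R) = monoid.mult R"
  by (simp_all add: self_module_def with_smult_def)

lemma (in cring) module_self_module: "Module.module R (self_module R)"
  by (rule module_criteria)
    (auto intro: cring_axioms l_neg r_neg a_comm a_assoc m_assoc l_distr r_distr)

lemma (in Module.module) cyclic_submodule:
  assumes x: "x \<in> carrier M"
  shows "LinearCombinations.submodule R {r \<odot>\<^bsub>M\<^esub> x | r. r \<in> carrier R} M" (is "submodule R ?N M")
proof (rule submodule.intro)
  show "Module.module R M" by unfold_locales
  show "?N \<subseteq> carrier M" using x smult_closed by blast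
  show "v \<oplus>\<^bsub>M\<^esub> w \<in> ?N" if vw: "v \<in> ?N" "w \<in> ?N" for v w
  proof -
    obtain r s where "r \<in> carrier R" "s \<in> carrier R" "v = r \<odot>\<^bsub>M\<^esub> x" "w = s \<odot>\<^bsub>M\<^esub> x"
      using vw by blast
    then have "v \<oplus>\<^bsub>M\<^esub> w = (r \<oplus> s) \<odot>\<^bsub>M\<^esub> x" "r \<oplus> s \<in> carrier R" using x smult_l_distr by simp_all
    then show ?thesis by blast
  qed
  have "\<zero>\<^bsub>M\<^esub> = \<zero> \<odot>\<^bsub>M\<^esub> x" using x by simp
  then show "\<zero>\<^bsub>M\<^esub> \<in> ?N" by blast
  show "c \<odot>\<^bsub>M\<^esub> v \<in> ?N" if cv: "c \<in> carrier R" "v \<in> ?N" for c v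
  proof -
    obtain r where "r \<in> carrier R" "v = r \<odot>\<^bsub>M\<^esub> x" using cv(2) by blast
    then have "c \<odot>\<^bsub>M\<^esub> v = (c \<otimes> r) \<odot>\<^bsub>M\<^esub> x" "c \<otimes> r \<in> carrier R"
      using x cv(1) smult_assoc1 by simp_all
    then show ?thesis by blast
  qed
qed

text \<open>\<open>e\<close> generates the copy of the residue field in \<omega>, and
  \<open>ess\<close> is essentiality in the sharp form that a nonzero submodule contains this whole
  copy. \<tau> is any functional normalised at \<open>e\<close>; there is no canonical one.\<close>

locale dual_module = monomial_quotient R n B \<psi> + W: Module.module R \<omega>
  for R :: "'r ring" (structure) and n B and \<psi> :: "'k::field mpoly \<Rightarrow> 'r"
    and \<omega> :: "('r, 'w) module" +
  fixes \<tau> :: "'w \<Rightarrow> 'k" and e :: 'w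
  assumes e: "e \<in> carrier \<omega>"
    and ess: "\<And>N. LinearCombinations.submodule R N \<omega> \<Longrightarrow> N \<noteq> {\<zero>\<^bsub>\<omega>\<^esub>} \<Longrightarrow> e \<in> N"
    and ann: "\<And>r. r \<in> m0 \<Longrightarrow> r \<odot>\<^bsub>\<omega>\<^esub> e = \<zero>\<^bsub>\<omega>\<^esub>"
    and tau_add: "\<And>x y. x \<in> carrier \<omega> \<Longrightarrow> y \<in> carrier \<omega> \<Longrightarrow> \<tau> (x \<oplus>\<^bsub>\<omega>\<^esub> y) = \<tau> x + \<tau> y"
    and tau_smult: "\<And>c x. x \<in> carrier \<omega> \<Longrightarrow> \<tau> (\<psi> (single 0 c) \<odot>\<^bsub>\<omega>\<^esub> x) = c * \<tau> x"
    and tau_e: "\<tau> e = 1"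
    and injective: "injective_module R \<omega>"
begin

abbreviation "W \<equiv> carrier \<omega>"

abbreviation act :: "'r \<Rightarrow> 'w \<Rightarrow> 'w" (infixl "\<star>" 70) where "r \<star> x \<equiv> r \<odot>\<^bsub>\<omega>\<^esub> x"

lemma tau_zero: "\<tau> \<zero>\<^bsub>\<omega>\<^esub> = 0"
  using tau_smult[of "\<zero>\<^bsub>\<omega>\<^esub>" 0] by simp

text \<open>A nonzero \<open>x\<close> generates a submodule containing \<open>e\<close>, where
  \<tau> has the value 1.\<close>

lemma eq_zero_if_tau:
  assumes x: "x \<in> W" and z: "\<And>r. r \<in> carrier R \<Longrightarrow> \<tau> (r \<star> x) = 0"
  shows "x = \<zero>\<^bsub>\<omega>\<^esub>"
proof (rule ccontr)
  assume nz: "x \<noteq> \<zero>\<^bsub>\<omega>\<^esub>"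
  let ?N = "{r \<star> x | r. r \<in> carrier R}"
  have "LinearCombinations.submodule R ?N \<omega>" by (rule W.cyclic_submodule[OF x])
  moreover have "x \<in> ?N" using x W.smult_one by (metis (mono_tags, lifting) mem_Collect_eq one_closed)
  ultimately have "e \<in> ?N" using nz ess by blast
  then show False using z tau_e by auto
qed

lemma tau_diff_eq:
  assumes xy: "x \<in> W" "y \<in> W" and eq: "\<And>r. r \<in> carrier R \<Longrightarrow> \<tau> (r \<star> x) = \<tau> (r \<star> y)"
  shows "x = y"
proof -
  have "x \<oplus>\<^bsub>\<omega>\<^esub> \<ominus>\<^bsub>\<omega>\<^esub> y = \<zero>\<^bsub>\<omega>\<^esub>"
  proof (rule eq_zero_if_tau)
    fix r assume r: "r \<in> carrier R"
    have "\<tau> (r \<star> y) + \<tau> (r \<star> \<ominus>\<^bsub>\<omega>\<^esub> y) = \<tau> (r \<star> (y \<oplus>\<^bsub>\<omega>\<^esub> \<ominus>\<^bsub>\<omega>\<^esub> y))"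
      using r xy W.smult_r_distr tau_add by simp
    also have "\<dots> = 0" using r xy tau_zero by (simp add: W.M.r_neg)
    finally show "\<tau> (r \<star> (x \<oplus>\<^bsub>\<omega>\<^esub> \<ominus>\<^bsub>\<omega>\<^esub> y)) = 0"
      using r xy W.smult_r_distr tau_add eq[OF r] by simp
  qed (use xy in simp)
  then show ?thesis using xy by (metis W.M.a_inv_closed W.M.minus_equality W.M.minus_minus W.M.a_comm)
qed

lemma smult_left_commute:
  "r \<in> carrier R \<Longrightarrow> s \<in> carrier R \<Longrightarrow> x \<in> W \<Longrightarrow> r \<star> (s \<star> x) = s \<star> (r \<star> x)"
  by (simp add: m_comm flip: W.smult_assoc1)

lemma dual_form_tau: "x \<in> W \<Longrightarrow> dual_form (\<lambda>p. \<tau> (\<psi> p \<star> x))"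
  unfolding dual_form_def
  by (auto simp: psi_add W.smult_l_distr tau_add psi_mult W.smult_assoc1 tau_smult vanishing_def
    ker[THEN iffD2] tau_zero)

text \<open>Since \<open>Ann z \<subseteq> \<mm> = Ann e\<close>, the map \<open>k \<otimes> z \<mapsto> k \<odot> e\<close> is well defined on the ideal \<open>R z\<close>, and it
  extends to \<open>R\<close>.\<close>

lemma faithful:
  assumes z: "z \<in> carrier R" "z \<noteq> \<zero>"
  shows "\<exists>x\<in>W. \<tau> (z \<star> x) \<noteq> 0"
proof -
  have kill: "k \<star> e = \<zero>\<^bsub>\<omega>\<^esub>" if k: "k \<in> carrier R" "k \<otimes> z = \<zero>" for k
  proof -
    have "k \<in> m0"
      using unit_annihilates[OF z(1) k(1)] k z by (auto simp: m_comm)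
    then show ?thesis by (rule ann)
  qed
  have wd: "k \<star> e = l \<star> e" if kl: "k \<in> carrier R" "l \<in> carrier R" "k \<otimes> z = l \<otimes> z" for k l
  proof -
    have "(k \<ominus> l) \<otimes> z = \<zero>" using kl z by (simp add: minus_eq l_distr l_minus r_neg)
    then have "(k \<ominus> l) \<star> e = \<zero>\<^bsub>\<omega>\<^esub>" using kill kl by simp
    then have "k \<star> e \<oplus>\<^bsub>\<omega>\<^esub> \<ominus>\<^bsub>\<omega>\<^esub> (l \<star> e) = \<zero>\<^bsub>\<omega>\<^esub>"
      using kl e by (simp add: minus_eq W.smult_l_distr W.smult_l_minus)
    then show ?thesis using kl e
      by (metis W.M.a_comm W.M.a_inv_closed W.M.minus_equality W.M.minus_minus W.smult_closed)
  qed
  interpret self: Module.module R "self_module R" by (rule module_self_module)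
  define A0 where "A0 = {k \<otimes> z | k. k \<in> carrier R}"
  have A0: "LinearCombinations.submodule R A0 (self_module R)"
    using self.cyclic_submodule[of z] z by (simp add: A0_def)
  let ?A = "self_module R\<lparr>carrier := A0\<rparr>"
  have modA: "Module.module R ?A" by (rule self.submodule_is_module[OF A0])
  define g where "g a = (SOME k. k \<in> carrier R \<and> a = k \<otimes> z) \<star> e" for a
  have g: "g (k \<otimes> z) = k \<star> e" if k: "k \<in> carrier R" for k
  proof -
    let ?k = "SOME l. l \<in> carrier R \<and> k \<otimes> z = l \<otimes> z"
    have "?k \<in> carrier R \<and> k \<otimes> z = ?k \<otimes> z" by (rule someI[of _ k]) (use k in simp)
    then show ?thesis unfolding g_def using wd[of ?k k] k by simp
  qed
  have A0E: "\<exists>k\<in>carrier R. a = k \<otimes> z" if "a \<in> A0" for a using that unfolding A0_def by blast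
  have "g \<in> LinearCombinations.module_hom R ?A \<omega>"
    unfolding module_hom_def
  proof (intro CollectI conjI allI impI Pi_I)
    fix a assume "a \<in> carrier ?A"
    then obtain k where "k \<in> carrier R" "a = k \<otimes> z" using A0E by auto
    then show "g a \<in> W" using g e by simp
  next
    fix a b assume "a \<in> carrier ?A \<and> b \<in> carrier ?A"
    then have "a \<in> A0" "b \<in> A0" by simp_all
    then obtain k l where kl: "k \<in> carrier R" "a = k \<otimes> z" "l \<in> carrier R" "b = l \<otimes> z"
      using A0E[of a] A0E[of b] by blast
    then have "a \<oplus> b = (k \<oplus> l) \<otimes> z" using z by (simp add: l_distr)
    then show "g (a \<oplus>\<^bsub>?A\<^esub> b) = g a \<oplus>\<^bsub>\<omega>\<^esub> g b" using kl g e by (simp add: W.smult_l_distr)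
  next
    fix c a assume ca: "c \<in> carrier R \<and> a \<in> carrier ?A"
    then obtain k where k: "k \<in> carrier R" "a = k \<otimes> z" using A0E by auto
    then have "c \<otimes> a = (c \<otimes> k) \<otimes> z" using z ca by (simp add: m_assoc)
    then show "g (c \<odot>\<^bsub>?A\<^esub> a) = c \<star> g a" using k g e ca by (simp add: W.smult_assoc1)
  qed
  moreover have "id \<in> LinearCombinations.module_hom R ?A (self_module R)"
    unfolding module_hom_def using A0 by (auto simp: submodule_def)
  moreover have "inj_on id (carrier ?A)" by simp
  ultimately obtain h where h: "h \<in> LinearCombinations.module_hom R (self_module R) \<omega>"
    and hg: "\<And>a. a \<in> A0 \<Longrightarrow> h a = g a"
    using injective modA module_self_module unfolding injective_module_def by fastforce
  have h1: "h \<one> \<in> W" using module_hom_closed[OF h] by auto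
  have zA: "z \<in> A0" unfolding A0_def using z by (auto intro: exI[of _ \<one>])
  have "z \<star> h \<one> = h z" using module_hom_smult[OF h, of z \<one>] z by simp
  also have "\<dots> = g (\<one> \<otimes> z)" using hg[OF zA] z by simp
  also have "\<dots> = e" using g[of \<one>] e by simp
  finally have "z \<star> h \<one> = e" .
  then show ?thesis using h1 tau_e by (intro bexI[of _ "h \<one>"]) simp_all
qed

lemma tau_sum:
  assumes "x \<in> W"
  shows "\<tau> (\<psi> (\<Sum>t\<in>B. single t (c t)) \<star> x) = (\<Sum>t\<in>B. c t * \<tau> (\<psi> (single t 1) \<star> x))"
proof -
  have S: "(\<Sum>t\<in>B. single t (c t)) \<in> S" by (intro sum_in_mpoly single_B)
  have "lookup (\<Sum>t\<in>B. single t (c t)) t = c t" if "t \<in> B" for t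
    using that by (rule lookup_sum_singles[OF finite_B])
  then show ?thesis using dual_form_sum[OF dual_form_tau[OF assms] S] by simp
qed

text \<open>If \<open>c\<close> were not attained, some functional \<phi> would vanish on all
  attained vectors of values but not on \<open>c\<close>. Such a \<phi> is evaluation at an element
  \<open>r\<close> of \<open>R\<close>, namely the one with coefficients
  \<open>\<phi> (x^t)\<close>. Then \<tau> vanishes on \<open>r \<star> x\<close> for all
  \<open>x\<close>, so \<open>r\<close> is zero by \<open>faithful\<close>, and with it
  \<phi>.\<close>

lemma dual_surj:
  "\<exists>x\<in>W. \<forall>t\<in>B. \<tau> (\<psi> (single t 1) \<star> x) = c t"
proof (rule ccontr)
  assume no: "\<not> ?thesis"
  \<comment> \<open>A vector of values is stored as a polynomial, with the value at \<open>t\<close>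
    as coefficient of \<open>x^t\<close>. Coefficients outside \<open>B\<close> are left free, so
    that \<open>E\<close> contains the ideal.\<close>
  define E where "E = {p \<in> S. \<exists>x\<in>W. \<forall>t\<in>B. lookup p t = \<tau> (\<psi> (single t 1) \<star> x)}"
  let ?v = "\<Sum>t\<in>B. single t (c t)"
  have lk: "lookup (\<Sum>t\<in>B. single t (c t)) t = c t" if "t \<in> B" for t and c :: "_ \<Rightarrow> 'k"
    using that by (rule lookup_sum_singles[OF finite_B])
  have sS: "(\<Sum>t\<in>B. single t (c t)) \<in> S" for c :: "_ \<Rightarrow> 'k" by (intro sum_in_mpoly single_B)
  have X: "\<psi> (single t 1) \<in> carrier R" if "t \<in> B" for t using single_B[OF that] by simp
  obtain \<phi> where df: "dual_form \<phi>" and E0: "\<And>p. p \<in> E \<Longrightarrow> \<phi> p = 0" and v1: "\<phi> ?v = 1"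
  proof (rule dual_form_exists[of E ?v])
    show "E \<subseteq> S" unfolding E_def by blast
    show "vanishing n B \<subseteq> E"
      using X unfolding E_def vanishing_def
      by (auto intro!: bexI[of _ "\<zero>\<^bsub>\<omega>\<^esub>"] simp: tau_zero in_keys_iff disjoint_iff)
    show "p + q \<in> E" if pq: "p \<in> E" "q \<in> E" for p q
    proof -
      obtain x y where xy: "x \<in> W" "y \<in> W" "\<forall>t\<in>B. lookup p t = \<tau> (\<psi> (single t 1) \<star> x)"
          "\<forall>t\<in>B. lookup q t = \<tau> (\<psi> (single t 1) \<star> y)" and S: "p \<in> S" "q \<in> S"
        using pq unfolding E_def by blast
      have "\<forall>t\<in>B. lookup (p + q) t = \<tau> (\<psi> (single t 1) \<star> (x \<oplus>\<^bsub>\<omega>\<^esub> y))"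
        using xy X by (simp add: lookup_add W.smult_r_distr tau_add)
      moreover have "x \<oplus>\<^bsub>\<omega>\<^esub> y \<in> W" using xy by simp
      ultimately show ?thesis using mpoly_closed(1)[OF S] unfolding E_def by auto
    qed
    show "single 0 a * p \<in> E" if p: "p \<in> E" for a p
    proof -
      obtain x where x: "x \<in> W" "\<forall>t\<in>B. lookup p t = \<tau> (\<psi> (single t 1) \<star> x)" and S: "p \<in> S"
        using p unfolding E_def by blast
      have "\<tau> (\<psi> (single t 1) \<star> (\<psi> (single 0 a) \<star> x)) = lookup (single 0 a * p) t" if t: "t \<in> B" for t
      proof -
        have "\<psi> (single t 1) \<star> (\<psi> (single 0 a) \<star> x) = \<psi> (single 0 a) \<star> (\<psi> (single t 1) \<star> x)"
          using X[OF t] x(1) by (simp add: smult_left_commute)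
        then show ?thesis
          using x t X[OF t] tau_smult by (simp add: lookup_single_mult dvs_def)
      qed
      moreover have "\<psi> (single 0 a) \<star> x \<in> W" using x by simp
      ultimately show ?thesis using mpoly_closed(2)[OF const_S[of a] S] unfolding E_def
        by (intro CollectI conjI bexI[of _ "\<psi> (single 0 a) \<star> x"]) simp_all
    qed
    show "?v \<in> S" by (rule sS)
    show "?v \<notin> E"
    proof
      assume "?v \<in> E"
      then obtain x where "x \<in> W" "\<forall>t\<in>B. lookup ?v t = \<tau> (\<psi> (single t 1) \<star> x)"
        unfolding E_def by blast
      with no lk show False by auto
    qed
  qed (rule that)
  define r where "r = \<psi> (\<Sum>t\<in>B. single t (\<phi> (single t 1)))"
  have rc: "r \<in> carrier R" unfolding r_def using sS by simp
  have "\<tau> (r \<star> x) = 0" if x: "x \<in> W" for x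
  proof -
    let ?f = "\<Sum>t\<in>B. single t (\<tau> (\<psi> (single t 1) \<star> x))"
    have "?f \<in> E" unfolding E_def using sS lk x by auto
    then have "\<phi> ?f = 0" by (rule E0)
    moreover have "\<phi> ?f = (\<Sum>t\<in>B. \<tau> (\<psi> (single t 1) \<star> x) * \<phi> (single t 1))"
      using dual_form_sum[OF df sS] lk by simp
    ultimately show ?thesis unfolding r_def tau_sum[OF x] by (simp add: mult.commute)
  qed
  then have "r = \<zero>" using faithful[OF rc] by blast
  then have disj: "keys (\<Sum>t\<in>B. single t (\<phi> (single t 1))) \<inter> B = {}"
    using ker[OF sS] unfolding r_def by simp
  have "\<phi> (single t 1) = 0" if t: "t \<in> B" for t
  proof -
    have "t \<notin> keys (\<Sum>t\<in>B. single t (\<phi> (single t 1)))" using disj t by blast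
    then show ?thesis using lk[OF t, of "\<lambda>t. \<phi> (single t 1)"] by (simp add: in_keys_iff)
  qed
  then have "\<phi> ?v = 0" using dual_form_sum[OF df sS] by simp
  then show False using v1 by simp
qed

section \<open>Lower and upper bounds for the trace ideal\<close>

lemma ideal_trace: "ideal (trace_ideal R \<omega>) R"
  unfolding trace_ideal_def
  by (rule genideal_ideal) (auto simp: module_hom_def Pi_def)

lemma trace_ideal_memI:
  assumes "f \<in> LinearCombinations.module_hom R \<omega> (self_module R)" "x \<in> W"
  shows "f x \<in> trace_ideal R \<omega>"
proof -
  have "{f x | f x. f \<in> LinearCombinations.module_hom R \<omega> (self_module R) \<and> x \<in> W} \<subseteq> carrier R"
    by (auto simp: module_hom_def Pi_def)
  from genideal_self[OF this] show ?thesis using assms unfolding trace_ideal_def by blast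
qed

lemma shift_module_hom:
  assumes ok: "shift_ok d"
  shows "(\<lambda>x. \<psi> (shift d (\<lambda>p. \<tau> (\<psi> p \<star> x)))) \<in> LinearCombinations.module_hom R \<omega> (self_module R)"
    (is "?f \<in> _")
proof -
  let ?\<phi> = "\<lambda>x p. \<tau> (\<psi> p \<star> x)"
  have sd: "single (d - t) 1 \<in> S" for t
    using ok by (intro single_in_mpoly) (auto simp: shift_ok_def in_keys_iff lookup_minus)
  have lk: "lookup (shift d (?\<phi> x)) t = (if dvs t d then ?\<phi> x (single (d - t) 1) else 0)"
    if "x \<in> W" "t \<in> B" for x t
    using lookup_shift_mult[OF ok dual_form_tau[OF that(1)] one_S that(2)] by simp
  have add: "?f (x \<oplus>\<^bsub>\<omega>\<^esub> y) = ?f x \<oplus> ?f y" if xy: "x \<in> W" "y \<in> W" for x y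
  proof -
    have "lookup (shift d (?\<phi> (x \<oplus>\<^bsub>\<omega>\<^esub> y))) t = lookup (shift d (?\<phi> x) + shift d (?\<phi> y)) t"
      if t: "t \<in> B" for t
      using xy t sd by (simp add: lk lookup_add W.smult_r_distr tau_add)
    then have "?f (x \<oplus>\<^bsub>\<omega>\<^esub> y) = \<psi> (shift d (?\<phi> x) + shift d (?\<phi> y))"
      using psi_eq_iff[OF shift_S mpoly_closed(1)[OF shift_S shift_S]] by blast
    then show ?thesis using psi_add[OF shift_S shift_S] by simp
  qed
  have smult: "?f (r \<star> x) = r \<otimes> ?f x" if r: "r \<in> carrier R" and x: "x \<in> W" for r x
  proof -
    obtain p where p: "p \<in> S" "r = \<psi> p" using r by (rule obtain_rep)
    have "lookup (shift d (?\<phi> (r \<star> x))) t = lookup (shift d (?\<phi> x) * p) t" if t: "t \<in> B" for t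
      using lookup_shift_mult[OF ok dual_form_tau[OF x] p(1) t] r x t sd p
      by (simp add: lk psi_mult W.smult_assoc1)
    then have "?f (r \<star> x) = \<psi> (shift d (?\<phi> x) * p)"
      using psi_eq_iff[OF shift_S mpoly_closed(2)[OF shift_S p(1)]] by blast
    then show ?thesis using psi_mult[OF shift_S p(1)] shift_S p by (simp add: m_comm)
  qed
  show ?thesis
    unfolding module_hom_def using add smult shift_S by simp
qed

lemma m0_subset_trace:
  assumes H: "\<And>j. j \<in> {1..n} \<Longrightarrow> single j 1 \<in> B \<Longrightarrow> \<exists>w\<in>B. shift_ok (w + single j 1)"
  shows "m0 \<subseteq> trace_ideal R \<omega>"
proof (rule m0_subset[OF ideal_trace])
  fix j assume j: "j \<in> {1..n}"
  let ?X = "single (single j 1) (1::'k)"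
  have XS: "?X \<in> S" by (rule Var_S[OF j])
  show "\<psi> ?X \<in> trace_ideal R \<omega>"
  proof (cases "single j 1 \<in> B")
    case False
    then have "\<psi> ?X = \<zero>" using ker[OF XS] by simp
    then show ?thesis using additive_subgroup.zero_closed[OF ideal.axioms(1)[OF ideal_trace]] by simp
  next
    case True
    obtain w where w: "w \<in> B" "shift_ok (w + single j 1)" using H[OF j True] by blast
    let ?d = "w + single j 1"
    \<comment> \<open>The dual basis element \<open>x^(-w)\<close>. The shift by
      \<open>d = w + e\<^sub>j\<close> sends it to \<open>x^(d - w)\<close>, the \<open>j\<close>-th
      variable.\<close>
    obtain x where x: "x \<in> W" and tx: "\<forall>t\<in>B. \<tau> (\<psi> (single t 1) \<star> x) = (if t = w then 1 else 0)"
      using dual_surj[of "\<lambda>t. if t = w then 1 else 0"] by blast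
    let ?F = "shift ?d (\<lambda>p. \<tau> (\<psi> p \<star> x))"
    have "lookup ?F t = lookup ?X t" if t: "t \<in> B" for t
    proof -
      have L: "lookup ?F t = (if dvs t ?d then \<tau> (\<psi> (single (?d - t) 1) \<star> x) else 0)"
        using lookup_shift_mult[OF w(2) dual_form_tau[OF x] one_S t] by simp
      show ?thesis
      proof (cases "dvs t ?d")
        case True
        have kd: "single (?d - t) 1 \<in> S"
          using w(2) by (intro single_in_mpoly) (auto simp: shift_ok_def in_keys_iff lookup_minus)
        have "\<tau> (\<psi> (single (?d - t) 1) \<star> x) = (if ?d - t = w then 1 else 0)"
        proof (cases "?d - t \<in> B")
          case True
          then show ?thesis using tx by blast
        next
          case False
          then have "\<psi> (single (?d - t) 1) = \<zero>" using ker[OF kd] by simp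
          then show ?thesis using False w(1) x tau_zero by auto
        qed
        moreover have "?d - t = w \<longleftrightarrow> t = single j 1"
          using dvs_add_diff[OF True] by (metis add.commute add_diff_cancel_left')
        ultimately show ?thesis using L True by (simp add: lookup_single when_def)
      next
        case False
        then have "t \<noteq> single j 1" using dvs_add(2) by metis
        then show ?thesis using L False by (simp add: lookup_single when_def)
      qed
    qed
    then have "\<psi> ?F = \<psi> ?X" using psi_eq_iff[OF shift_S XS] by blast
    then show ?thesis using trace_ideal_memI[OF shift_module_hom[OF w(2)] x] by simp
  qed
qed

text \<open>Applied to \<open>x \<mapsto> f x \<odot> z\<close>, this turns membership questions about \<open>f x\<close> into questions about
  annihilators.\<close>

lemma endomorphism_is_scalar:
  assumes \<theta>: "\<And>x. x \<in> W \<Longrightarrow> \<theta> x \<in> W"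
    and add: "\<And>x y. x \<in> W \<Longrightarrow> y \<in> W \<Longrightarrow> \<theta> (x \<oplus>\<^bsub>\<omega>\<^esub> y) = \<theta> x \<oplus>\<^bsub>\<omega>\<^esub> \<theta> y"
    and smult: "\<And>r x. r \<in> carrier R \<Longrightarrow> x \<in> W \<Longrightarrow> \<theta> (r \<star> x) = r \<star> \<theta> x"
  obtains s where "s \<in> carrier R" "\<And>x. x \<in> W \<Longrightarrow> \<theta> x = s \<star> x"
proof -
  let ?c = "\<lambda>x t. \<tau> (\<psi> (single t 1) \<star> x)"
  have X: "\<psi> (single t 1) \<in> carrier R" if "t \<in> B" for t using single_B[OF that] by simp
  have det: "x = y" if xy: "x \<in> W" "y \<in> W" and eq: "\<forall>t\<in>B. ?c x t = ?c y t" for x y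
  proof (rule tau_diff_eq[OF xy])
    fix r assume "r \<in> carrier R"
    then obtain p where p: "p \<in> S" "r = \<psi> p" by (rule obtain_rep)
    show "\<tau> (r \<star> x) = \<tau> (r \<star> y)"
      using dual_form_sum[OF dual_form_tau[OF xy(1)] p(1)] dual_form_sum[OF dual_form_tau[OF xy(2)] p(1)] eq p(2)
      by simp
  qed
  \<comment> \<open>A chosen inverse of the identification of \<omega> with the dual of
    \<open>R\<close>, again on values stored as coefficients.\<close>
  define el where "el p = (SOME x. x \<in> W \<and> (\<forall>t\<in>B. ?c x t = lookup p t))" for p
  have el: "el p \<in> W" "\<And>t. t \<in> B \<Longrightarrow> ?c (el p) t = lookup p t" for p
  proof -
    have "\<exists>x. x \<in> W \<and> (\<forall>t\<in>B. ?c x t = lookup p t)" using dual_surj[of "lookup p"] by blast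
    from someI_ex[OF this] show "el p \<in> W" "\<And>t. t \<in> B \<Longrightarrow> ?c (el p) t = lookup p t"
      unfolding el_def by blast+
  qed
  have el_add: "el (p + q) = el p \<oplus>\<^bsub>\<omega>\<^esub> el q" for p q
    using el X by (intro det) (simp_all add: W.smult_r_distr tau_add lookup_add)
  have el_smult: "el (single 0 a * p) = \<psi> (single 0 a) \<star> el p" for a p
  proof (rule det)
    show "\<forall>t\<in>B. ?c (el (single 0 a * p)) t = ?c (\<psi> (single 0 a) \<star> el p) t"
    proof
      fix t assume t: "t \<in> B"
      have "\<psi> (single t 1) \<star> (\<psi> (single 0 a) \<star> el p) = \<psi> (single 0 a) \<star> (\<psi> (single t 1) \<star> el p)"
        using X[OF t] el(1) by (simp add: m_comm flip: W.smult_assoc1)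
      then show "?c (el (single 0 a * p)) t = ?c (\<psi> (single 0 a) \<star> el p) t"
        using t X[OF t] el tau_smult by (simp add: lookup_single_mult dvs_def)
    qed
  qed (use el in auto)
  define \<rho> where "\<rho> p = \<tau> (\<theta> (el p))" for p
  have \<rho>: "dual_form \<rho>"
    unfolding dual_form_def \<rho>_def
  proof (intro conjI ballI allI)
    show "\<tau> (\<theta> (el (p + q))) = \<tau> (\<theta> (el p)) + \<tau> (\<theta> (el q))" for p q
      unfolding el_add using add el \<theta> tau_add by simp
    show "\<tau> (\<theta> (el (single 0 c * p))) = c * \<tau> (\<theta> (el p))" for c p
      unfolding el_smult using smult el \<theta> tau_smult by simp
    fix p :: "'k mpoly" assume "p \<in> vanishing n B"
    then have "el p = \<zero> \<star> el p"
      using el X by (intro det) (auto simp: tau_zero vanishing_def in_keys_iff disjoint_iff)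
    then have "\<theta> (el p) = \<zero> \<star> \<theta> (el p)" using smult[of \<zero> "el p"] el by simp
    then show "\<tau> (\<theta> (el p)) = 0" using \<theta> el tau_zero by simp
  qed
  \<comment> \<open>\<open>\<rho>\<close> is \<tau> \<circ> \<theta> read on the dual of
    \<open>R\<close>, hence an element of the double dual; it is evaluation at \<open>s\<close>.
    Thus \<open>\<tau> (\<theta> x) = \<tau> (s \<star> x)\<close>, and replacing \<open>x\<close>
    by its multiples \<open>r \<star> x\<close> determines \<theta> itself.\<close>
  define s where "s = \<psi> (\<Sum>t\<in>B. single t (\<rho> (single t 1)))"
  have s: "s \<in> carrier R" unfolding s_def using single_B by (intro psi_closed sum_in_mpoly)
  have key: "\<tau> (\<theta> x) = \<tau> (s \<star> x)" if x: "x \<in> W" for x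
  proof -
    let ?p = "\<Sum>t\<in>B. single t (?c x t)"
    have lk: "lookup ?p t = ?c x t" if "t \<in> B" for t
      using that by (rule lookup_sum_singles[OF finite_B])
    have pS: "?p \<in> S" using single_B by (intro sum_in_mpoly)
    have "el ?p = x" using el lk x by (intro det) auto
    then have "\<tau> (\<theta> x) = (\<Sum>t\<in>B. ?c x t * \<rho> (single t 1))"
      using dual_form_sum[OF \<rho> pS] lk unfolding \<rho>_def by simp
    then show ?thesis unfolding s_def tau_sum[OF x] by (simp add: mult.commute)
  qed
  have "\<theta> x = s \<star> x" if x: "x \<in> W" for x
  proof (rule tau_diff_eq)
    fix r assume r: "r \<in> carrier R"
    have "r \<star> (s \<star> x) = s \<star> (r \<star> x)"
      using r s x by (simp add: m_comm flip: W.smult_assoc1)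
    then show "\<tau> (r \<star> \<theta> x) = \<tau> (r \<star> (s \<star> x))"
      using key[of "r \<star> x"] smult[OF r x] r x by simp
  qed (use \<theta> s x in auto)
  with s show thesis by (rule that)
qed

lemma trace_mult_double_colon:
  assumes a: "ideal \<aa> R" and y: "y \<in> colon R {\<zero>} (colon R {\<zero>} \<aa>)"
    and f: "f \<in> LinearCombinations.module_hom R \<omega> (self_module R)" and x: "x \<in> W"
  shows "f x \<otimes> y \<in> \<aa>"
proof (rule ccontr)
  assume no: "f x \<otimes> y \<notin> \<aa>"
  interpret A: ideal \<aa> R by (rule a)
  have yc: "y \<in> carrier R" and yk: "\<And>s. s \<in> colon R {\<zero>} \<aa> \<Longrightarrow> y \<otimes> s = \<zero>"
    using y unfolding colon_def by auto
  have fW: "f x \<in> carrier R" if "x \<in> W" for x using module_hom_closed[OF f] that by auto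
  have "f x \<otimes> y \<in> carrier R" using fW[OF x] yc by simp
  then obtain q where q: "q \<in> S" "f x \<otimes> y = \<psi> q" by (rule obtain_rep)
  let ?E = "{p \<in> S. \<psi> p \<in> \<aa>}"
  \<comment> \<open>A functional that separates \<open>f x \<otimes> y\<close> from \<aa>. The
    element \<open>z\<close> of \<omega> realising it is then annihilated by \<aa>.\<close>
  obtain \<phi> where \<phi>: "dual_form \<phi>" and E0: "\<And>p. p \<in> ?E \<Longrightarrow> \<phi> p = 0" and q1: "\<phi> q = 1"
  proof (rule dual_form_exists[of ?E q])
    show "p + q \<in> ?E" if "p \<in> ?E" "q \<in> ?E" for p q
      using that by (simp add: mpoly_closed psi_add A.a_closed)
    show "single 0 c * p \<in> ?E" if "p \<in> ?E" for c p
      using that A.I_l_closed[of "\<psi> p" "\<psi> (single 0 c)"] by (simp add: mpoly_closed psi_mult)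
    show "vanishing n B \<subseteq> ?E"
    proof
      fix p :: "'k mpoly" assume "p \<in> vanishing n B"
      then show "p \<in> ?E" using ker[of p] by (simp add: vanishing_def A.zero_closed)
    qed
    show "q \<in> S" by (rule q(1))
    show "q \<notin> ?E" using no q(2) by simp
    show "?E \<subseteq> S" by blast
  qed (rule that)
  obtain z where z: "z \<in> W" and tz: "\<forall>t\<in>B. \<tau> (\<psi> (single t 1) \<star> z) = \<phi> (single t 1)"
    using dual_surj[of "\<lambda>t. \<phi> (single t 1)"] by blast
  have tz: "\<tau> (\<psi> p \<star> z) = \<phi> p" if "p \<in> S" for p
    using dual_form_sum[OF dual_form_tau[OF z] that] dual_form_sum[OF \<phi> that] tz by simp
  have az: "r \<star> z = \<zero>\<^bsub>\<omega>\<^esub>" if r: "r \<in> \<aa>" for r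
  proof (rule eq_zero_if_tau)
    fix s assume s: "s \<in> carrier R"
    have sr: "s \<otimes> r \<in> \<aa>" using s r by (rule A.I_l_closed[rotated])
    then have "s \<otimes> r \<in> carrier R" by (rule A.Icarr)
    then obtain p where p: "p \<in> S" "s \<otimes> r = \<psi> p" by (rule obtain_rep)
    have "\<tau> (s \<star> (r \<star> z)) = \<tau> (\<psi> p \<star> z)"
      using s r z A.Icarr p(2) by (simp flip: W.smult_assoc1)
    also have "\<dots> = 0" using tz[OF p(1)] E0[of p] p sr by simp
    finally show "\<tau> (s \<star> (r \<star> z)) = 0" .
  qed (use r z A.Icarr in simp)
  obtain s where s: "s \<in> carrier R" "\<And>x. x \<in> W \<Longrightarrow> f x \<star> z = s \<star> x"
  proof (rule endomorphism_is_scalar[of "\<lambda>x. f x \<star> z"])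
    show "f x \<star> z \<in> W" if "x \<in> W" for x using fW[OF that] z by simp
    show "f (x \<oplus>\<^bsub>\<omega>\<^esub> y) \<star> z = f x \<star> z \<oplus>\<^bsub>\<omega>\<^esub> f y \<star> z" if "x \<in> W" "y \<in> W" for x y
      using module_hom_add[OF f that] fW that z by (simp add: W.smult_l_distr)
    show "f (r \<star> x) \<star> z = r \<star> (f x \<star> z)" if "r \<in> carrier R" "x \<in> W" for r x
      using module_hom_smult[OF f that] fW that z by (simp add: W.smult_assoc1)
  qed (rule that)
  \<comment> \<open>For every \<open>x\<close>, the element \<open>s \<otimes> r\<close> sends
    \<open>x\<close> to \<open>f x \<star> (r \<star> z)\<close>, which is zero; faithfulness gives
    the claim.\<close>
  have "s \<otimes> r = \<zero>" if r: "r \<in> \<aa>" for r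
  proof (rule ccontr)
    assume nz: "s \<otimes> r \<noteq> \<zero>"
    have rc: "r \<in> carrier R" using r A.Icarr by blast
    obtain x where x: "x \<in> W" "\<tau> ((s \<otimes> r) \<star> x) \<noteq> 0" using faithful[OF _ nz] s rc by auto
    have "(s \<otimes> r) \<star> x = r \<star> (f x \<star> z)"
      using s x(1) rc by (simp add: m_comm W.smult_assoc1)
    also have "\<dots> = f x \<star> (r \<star> z)"
      using rc fW[OF x(1)] z by (simp add: m_comm flip: W.smult_assoc1)
    also have "\<dots> = \<zero>\<^bsub>\<omega>\<^esub>" using az[OF r] fW[OF x(1)] by simp
    finally show False using x(2) tau_zero by simp
  qed
  then have "s \<in> colon R {\<zero>} \<aa>" using s(1) unfolding colon_def by simp
  then have ys: "y \<otimes> s = \<zero>" by (rule yk)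
  have "1 = \<tau> ((f x \<otimes> y) \<star> z)" using tz[OF q(1)] q1 q(2) by simp
  also have "(f x \<otimes> y) \<star> z = y \<star> (f x \<star> z)"
    using fW[OF x] yc z by (simp add: m_comm W.smult_assoc1)
  also have "\<dots> = (y \<otimes> s) \<star> x" using s x yc by (simp add: W.smult_assoc1)
  finally show False using ys x tau_zero by simp
qed

lemma double_colon_of_trace:
  assumes "m0 \<subseteq> trace_ideal R \<omega>"
  shows double_colon_cond
  unfolding double_colon_cond_def
proof (intro allI impI subsetI)
  fix \<aa> y assume a: "ideal \<aa> R" and y: "y \<in> colon R {\<zero>} (colon R {\<zero>} \<aa>)"
  interpret A: ideal \<aa> R by (rule a)
  have yc: "y \<in> carrier R" using y unfolding colon_def by simp
  let ?I = "{r \<in> carrier R. r \<otimes> y \<in> \<aa>}"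
  have "ideal ?I R" by (rule ideal_mult_into[OF a yc])
  then have "trace_ideal R \<omega> \<subseteq> ?I"
    unfolding trace_ideal_def
    by (rule genideal_minimal)
      (use trace_mult_double_colon[OF a y] in \<open>auto simp: module_hom_def Pi_def\<close>)
  then have "r \<otimes> y \<in> \<aa>" if "r \<in> m0" for r using assms that by blast
  then show "y \<in> colon R \<aa> m0"
    using yc m0_carrier unfolding colon_def by (auto simp: m_comm)
qed

end

section \<open>From an injective hull to the dual, and the type as a count of monomials\<close>

lemma FactRing_rep:
  assumes "C \<in> carrier (R Quot I)"
  obtains s where "s \<in> carrier R" "C = I +>\<^bsub>R\<^esub> s"
  using assms unfolding FactRing_def A_RCOSETS_def' by auto

context monomial_quotient begin

text \<open>\<open>e\<close> is the image of the residue class of 1. A nonzero submodule meets the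
  image of the residue field in some nonzero \<open>c e\<close> with \<open>c\<close> a constant, so
  it contains \<open>e\<close>. Since \<open>e\<close> is nonzero, a functional with value 1 at
  \<open>e\<close> exists.\<close>

lemma canonical_dual_module:
  fixes \<omega> :: "('r, 'w) module"
  assumes M: "maximalideal m0 R" and can: "canonical_module R m0 \<omega>"
  shows "\<exists>\<tau> e. dual_module R n B \<psi> \<omega> \<tau> e"
proof -
  interpret M: maximalideal m0 R by (rule M)
  let ?Q = "R Quot m0" and ?k = "residue_module R m0"
  have inj: "injective_module R \<omega>" using can unfolding canonical_module_def injective_hull_def by blast
  obtain \<iota> where \<iota>: "\<iota> \<in> LinearCombinations.module_hom R ?k \<omega>" "inj_on \<iota> (carrier ?k)"
    and hull: "\<And>N. LinearCombinations.submodule R N \<omega> \<Longrightarrow> N \<noteq> {\<zero>\<^bsub>\<omega>\<^esub>} \<Longrightarrow> N \<inter> \<iota> ` carrier ?k \<noteq> {\<zero>\<^bsub>\<omega>\<^esub>}"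
    using can unfolding canonical_module_def injective_hull_def by blast
  interpret W: Module.module R \<omega> using inj unfolding injective_module_def by blast
  note \<pi> = M.rcos_ring_hom
  have k_simps: "carrier ?k = carrier ?Q" "\<And>r C. r \<odot>\<^bsub>?k\<^esub> C = (m0 +> r) \<otimes>\<^bsub>?Q\<^esub> C"
    by (simp_all add: residue_module_def with_smult_def)
  have one: "m0 +> \<one> \<in> carrier ?k" using ring_hom_closed[OF \<pi> one_closed] k_simps by simp
  have r1: "r \<odot>\<^bsub>?k\<^esub> (m0 +> \<one>) = m0 +> r" if "r \<in> carrier R" for r
    using ring_hom_mult[OF \<pi> that one_closed] that k_simps by simp
  define e where "e = \<iota> (m0 +> \<one>)"
  have e: "e \<in> carrier \<omega>" unfolding e_def using module_hom_closed[OF \<iota>(1)] one by auto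
  have re: "\<iota> (m0 +> r) = r \<odot>\<^bsub>\<omega>\<^esub> e" if "r \<in> carrier R" for r
    using module_hom_smult[OF \<iota>(1) that one] r1[OF that] unfolding e_def by simp
  have zero: "\<iota> m0 = \<zero>\<^bsub>\<omega>\<^esub>" using re[OF zero_closed] e M.a_rcos_const[OF M.zero_closed] by simp
  have ann: "r \<odot>\<^bsub>\<omega>\<^esub> e = \<zero>\<^bsub>\<omega>\<^esub>" if "r \<in> m0" for r
    using re[of r] zero M.a_rcos_const[OF that] that m0_carrier by auto
  have m0_k: "m0 \<in> carrier ?k"
    using ring_hom_closed[OF \<pi> zero_closed] M.a_rcos_const[OF M.zero_closed] k_simps by simp
  have e0: "e \<noteq> \<zero>\<^bsub>\<omega>\<^esub>"
  proof
    assume "e = \<zero>\<^bsub>\<omega>\<^esub>"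
    then have "\<iota> (m0 +> \<one>) = \<iota> m0" unfolding e_def using zero by simp
    then have "m0 +> \<one> = m0" using \<iota>(2) one m0_k unfolding inj_on_def by blast
    then have "\<one> \<in> m0" using M.a_rcos_self[OF one_closed] by simp
    then show False using M.one_imp_carrier M.I_notcarr by blast
  qed
  let ?s = "\<lambda>c x. \<psi> (single 0 c) \<odot>\<^bsub>\<omega>\<^esub> x"
  have ess: "e \<in> N" if N: "LinearCombinations.submodule R N \<omega>" "N \<noteq> {\<zero>\<^bsub>\<omega>\<^esub>}" for N
  proof -
    have Nz: "\<zero>\<^bsub>\<omega>\<^esub> \<in> N" and Ns: "\<And>c v. c \<in> carrier R \<Longrightarrow> v \<in> N \<Longrightarrow> c \<odot>\<^bsub>\<omega>\<^esub> v \<in> N"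
      using N(1) unfolding submodule_def by blast+
    have "\<zero>\<^bsub>\<omega>\<^esub> \<in> N \<inter> \<iota> ` carrier ?k" using Nz zero m0_k by (metis IntI imageI)
    then obtain y where y: "y \<in> N" "y \<in> \<iota> ` carrier ?k" "y \<noteq> \<zero>\<^bsub>\<omega>\<^esub>" using hull[OF N] by blast
    then obtain C where "C \<in> carrier ?Q" "y = \<iota> C" using k_simps by auto
    then obtain r where r: "r \<in> carrier R" "y = r \<odot>\<^bsub>\<omega>\<^esub> e"
      using re by (metis FactRing_rep)
    obtain c m where cm: "m \<in> m0" "r = \<psi> (single 0 c) \<oplus> m" "r \<in> m0 \<longleftrightarrow> c = 0"
      using r(1) by (rule const_decomp)
    have c: "c \<noteq> 0" using cm(3) ann r y(3) by blast
    have mc: "m \<in> carrier R" using cm(1) m0_carrier by blast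
    have "y = ?s c e" using r(2) cm(2) ann[OF cm(1)] e mc by (simp add: W.smult_l_distr)
    then have "?s (inverse c) y = e"
      using const_unit[OF c] e by (simp flip: W.smult_assoc1)
    then show ?thesis using Ns[OF psi_closed[OF const_S] y(1)] by metis
  qed
  have "\<exists>\<tau> :: 'w \<Rightarrow> 'k. (\<forall>x\<in>carrier \<omega>. \<forall>y\<in>carrier \<omega>. \<tau> (x \<oplus>\<^bsub>\<omega>\<^esub> y) = \<tau> x + \<tau> y) \<and>
      (\<forall>c. \<forall>x\<in>carrier \<omega>. \<tau> (?s c x) = c * \<tau> x) \<and> \<tau> e = 1"
  proof (rule linear_functional_exists[of \<omega> ?s "{\<zero>\<^bsub>\<omega>\<^esub>}" e])
    show "abelian_group \<omega>" by unfold_locales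
    show "?s (c + d) x = ?s c x \<oplus>\<^bsub>\<omega>\<^esub> ?s d x" if "x \<in> carrier \<omega>" for c d x
      using that psi_add[OF const_S const_S, of c d] by (simp add: single_add W.smult_l_distr)
    show "?s (c * d) x = ?s c (?s d x)" if "x \<in> carrier \<omega>" for c d x
      using that psi_mult[OF const_S const_S, of c d] by (simp add: mult_single W.smult_assoc1)
  next
    fix \<tau> :: "'w \<Rightarrow> 'k"
    assume "\<And>x y. x \<in> carrier \<omega> \<Longrightarrow> y \<in> carrier \<omega> \<Longrightarrow> \<tau> (x \<oplus>\<^bsub>\<omega>\<^esub> y) = \<tau> x + \<tau> y"
      "\<And>c x. x \<in> carrier \<omega> \<Longrightarrow> \<tau> (?s c x) = c * \<tau> x" "\<tau> e = 1"
    then show ?thesis by blast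
  qed (use e e0 in \<open>auto simp: W.smult_r_distr\<close>)
  then obtain \<tau> :: "'w \<Rightarrow> 'k" where \<tau>:
      "\<And>x y. x \<in> carrier \<omega> \<Longrightarrow> y \<in> carrier \<omega> \<Longrightarrow> \<tau> (x \<oplus>\<^bsub>\<omega>\<^esub> y) = \<tau> x + \<tau> y"
      "\<And>c x. x \<in> carrier \<omega> \<Longrightarrow> \<tau> (?s c x) = c * \<tau> x" "\<tau> e = 1" by blast
  have "dual_module R n B \<psi> \<omega> \<tau> e"
    by unfold_locales (use e ess ann \<tau> inj in auto)
  then show ?thesis by blast
qed

definition socle_exps :: "(nat \<Rightarrow>\<^sub>0 nat) set" where
  "socle_exps = {t \<in> B. \<forall>j\<in>{1..n}. t + single j 1 \<notin> B}"

lemma ring_type_le: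
  assumes M: "maximalideal m0 R"
  shows "ring_type R m0 \<le> card socle_exps"
proof -
  interpret M: maximalideal m0 R by (rule M)
  let ?Q = "R Quot m0" and ?V = "socle_space R m0" and ?A = "colon R {\<zero>} m0"
  let ?X = "\<lambda>t. \<psi> (single t 1)"
  note \<pi> = M.rcos_ring_hom
  have A_carrier: "x \<in> carrier R" if "x \<in> ?A" for x using that unfolding colon_def by simp
  have A_ann: "m \<otimes> x = \<zero>" if "x \<in> ?A" "m \<in> m0" for x m
    using that m0_carrier unfolding colon_def by (auto simp: m_comm)
  have V_simps: "carrier ?V = ?A" "\<And>x y. x \<oplus>\<^bsub>?V\<^esub> y = x \<oplus> y" "\<zero>\<^bsub>?V\<^esub> = \<zero>"
    by (simp_all add: socle_space_def with_smult_def)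
  \<comment> \<open>The definite description in \<open>socle_space\<close> has exactly one solution:
    two members of a residue class differ by an element of \<open>m0\<close>, which kills the
    socle.\<close>
  have sm: "(m0 +> s) \<odot>\<^bsub>?V\<^esub> x = s \<otimes> x" if s: "s \<in> carrier R" and x: "x \<in> ?A" for s x
  proof -
    have "r \<otimes> x = s \<otimes> x" if r: "r \<in> m0 +> s" for r
    proof -
      have rc: "r \<in> carrier R" using M.a_elemrcos_carrier[OF s r] .
      have "(r \<oplus> \<ominus> s) \<otimes> x = \<zero>" using A_ann[OF x] M.a_rcos_module_imp[OF s r] by blast
      then have "r \<otimes> x \<oplus> \<ominus> (s \<otimes> x) = \<zero>"
        using rc s A_carrier[OF x] by (simp add: l_distr l_minus)
      then show ?thesis using rc s A_carrier[OF x]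
        by (metis a_comm a_inv_closed m_closed minus_equality minus_minus)
    qed
    moreover have "s \<in> m0 +> s" using M.a_rcos_self[OF s] .
    ultimately have "(THE y. \<exists>r\<in>m0 +> s. y = r \<otimes> x) = s \<otimes> x" by (intro the_equality) blast+
    then show ?thesis by (simp add: socle_space_def with_smult_def)
  qed
  have Q_rep: "\<exists>s\<in>carrier R. C = m0 +> s" if "C \<in> carrier ?Q" for C
    using that by (metis FactRing_rep)
  have A_add: "x \<oplus> y \<in> ?A" if "x \<in> ?A" "y \<in> ?A" for x y
    using that m0_carrier unfolding colon_def by (auto simp: l_distr)
  have A_mult: "s \<otimes> x \<in> ?A" if "s \<in> carrier R" "x \<in> ?A" for s x
    using that m0_carrier unfolding colon_def by (auto simp: m_assoc subset_iff)
  have A_zero: "\<zero> \<in> ?A" using m0_carrier unfolding colon_def by auto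
  have fieldQ: "Ring.field ?Q" by (rule M.quotient_is_field) (rule cring_axioms)
  interpret Q: Ring.field ?Q by (rule fieldQ)
  have "Module.module ?Q ?V"
  proof (rule module_criteria)
    show "cring ?Q" by (rule Q.cring_axioms)
    show "\<forall>v\<in>carrier ?V. \<exists>w\<in>carrier ?V. v \<oplus>\<^bsub>?V\<^esub> w = \<zero>\<^bsub>?V\<^esub>"
    proof
      fix v assume "v \<in> carrier ?V"
      then have v: "v \<in> ?A" using V_simps by simp
      have "\<ominus> \<one> \<otimes> v \<in> ?A" by (rule A_mult[OF _ v]) simp
      moreover have "v \<oplus> \<ominus> \<one> \<otimes> v = \<zero>" using A_carrier[OF v] by (simp add: l_minus r_neg)
      ultimately show "\<exists>w\<in>carrier ?V. v \<oplus>\<^bsub>?V\<^esub> w = \<zero>\<^bsub>?V\<^esub>" using V_simps by auto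
    qed
    show "\<forall>C v. C \<in> carrier ?Q \<and> v \<in> carrier ?V \<longrightarrow> C \<odot>\<^bsub>?V\<^esub> v \<in> carrier ?V"
      using sm A_mult V_simps(1) Q_rep by metis
    show "\<forall>v\<in>carrier ?V. \<one>\<^bsub>?Q\<^esub> \<odot>\<^bsub>?V\<^esub> v = v"
      using sm[OF one_closed] ring_hom_one[OF \<pi>] A_carrier V_simps(1) by auto
    show "\<forall>C D v. C \<in> carrier ?Q \<and> D \<in> carrier ?Q \<and> v \<in> carrier ?V \<longrightarrow>
        (C \<otimes>\<^bsub>?Q\<^esub> D) \<odot>\<^bsub>?V\<^esub> v = C \<odot>\<^bsub>?V\<^esub> (D \<odot>\<^bsub>?V\<^esub> v)"
    proof (intro allI impI)
      fix C D v assume h: "C \<in> carrier ?Q \<and> D \<in> carrier ?Q \<and> v \<in> carrier ?V"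
      obtain s t where st: "s \<in> carrier R" "C = m0 +> s" "t \<in> carrier R" "D = m0 +> t"
        using h Q_rep by blast
      have v: "v \<in> ?A" using h V_simps by simp
      have "C \<otimes>\<^bsub>?Q\<^esub> D = m0 +> (s \<otimes> t)" using ring_hom_mult[OF \<pi> st(1,3)] st by simp
      then show "(C \<otimes>\<^bsub>?Q\<^esub> D) \<odot>\<^bsub>?V\<^esub> v = C \<odot>\<^bsub>?V\<^esub> (D \<odot>\<^bsub>?V\<^esub> v)"
        using st v A_carrier[OF v] by (simp add: sm A_mult m_assoc)
    qed
    show "\<forall>C D v. C \<in> carrier ?Q \<and> D \<in> carrier ?Q \<and> v \<in> carrier ?V \<longrightarrow>
        (C \<oplus>\<^bsub>?Q\<^esub> D) \<odot>\<^bsub>?V\<^esub> v = C \<odot>\<^bsub>?V\<^esub> v \<oplus>\<^bsub>?V\<^esub> D \<odot>\<^bsub>?V\<^esub> v"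
    proof (intro allI impI)
      fix C D v assume h: "C \<in> carrier ?Q \<and> D \<in> carrier ?Q \<and> v \<in> carrier ?V"
      obtain s t where st: "s \<in> carrier R" "C = m0 +> s" "t \<in> carrier R" "D = m0 +> t"
        using h Q_rep by blast
      have v: "v \<in> ?A" using h V_simps by simp
      have "C \<oplus>\<^bsub>?Q\<^esub> D = m0 +> (s \<oplus> t)" using ring_hom_add[OF \<pi> st(1,3)] st by simp
      then show "(C \<oplus>\<^bsub>?Q\<^esub> D) \<odot>\<^bsub>?V\<^esub> v = C \<odot>\<^bsub>?V\<^esub> v \<oplus>\<^bsub>?V\<^esub> D \<odot>\<^bsub>?V\<^esub> v"
        using st v A_carrier[OF v] by (simp add: sm V_simps l_distr)
    qed
    show "\<forall>C v w. C \<in> carrier ?Q \<and> v \<in> carrier ?V \<and> w \<in> carrier ?V \<longrightarrow>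
        C \<odot>\<^bsub>?V\<^esub> (v \<oplus>\<^bsub>?V\<^esub> w) = C \<odot>\<^bsub>?V\<^esub> v \<oplus>\<^bsub>?V\<^esub> C \<odot>\<^bsub>?V\<^esub> w"
    proof (intro allI impI)
      fix C v w assume h: "C \<in> carrier ?Q \<and> v \<in> carrier ?V \<and> w \<in> carrier ?V"
      obtain s where st: "s \<in> carrier R" "C = m0 +> s" using h Q_rep by blast
      have v: "v \<in> ?A" "w \<in> ?A" using h V_simps by simp_all
      then show "C \<odot>\<^bsub>?V\<^esub> (v \<oplus>\<^bsub>?V\<^esub> w) = C \<odot>\<^bsub>?V\<^esub> v \<oplus>\<^bsub>?V\<^esub> C \<odot>\<^bsub>?V\<^esub> w"
        using st A_carrier[OF v(1)] A_carrier[OF v(2)] A_add[OF v] by (simp add: sm V_simps r_distr)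
    qed
  qed (use A_carrier A_add A_zero in \<open>auto simp: V_simps a_ac\<close>)
  then interpret V: vectorspace ?Q ?V using fieldQ by (simp add: vectorspace_def)
  let ?G = "?X ` socle_exps"
  have fin: "finite socle_exps" using finite_B unfolding socle_exps_def by simp
  have X_socle: "?X t \<in> ?A" if t: "t \<in> socle_exps" for t
  proof -
    have tS: "single t 1 \<in> S" using t single_B unfolding socle_exps_def by blast
    let ?I = "{s \<in> carrier R. s \<otimes> ?X t \<in> {\<zero>}}"
    have "ideal ?I R" using tS by (intro ideal_mult_into zeroideal) simp
    then have "m0 \<subseteq> ?I"
    proof (rule m0_subset)
      fix j assume j: "j \<in> {1..n}"
      have kj: "single (single j 1) 1 \<in> S" using j by (intro Var_S) blast
      have "t + single j 1 \<notin> B" using t j unfolding socle_exps_def by blast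
      then have "?X (single j 1) \<otimes> ?X t = \<zero>"
        using ker[OF mpoly_closed(2)[OF tS kj]] psi_mult[OF tS kj] tS kj
        by (simp add: mult_single m_comm)
      then show "?X (single j 1) \<in> ?I" using kj by simp
    qed
    then show ?thesis using tS unfolding colon_def by (auto simp: m_comm)
  qed
  have GA: "?G \<subseteq> carrier ?V" using X_socle V_simps by auto
  have sub: "LinearCombinations.submodule ?Q (V.span ?G) ?V" by (rule V.span_is_submodule[OF GA])
  have span_add: "v \<oplus> w \<in> V.span ?G" if "v \<in> V.span ?G" "w \<in> V.span ?G" for v w
    using submodule.m_closed[OF sub that] V_simps by simp
  have term_in: "\<psi> (single t c) \<in> V.span ?G" if t: "t \<in> socle_exps" for t c
  proof -
    have tS: "single t 1 \<in> S" using t single_B unfolding socle_exps_def by blast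
    have "m0 +> \<psi> (single 0 c) \<in> carrier ?Q" by (rule ring_hom_closed[OF \<pi>]) simp
    moreover have "?X t \<in> V.span ?G" using V.in_own_span[OF GA] t by blast
    ultimately have "(m0 +> \<psi> (single 0 c)) \<odot>\<^bsub>?V\<^esub> ?X t \<in> V.span ?G"
      by (rule submodule.smult_closed[OF sub])
    moreover have "\<psi> (single 0 c) \<otimes> ?X t = \<psi> (single t c)"
      using psi_mult[OF const_S tS, of c] by (simp add: mult_single)
    ultimately show ?thesis using sm[OF psi_closed[OF const_S] X_socle[OF t]] by metis
  qed
  have "carrier ?V \<subseteq> V.span ?G"
  proof
    fix r assume "r \<in> carrier ?V"
    then have r: "r \<in> ?A" using V_simps by simp
    obtain p where p: "p \<in> S" "r = \<psi> p" using A_carrier[OF r] by (rule obtain_rep)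
    have zero: "lookup p t = 0" if t: "t \<in> B" "t \<notin> socle_exps" for t
    proof -
      obtain j where j: "j \<in> {1..n}" "t + single j 1 \<in> B" using t unfolding socle_exps_def by blast
      have kj: "single (single j 1) 1 \<in> S" using j by (intro Var_S) blast
      have "?X (single j 1) \<in> m0" by (rule psi_Var_m0[OF j(1)])
      then have "\<psi> (single (single j 1) 1 * p) = \<zero>"
        using A_ann[OF r] p psi_mult[OF kj p(1)] by simp
      then have "lookup (single (single j 1) 1 * p) (single j 1 + t) = 0"
        using ker[OF mpoly_closed(2)[OF kj p(1)]] j(2) by (auto simp: add.commute in_keys_iff disjoint_iff)
      then show ?thesis using dvs_add(1)[of "single j 1" t] by (simp add: lookup_single_mult)
    qed
    let ?p = "\<Sum>t\<in>socle_exps. single t (lookup p t)"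
    have pS: "(\<Sum>t\<in>T. single t (lookup p t)) \<in> S" if "T \<subseteq> socle_exps" for T
      using that single_B unfolding socle_exps_def by (intro sum_in_mpoly) auto
    have "lookup ?p t = lookup p t" if "t \<in> B" for t
      using zero[OF that] fin by (simp add: lookup_sum lookup_single when_def sum.delta')
    then have "r = \<psi> ?p" using psi_eq_iff[OF p(1) pS[OF order.refl]] p(2) by simp
    also have "\<psi> (\<Sum>t\<in>T. single t (lookup p t)) \<in> V.span ?G" if "T \<subseteq> socle_exps" for T
      using finite_subset[OF that fin] that
    proof (induction T rule: finite_induct)
      case empty
      show ?case using submodule.zero_closed[OF sub] V_simps by simp
    next
      case (insert t T)
      have "single t (lookup p t) \<in> S" using insert.prems single_B unfolding socle_exps_def by blast
      then show ?case using insert pS[of T] term_in[of t "lookup p t"] span_add by (simp add: psi_add)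
    qed
    finally show "r \<in> V.span ?G" by simp
  qed
  moreover have "V.span ?G \<subseteq> carrier ?V" by (rule V.span_is_subset2[OF GA])
  ultimately have "V.dim \<le> card ?G" using fin GA by (intro V.gen_ge_dim) auto
  also have "\<dots> \<le> card socle_exps" by (rule card_image_le[OF fin])
  finally show ?thesis unfolding ring_type_def .
qed

end

section \<open>The colon condition and exponent vectors\<close>

definition expv :: "nat \<Rightarrow> (nat \<Rightarrow> nat) \<Rightarrow> (nat \<Rightarrow>\<^sub>0 nat)" where
  "expv n f = (\<Sum>i\<in>{1..n}. single i (f i))"

lemma lookup_expv: "lookup (expv n f) i = (if i \<in> {1..n} then f i else 0)"
  by (simp add: expv_def lookup_sum lookup_single when_def)

lemma keys_expv: "keys (expv n f) \<subseteq> {1..n}"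
  unfolding in_keys_iff subset_iff lookup_expv by simp

lemma lookup_outside: "keys t \<subseteq> {1..n} \<Longrightarrow> i \<notin> {1..n} \<Longrightarrow> lookup t i = 0"
  by (auto simp: in_keys_iff)

lemma expv_lookup: "keys t \<subseteq> {1..n} \<Longrightarrow> expv n (lookup t) = t"
  by (intro poly_mapping_eqI) (metis lookup_expv lookup_outside)

lemma expv_in_down_set: "f \<in> W \<Longrightarrow> expv n f \<in> down_set n W"
  unfolding down_set_def using keys_expv[of n f] by (intro CollectI conjI bexI[of _ f]) (simp_all add: lookup_expv)

lemma down_set_down:
  assumes "t \<in> down_set n W" "dvs s t"
  shows "s \<in> down_set n W"
proof -
  obtain w where w: "w \<in> W" "\<forall>i\<in>{1..n}. lookup t i \<le> w i" and k: "keys t \<subseteq> {1..n}"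
    using assms(1) unfolding down_set_def by blast
  have "\<forall>i\<in>{1..n}. lookup s i \<le> w i" using w(2) assms(2) unfolding dvs_def by (meson le_trans)
  then show ?thesis using w(1) k dvs_keys[OF assms(2)] unfolding down_set_def by blast
qed

lemma finite_down_set:
  assumes "finite W"
  shows "finite (down_set n W)"
proof -
  have "down_set n W \<subseteq> (\<Union>w\<in>W. expv n ` (PiE {1..n} (\<lambda>i. {..w i})))"
  proof
    fix t assume "t \<in> down_set n W"
    then obtain w where w: "w \<in> W" "\<forall>i\<in>{1..n}. lookup t i \<le> w i" and k: "keys t \<subseteq> {1..n}"
      unfolding down_set_def by blast
    have PE: "restrict (lookup t) {1..n} \<in> PiE {1..n} (\<lambda>i. {..w i})" using w(2) by simp
    have "expv n (restrict (lookup t) {1..n}) = expv n (lookup t)"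
      unfolding expv_def by (rule sum.cong) simp_all
    then have "t = expv n (restrict (lookup t) {1..n})" using expv_lookup[OF k] by simp
    then show "t \<in> (\<Union>w\<in>W. expv n ` (PiE {1..n} (\<lambda>i. {..w i})))" using w(1) PE by blast
  qed
  moreover have "finite (\<Union>w\<in>W. expv n ` (PiE {1..n} (\<lambda>i. {..w i})))"
    using assms by (auto intro!: finite_PiE)
  ultimately show ?thesis by (rule finite_subset)
qed

lemma down_set_cong:
  assumes "\<And>f. f \<in> W \<Longrightarrow> \<exists>g\<in>W'. \<forall>x\<in>{1..n}. f x = g x"
    and "\<And>g. g \<in> W' \<Longrightarrow> \<exists>f\<in>W. \<forall>x\<in>{1..n}. f x = g x"
  shows "down_set n W = down_set n W'"
proof -
  have "\<exists>g\<in>V'. \<forall>i\<in>{1..n}. lookup t i \<le> g i"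
    if "\<exists>f\<in>V. \<forall>i\<in>{1..n}. lookup t i \<le> f i" "\<And>f. f \<in> V \<Longrightarrow> \<exists>g\<in>V'. \<forall>x\<in>{1..n}. f x = g x"
    for V V' :: "(nat \<Rightarrow> nat) set" and t
  proof -
    note h = that
    obtain f where f: "f \<in> V" "\<forall>i\<in>{1..n}. lookup t i \<le> f i" using h(1) by blast
    obtain g where g: "g \<in> V'" "\<forall>x\<in>{1..n}. f x = g x" using h(2)[OF f(1)] by blast
    have "\<forall>i\<in>{1..n}. lookup t i \<le> g i" using f(2) g(2) by simp
    then show ?thesis using g(1) by blast
  qed
  note * = this
  have "\<exists>f\<in>W. \<forall>x\<in>{1..n}. g x = f x" if g: "g \<in> W'" for g
  proof -
    obtain f where "f \<in> W" "\<forall>x\<in>{1..n}. f x = g x" using assms(2)[OF g] by blast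
    then show ?thesis by (intro bexI[of _ f]) simp_all
  qed
  with * assms(1) have "(\<exists>f\<in>W. \<forall>i\<in>{1..n}. lookup t i \<le> f i) \<longleftrightarrow> (\<exists>g\<in>W'. \<forall>i\<in>{1..n}. lookup t i \<le> g i)" for t
    by (intro iffI) (rule *; assumption)+
  then show ?thesis unfolding down_set_def by simp
qed

text \<open>\<open>shift_ok\<close> for \<open>d = w + e\<^sub>j\<close>, tested on the tops
  \<open>p\<close>, \<open>q\<close> of the down set. This suffices: if \<open>t \<le> p\<close>,
  \<open>u \<le> q\<close> and \<open>d \<le> t + u\<close>, then \<open>d \<le> p + q\<close>,
  whence \<open>t \<le> p \<le> d\<close>.\<close>

definition shift_ok_at :: "nat set \<Rightarrow> (nat \<Rightarrow> nat) set \<Rightarrow> nat \<Rightarrow> bool" where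
  "shift_ok_at N W j \<longleftrightarrow>
    (\<exists>w\<in>W. \<forall>p\<in>W. \<forall>q\<in>W. lef N (inc w j) (\<lambda>x. p x + q x) \<longrightarrow> lef N p (inc w j))"

text \<open>A variable with exponent zero throughout \<open>W\<close> is zero in the quotient and
  demands no shift.\<close>

definition shift_cond :: "nat set \<Rightarrow> (nat \<Rightarrow> nat) set \<Rightarrow> bool" where
  "shift_cond N W \<longleftrightarrow> (\<forall>j\<in>N. (\<exists>w\<in>W. 0 < w j) \<longrightarrow> shift_ok_at N W j)"

lemma monomial_quotientI:
  assumes "cring R" "finite W" "\<psi> \<in> ring_hom (mpoly_ring n :: 'k::field mpoly ring) R"
    and "\<psi> ` carrier (mpoly_ring n) = carrier R"
    and ker: "\<And>p. p \<in> carrier (mpoly_ring n) \<Longrightarrow> \<psi> p = \<zero>\<^bsub>R\<^esub> \<longleftrightarrow> p \<in> vanishing n (down_set n W)"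
    and "\<one>\<^bsub>R\<^esub> \<noteq> \<zero>\<^bsub>R\<^esub>"
  shows "monomial_quotient R n (down_set n W) \<psi>"
proof -
  interpret cring R by fact
  have one: "(1::'k mpoly) \<in> carrier (mpoly_ring n)" by (simp add: carrier_mpoly_iff)
  show ?thesis
  proof unfold_locales
    have "1 \<notin> (vanishing n (down_set n W) :: 'k mpoly set)"
      using ker[OF one] ring_hom_one[OF assms(3)] assms(6) by simp
    then show "0 \<in> down_set n W" using one by (simp add: vanishing_def)
    show "keys t \<subseteq> {1..n}" if "t \<in> down_set n W" for t using that unfolding down_set_def by blast
    show "\<psi> p = \<zero>\<^bsub>R\<^esub> \<longleftrightarrow> keys p \<inter> down_set n W = {}" if "p \<in> carrier (mpoly_ring n)" for p
      using ker[OF that] that unfolding vanishing_def by simp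
    show "s \<in> down_set n W" if "t \<in> down_set n W" "dvs s t" for s t
      using that by (rule down_set_down)
    show "finite (down_set n W)" by (rule finite_down_set) fact
  qed (fact assms)+
qed

context monomial_quotient begin

lemma shift_ok_exists:
  assumes B: "B = down_set n W" and H: "shift_cond {1..n} W" and j: "j \<in> {1..n}" "single j 1 \<in> B"
  shows "\<exists>w\<in>B. shift_ok (w + single j 1)"
proof -
  obtain w0 where w0: "w0 \<in> W" "\<forall>i\<in>{1..n}. lookup (single j 1) i \<le> w0 i"
    using j(2) unfolding B down_set_def by blast
  have "0 < w0 j" using bspec[OF w0(2) j(1)] by simp
  then have "\<exists>w\<in>W. 0 < w j" using w0(1) by blast
  then obtain w where w: "w \<in> W" and sc: "\<And>p q. p \<in> W \<Longrightarrow> q \<in> W \<Longrightarrow>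
      lef {1..n} (inc w j) (\<lambda>x. p x + q x) \<Longrightarrow> lef {1..n} p (inc w j)"
    using H j(1) unfolding shift_cond_def shift_ok_at_def by blast
  let ?d = "expv n w + single j 1"
  have ld: "lookup ?d x = inc w j x" if "x \<in> {1..n}" for x
    using that by (simp add: lookup_add lookup_expv inc_def lookup_single when_def)
  have kd: "keys ?d \<subseteq> {1..n}"
    using Poly_Mapping.keys_add[of "expv n w" "single j 1"] keys_expv[of n w] j(1) by auto
  have "dvs t ?d" if t: "t \<in> B" and u: "u \<in> B" and d: "dvs ?d (t + u)" for t u
  proof -
    obtain p where p: "p \<in> W" "\<forall>x\<in>{1..n}. lookup t x \<le> p x" using t unfolding B down_set_def by blast
    obtain q where q: "q \<in> W" "\<forall>x\<in>{1..n}. lookup u x \<le> q x" using u unfolding B down_set_def by blast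
    have "lef {1..n} (inc w j) (\<lambda>x. p x + q x)"
      unfolding lef_def
    proof
      fix x assume x: "x \<in> {1..n}"
      have "lookup ?d x \<le> lookup t x + lookup u x" using d unfolding dvs_def lookup_add by blast
      then show "inc w j x \<le> p x + q x" using ld[OF x] bspec[OF p(2) x] bspec[OF q(2) x] by linarith
    qed
    then have le: "lef {1..n} p (inc w j)" using sc p q by blast
    have "lookup t x \<le> lookup ?d x" for x
    proof (cases "x \<in> {1..n}")
      case True
      then show ?thesis using ld[OF True] bspec[OF p(2) True] le unfolding lef_def by fastforce
    next
      case False
      then show ?thesis using lookup_outside[OF keys_B[OF t]] by simp
    qed
    then show ?thesis unfolding dvs_def by blast
  qed
  then have "shift_ok ?d" using kd unfolding shift_ok_def by blast
  moreover have "expv n w \<in> B" unfolding B by (rule expv_in_down_set[OF w])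
  ultimately show ?thesis by blast
qed

section \<open>Type three and the colon condition as statements about exponent vectors\<close>

lemma socle_exps_subset:
  assumes B: "B = down_set n W"
  shows "socle_exps \<subseteq> expv n ` W"
proof
  fix t assume t: "t \<in> socle_exps"
  then have tB: "t \<in> B" and mx: "\<And>j. j \<in> {1..n} \<Longrightarrow> t + single j 1 \<notin> B"
    unfolding socle_exps_def by blast+
  obtain w where w: "w \<in> W" "\<forall>x\<in>{1..n}. lookup t x \<le> w x" using tB unfolding B down_set_def by blast
  have "lookup t x = w x" if x: "x \<in> {1..n}" for x
  proof (rule ccontr)
    assume "lookup t x \<noteq> w x"
    then have lt: "lookup t x < w x" using bspec[OF w(2) x] by simp
    have "keys (t + single x 1) \<subseteq> {1..n}"
      using Poly_Mapping.keys_add[of t "single x 1"] keys_B[OF tB] x by auto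
    moreover have "lookup (t + single x 1) y \<le> w y" if "y \<in> {1..n}" for y
      using bspec[OF w(2) that] lt by (auto simp: lookup_add lookup_single when_def)
    ultimately have "t + single x 1 \<in> B" using w(1) unfolding B down_set_def by blast
    then show False using mx[OF x] by blast
  qed
  then have "t = expv n w"
    by (intro poly_mapping_eqI) (metis lookup_expv lookup_outside[OF keys_B[OF tB]])
  then show "t \<in> expv n ` W" using w(1) by blast
qed

text \<open>If \<open>w p\<close> lay below \<open>w q\<close>, dropping \<open>p\<close> would
  leave the down set unchanged, so at most \<open>card T - 1\<close> monomials would span the
  socle.\<close>

lemma antichain_of_type:
  assumes M: "maximalideal m0 R" and B: "B = down_set n (w ` T)" and T: "finite T"
    and type: "ring_type R m0 = card T" and pq: "p \<in> T" "q \<in> T" "p \<noteq> q"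
  shows "\<not> lef {1..n} (w p) (w q)"
proof
  assume le: "lef {1..n} (w p) (w q)"
  have "down_set n (w ` T) = down_set n (w ` (T - {p}))"
  proof
    show "down_set n (w ` T) \<subseteq> down_set n (w ` (T - {p}))"
    proof
      fix t assume "t \<in> down_set n (w ` T)"
      then obtain i where i: "i \<in> T" "\<forall>x\<in>{1..n}. lookup t x \<le> w i x" and k: "keys t \<subseteq> {1..n}"
        unfolding down_set_def by blast
      show "t \<in> down_set n (w ` (T - {p}))"
      proof (cases "i = p")
        case True
        then have "\<forall>x\<in>{1..n}. lookup t x \<le> w q x" using i(2) le unfolding lef_def by (meson le_trans)
        then show ?thesis using k pq unfolding down_set_def by blast
      next
        case False
        then show ?thesis using i k unfolding down_set_def by blast
      qed
    qed
  qed (auto simp: down_set_def)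
  then have "socle_exps \<subseteq> expv n ` w ` (T - {p})" using socle_exps_subset B by simp
  then have "card socle_exps \<le> card (expv n ` w ` (T - {p}))" using T by (intro card_mono) auto
  also have "\<dots> \<le> card (T - {p})" using T by (metis card_image_le finite_Diff finite_imageI le_trans)
  also have "\<dots> < card T" using T pq by (intro card_Diff1_less)
  finally show False using ring_type_le[OF M] type by simp
qed

lemma ideal_psi_image:
  assumes "ideal V (mpoly_ring n)"
  shows "ideal (\<psi> ` V) R"
proof (rule idealI[OF ring_axioms])
  interpret P: cring "mpoly_ring n :: 'k mpoly ring" by (rule cring_mpoly_ring)
  interpret H: ring_hom_ring "mpoly_ring n :: 'k mpoly ring" R \<psi>
    by (rule ring_hom_ringI2[OF P.ring_axioms ring_axioms hom])
  interpret V: ideal V "mpoly_ring n" by fact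
  show "subgroup (\<psi> ` V) (add_monoid R)" by (rule H.img_is_add_subgroup[OF V.a_subgroup])
  fix a x assume a: "a \<in> \<psi> ` V" and x: "x \<in> carrier R"
  obtain v where v: "v \<in> V" "a = \<psi> v" using a by blast
  obtain p where p: "p \<in> S" "x = \<psi> p" using x by (rule obtain_rep)
  have "x \<otimes> a = \<psi> (p * v)" using psi_mult p v V.Icarr by simp
  moreover have "p * v \<in> V" using V.I_l_closed[OF v(1) p(1)] by simp
  ultimately show "x \<otimes> a \<in> \<psi> ` V" by blast
  then show "a \<otimes> x \<in> \<psi> ` V" using v p V.Icarr by (simp add: m_comm)
qed

text \<open>With \<open>u\<close> the vector \<open>w p\<close>, the test ideal \<open>J\<close> is
  spanned by the monomials not dividing \<open>x^u\<close>. The monomial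
  \<open>x^u / x\<^sub>j\<close> is carried to \<open>x^u\<close> by \<open>x\<^sub>j\<close>, so it
  is outside \<open>colon R J m0\<close>; hence some \<open>s\<close> that kills \<open>J\<close>
  does not kill it. A term \<open>x^v\<close> of \<open>s\<close> that survives the product supplies
  \<open>i\<close>: \<open>x^(u + v)\<close> divides \<open>x\<^sub>j x^(w i)\<close>.\<close>

lemma colon_cond_of_double_colon:
  assumes B: "B = down_set n (w ` T)" and Q: double_colon_cond
  shows "colon_cond {1..n} T w"
  unfolding colon_cond_def
proof (intro ballI impI)
  fix p j assume p: "p \<in> T" and j: "j \<in> {1..n}" and pos: "0 < w p j"
  let ?X = "\<lambda>t. \<psi> (single t 1)"
  define u where "u = expv n (w p)"
  have uB: "u \<in> B" unfolding u_def B using p by (intro expv_in_down_set) blast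
  have lu: "lookup u x = w p x" if "x \<in> {1..n}" for x using that by (simp add: u_def lookup_expv)
  define V :: "'k mpoly set" where "V = vanishing n {t. dvs t u}"
  define J where "J = \<psi> ` V"
  have "ideal V (mpoly_ring n)" unfolding V_def by (rule ideal_vanishing) (use dvs_trans in blast)
  then have J: "ideal J R" unfolding J_def by (rule ideal_psi_image)
  let ?t = "u - single j 1"
  have jt: "single j 1 + ?t = u" using dvs_add_diff[of "single j 1" u] lu[OF j] pos by (simp add: dvs_single)
  have tB: "?t \<in> B" using down_B[OF uB] jt dvs_add(2) by metis
  have tS: "single ?t 1 \<in> S" by (rule single_B[OF tB])
  have jS: "single (single j 1) 1 \<in> S" by (rule Var_S[OF j])
  have Xm: "?X (single j 1) \<in> m0" by (rule psi_Var_m0[OF j])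
  have "?X ?t \<otimes> ?X (single j 1) \<notin> J"
  proof
    assume "?X ?t \<otimes> ?X (single j 1) \<in> J"
    moreover have "?X ?t \<otimes> ?X (single j 1) = ?X u"
      using psi_mult[OF tS jS] jt by (simp add: mult_single add.commute)
    ultimately obtain q where "q \<in> V" "?X u = \<psi> q" unfolding J_def by auto
    moreover from this have "q \<in> S" "lookup q u = 0"
      using dvs_refl[of u] by (auto simp: V_def vanishing_def in_keys_iff disjoint_iff)
    ultimately have "lookup (single u 1) u = (0::'k)" using psi_eq_iff[OF single_B[OF uB]] uB by metis
    then show False by simp
  qed
  then have "?X ?t \<notin> colon R J m0" using Xm unfolding colon_def by blast
  then have "?X ?t \<notin> colon R {\<zero>} (colon R {\<zero>} J)" using Q J unfolding double_colon_cond_def by blast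
  then obtain s where s: "s \<in> colon R {\<zero>} J" "?X ?t \<otimes> s \<noteq> \<zero>" using tS unfolding colon_def by auto
  have sc: "s \<in> carrier R" and sJ: "\<And>r. r \<in> J \<Longrightarrow> s \<otimes> r = \<zero>" using s(1) unfolding colon_def by auto
  obtain f where f: "f \<in> S" "s = \<psi> f" using sc by (rule obtain_rep)
  have "\<psi> (single ?t 1 * f) \<noteq> \<zero>" using s(2) psi_mult[OF tS f(1)] f(2) by simp
  \<comment> \<open>\<open>t\<close> is a surviving exponent of the product, and
    \<open>t - ?t\<close> is the exponent \<open>v\<close> of the corresponding term of
    \<open>f\<close>.\<close>
  then obtain t where t: "t \<in> keys (single ?t 1 * f)" "t \<in> B"
    using ker[OF mpoly_closed(2)[OF tS f(1)]] by blast
  have tdvs: "dvs ?t t" and ft: "lookup f (t - ?t) \<noteq> 0"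
    using t(1) by (auto simp: in_keys_iff lookup_single_mult split: if_splits)
  let ?v = "t - ?t"
  \<comment> \<open>\<open>s\<close> kills the power \<open>x\<^sub>l^(w p l + 1)\<close>, which
    lies in \<open>J\<close>; so its product with the term \<open>x^v\<close> of \<open>f\<close>
    must leave \<open>B\<close>.\<close>
  have out: "?v + single l (Suc (w p l)) \<notin> B" if l: "l \<in> {1..n}" for l
  proof
    assume vB: "?v + single l (Suc (w p l)) \<in> B"
    let ?m = "single l (Suc (w p l))"
    have mS: "single ?m 1 \<in> S" using l by (intro single_in_mpoly) (auto split: if_splits)
    have "\<not> dvs ?m u" using lu[OF l] by (simp add: dvs_single)
    then have "single ?m 1 \<in> V" using mS by (simp add: V_def vanishing_def)
    then have "?X ?m \<in> J" unfolding J_def by blast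
    then have "s \<otimes> ?X ?m = \<zero>" by (rule sJ)
    then have "\<psi> (single ?m 1 * f) = \<zero>" using psi_mult[OF mS f(1)] f mS by (simp add: m_comm)
    then have "lookup (single ?m 1 * f) (?m + ?v) = 0"
      using ker[OF mpoly_closed(2)[OF mS f(1)]] vB by (auto simp: add.commute in_keys_iff disjoint_iff)
    then show False using ft dvs_add(1)[of ?m ?v] by (simp add: lookup_single_mult)
  qed
  obtain i where i: "i \<in> T" "\<forall>x\<in>{1..n}. lookup t x \<le> w i x" using t(2) unfolding B down_set_def by blast
  have le: "w p x \<le> inc (w i) j x \<and> lookup ?v x + w p x \<le> inc (w i) j x" if x: "x \<in> {1..n}" for x
  proof -
    have "lookup ?t x \<le> lookup t x" using tdvs unfolding dvs_def by blast
    moreover have "lookup ?t x = w p x - (if x = j then 1 else 0)"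
      using lu[OF x] by (simp add: lookup_minus lookup_single when_def)
    ultimately show ?thesis
      using bspec[OF i(2) x] pos by (auto simp: inc_def lookup_minus split: if_splits)
  qed
  show "\<exists>i\<in>T. lef {1..n} (w p) (inc (w i) j) \<and>
      (\<forall>q\<in>T. lef {1..n} (inc (w i) j) (\<lambda>x. w q x + w p x) \<longrightarrow> lef {1..n} (w q) (inc (w i) j))"
  proof (intro bexI[OF _ i(1)] conjI ballI impI)
    show "lef {1..n} (w p) (inc (w i) j)" using le unfolding lef_def by blast
    fix q assume q: "q \<in> T" and dq: "lef {1..n} (inc (w i) j) (\<lambda>x. w q x + w p x)"
    show "lef {1..n} (w q) (inc (w i) j)"
    proof (rule ccontr)
      assume "\<not> ?thesis"
      then obtain l where l: "l \<in> {1..n}" "inc (w i) j l < w q l" unfolding lef_def by (auto simp: not_le)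
      \<comment> \<open>Off \<open>l\<close>, the exponent \<open>v\<close> is at most
        \<open>inc (w i) j - w p\<close>, hence at most \<open>w q\<close>. At \<open>l\<close>, the
        extra 1 is absorbed by the strict inequality in the choice of \<open>l\<close>.\<close>
      have "lookup (?v + single l (Suc (w p l))) x \<le> w q x" if x: "x \<in> {1..n}" for x
      proof -
        have "inc (w i) j x \<le> w q x + w p x" using dq x unfolding lef_def by blast
        then show ?thesis
          using le[OF x] l(2) by (cases "x = l") (auto simp: lookup_add lookup_single_not_eq)
      qed
      moreover have "keys ?v \<subseteq> {1..n}"
        using keys_B[OF t(2)] by (auto simp: in_keys_iff lookup_minus)
      then have "keys (?v + single l (Suc (w p l))) \<subseteq> {1..n}"
        using Poly_Mapping.keys_add[of ?v "single l (Suc (w p l))"] l(1) by auto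
      ultimately have "?v + single l (Suc (w p l)) \<in> B" using q unfolding B down_set_def by blast
      then show False using out[OF l(1)] by blast
    qed
  qed
qed

lemma iso_quotient:
  fixes I :: "'k mpoly set"
  assumes "I = vanishing n B"
  shows "R \<simeq> (mpoly_ring n Quot I)"
proof -
  interpret P: cring "mpoly_ring n :: 'k mpoly ring" by (rule cring_mpoly_ring)
  interpret H: ring_hom_ring "mpoly_ring n :: 'k mpoly ring" R \<psi>
    by (rule ring_hom_ringI2[OF P.ring_axioms ring_axioms hom])
  have ker_eq: "a_kernel (mpoly_ring n) R \<psi> = I"
    unfolding assms a_kernel_def' vanishing_def by (rule Collect_cong) (use ker in metis)
  have "(mpoly_ring n Quot I) \<simeq> R" using H.FactRing_iso[OF surj] ker_eq by simp
  moreover have "ring (mpoly_ring n Quot I)"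
    using ideal.quotient_is_ring[OF H.kernel_is_ideal] ker_eq by simp
  ultimately show ?thesis by (rule ring_iso_sym[rotated])
qed

end

section \<open>The five families\<close>

text \<open>If \<open>w\<close> alone involves the \<open>j\<close>-th variable, then
  \<open>w j + 1 \<le> p j + q j\<close> forces both \<open>p\<close> and \<open>q\<close> to be
  \<open>w\<close>.\<close>

lemma private_witness:
  assumes "j \<in> N" and "w \<in> W" and excl: "\<And>p. p \<in> W \<Longrightarrow> p = w \<or> p j = 0"
  shows "shift_ok_at N W j"
  unfolding shift_ok_at_def
proof (intro bexI[OF _ assms(2)] ballI impI)
  fix p q assume pq: "p \<in> W" "q \<in> W" "lef N (inc w j) (\<lambda>x. p x + q x)"
  then have "Suc (w j) \<le> p j + q j" using assms(1) by (auto simp: lef_def inc_def)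
  then have "p = w" using excl[OF pq(1)] excl[OF pq(2)] by auto
  then show "lef N p (inc w j)" by (auto simp: lef_def inc_def)
qed

lemma listed_ideal_shift_cond:
  assumes "listed_ideal m (I :: 'k::field mpoly set)"
  shows "\<exists>W. finite W \<and> shift_cond {1..m} W \<and> I = vanishing m (down_set m W)"
  using assms
proof cases
  case (item1 a)
  let ?W = "{(\<lambda>i. a i - 1)(j := a j - 2) | j. j \<in> {1..m} \<and> 2 \<le> a j}"
  have "?W \<subseteq> (\<lambda>j. (\<lambda>i. a i - 1)(j := a j - 2)) ` {1..m}" by blast
  then have "finite ?W" by (rule finite_subset) simp
  moreover have "shift_cond {1..m} ?W"
    unfolding shift_cond_def
  proof (intro ballI impI)
    fix j assume j: "j \<in> {1..m}" and "\<exists>w\<in>?W. 0 < w j"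
    then have "2 \<le> a j" by (auto split: if_splits)
    then have w: "(\<lambda>i. a i - 1)(j := a j - 2) \<in> ?W" (is "?w \<in> _") using j by auto
    \<comment> \<open>The target \<open>d\<close> is the very monomial that this family removes, and
      all of \<open>?W\<close> lies below it.\<close>
    have "inc ?w j = (\<lambda>i. a i - 1)" using \<open>2 \<le> a j\<close> by (intro ext) (auto simp: inc_def)
    moreover have "p x \<le> a x - 1" if "p \<in> ?W" for p x using that by auto
    ultimately have "lef {1..m} p (inc ?w j)" if "p \<in> ?W" for p
      using that unfolding lef_def by simp
    then show "shift_ok_at {1..m} ?W j"
      unfolding shift_ok_at_def by (intro bexI[OF _ w]) blast
  qed
  ultimately show ?thesis using Idl_item1[of m a] item1 by (intro exI[of _ ?W]) simp
next
  case (item2 a b c)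
  let ?u = "\<lambda>i. (c(1 := a, 2 := b)) i - 1" and ?v = "\<lambda>i. ((\<lambda>_. 1::nat)(1 := a + 1)) i - 1"
    and ?w = "\<lambda>i. ((\<lambda>_. 1::nat)(2 := b + 1)) i - 1"
  let ?W = "{?u, ?v, ?w}"
  have "shift_cond {1..m} ?W"
    unfolding shift_cond_def
  proof (intro ballI impI)
    fix j assume j: "j \<in> {1..m}"
    \<comment> \<open>Coordinate 3 is positive only in \<open>?u\<close>, so
      \<open>inc ?u j \<le> p + q\<close> makes \<open>p\<close> or \<open>q\<close> equal to
      \<open>?u\<close>. The one vector not below \<open>inc ?u j\<close> then leaves the sum one
      short in coordinate \<open>j\<close>.\<close>
    have c3: "2 \<le> c 3" using item2 by (simp add: Suc_le_eq numeral_2_eq_2)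
    have N: "1 \<in> {1..m}" "2 \<in> {1..m}" "3 \<in> {1..m}" using item2 by auto
    consider "j = 1 \<or> j = 2" | "j \<ge> 3" using j by force
    then show "shift_ok_at {1..m} ?W j"
    proof cases
      case 1
      show ?thesis
        unfolding shift_ok_at_def
      proof (intro bexI[of _ ?u] ballI impI)
        fix p q assume pq: "p \<in> ?W" "q \<in> ?W" "lef {1..m} (inc ?u j) (\<lambda>x. p x + q x)"
        have le: "inc ?u j 1 \<le> p 1 + q 1" "inc ?u j 2 \<le> p 2 + q 2" "inc ?u j 3 \<le> p 3 + q 3"
          using pq(3) N unfolding lef_def by blast+
        show "lef {1..m} p (inc ?u j)"
          using pq(1,2) le 1 item2 c3 by (auto simp: lef_def inc_def split: if_splits)
      qed simp
    next
      case 2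
      show ?thesis by (rule private_witness[of _ _ ?u]) (use j 2 in auto)
    qed
  qed
  moreover have "I = vanishing m (down_set m ?W)"
    unfolding item2(1)
  proof (rule pow_ideal_Int3)
    show "1 \<le> (c(1 := a, 2 := b)) i" if "i \<in> {1..m}" for i
    proof (cases "i = 1 \<or> i = 2")
      case False
      then have "i \<in> {3..m}" using that by auto
      then show ?thesis using item2 False by (simp add: less_imp_le)
    qed (use item2 in auto)
  qed auto
  ultimately show ?thesis by (intro exI[of _ ?W]) simp
next
  case (item3 a b c)
  let ?u = "\<lambda>i. ((\<lambda>_. 1::nat)(1 := a, 2 := b + 1)) i - 1"
    and ?v = "\<lambda>i. ((\<lambda>_. 1::nat)(1 := a + 1, 2 := b)) i - 1"
    and ?w = "\<lambda>i. (c(1 := 1, 2 := 1)) i - 1"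
  let ?W = "{?u, ?v, ?w}"
  have "shift_cond {1..m} ?W"
    unfolding shift_cond_def
  proof (intro ballI impI)
    fix j assume j: "j \<in> {1..m}"
    have N: "1 \<in> {1..m}" "2 \<in> {1..m}" using item3 by auto
    \<comment> \<open>For both shared variables \<open>d\<close> has exponents \<open>a\<close>,
      \<open>b\<close> and then zeros. It lies above \<open>?u\<close> and \<open>?v\<close>, while
      no sum involving \<open>?w\<close> reaches it.\<close>
    consider "j = 1" | "j = 2" | "j \<ge> 3" using j by force
    then show "shift_ok_at {1..m} ?W j"
    proof cases
      case 1
      show ?thesis
        unfolding shift_ok_at_def
      proof (intro bexI[of _ ?u] ballI impI)
        fix p q assume pq: "p \<in> ?W" "q \<in> ?W" "lef {1..m} (inc ?u j) (\<lambda>x. p x + q x)"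
        have le: "inc ?u j 1 \<le> p 1 + q 1" "inc ?u j 2 \<le> p 2 + q 2"
          using pq(3) N unfolding lef_def by blast+
        show "lef {1..m} p (inc ?u j)"
          using pq(1,2) le 1 item3 by (auto simp: lef_def inc_def split: if_splits)
      qed simp
    next
      case 2
      show ?thesis
        unfolding shift_ok_at_def
      proof (intro bexI[of _ ?v] ballI impI)
        fix p q assume pq: "p \<in> ?W" "q \<in> ?W" "lef {1..m} (inc ?v j) (\<lambda>x. p x + q x)"
        have le: "inc ?v j 1 \<le> p 1 + q 1" "inc ?v j 2 \<le> p 2 + q 2"
          using pq(3) N unfolding lef_def by blast+
        show "lef {1..m} p (inc ?v j)"
          using pq(1,2) le 2 item3 by (auto simp: lef_def inc_def split: if_splits)
      qed simp
    next
      case 3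
      show ?thesis by (rule private_witness[of _ _ ?w]) (use j 3 in auto)
    qed
  qed
  moreover have "I = vanishing m (down_set m ?W)"
    unfolding item3(1)
  proof (rule pow_ideal_Int3)
    show "1 \<le> (c(1 := 1, 2 := 1)) i" if "i \<in> {1..m}" for i
    proof (cases "i = 1 \<or> i = 2")
      case False
      then have "i \<in> {3..m}" using that by auto
      then show ?thesis using item3 False by simp
    qed auto
  qed (use item3 in auto)
  ultimately show ?thesis by (intro exI[of _ ?W]) simp
next
  case (item4 s a b c)
  let ?u = "\<lambda>i. (if i = 1 then a else if i \<le> s then 1 else b i) - 1"
    and ?v = "\<lambda>i. ((\<lambda>_. 1::nat)(1 := a + 1)) i - 1"
    and ?w = "\<lambda>i. (if 2 \<le> i \<and> i \<le> s then c i else 1) - 1"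
  let ?W = "{?u, ?v, ?w}"
  have "shift_cond {1..m} ?W"
    unfolding shift_cond_def
  proof (intro ballI impI)
    fix j assume j: "j \<in> {1..m}"
    have N: "1 \<in> {1..m}" using item4 by auto
    \<comment> \<open>If every \<open>b l\<close> is 1, then \<open>?u\<close> lies below
      \<open>?v\<close> and the shift starts from \<open>?v\<close>. Otherwise a coordinate
      \<open>l\<close> with \<open>1 < b l\<close> distinguishes \<open>?u\<close> from the other
      two vectors.\<close>
    consider "j = 1" "\<exists>l\<in>{s+1..m}. 1 < b l" | "j = 1" "\<forall>l\<in>{s+1..m}. b l = 1"
      | "2 \<le> j \<and> j \<le> s" | "s < j"
    proof -
      have "(\<exists>l\<in>{s+1..m}. 1 < b l) \<or> (\<forall>l\<in>{s+1..m}. b l = 1)"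
        using item4(5) by (metis le_neq_implies_less)
      moreover have "j = 1 \<or> (2 \<le> j \<and> j \<le> s) \<or> s < j" using j by auto
      ultimately show thesis using that by blast
    qed
    then show "shift_ok_at {1..m} ?W j"
    proof cases
      case 1
      then obtain l where l: "l \<in> {s+1..m}" "1 < b l" by blast
      show ?thesis
        unfolding shift_ok_at_def
      proof (intro bexI[of _ ?u] ballI impI)
        fix p q assume pq: "p \<in> ?W" "q \<in> ?W" "lef {1..m} (inc ?u j) (\<lambda>x. p x + q x)"
        have le: "inc ?u j 1 \<le> p 1 + q 1" "inc ?u j l \<le> p l + q l"
          using pq(3) N l(1) unfolding lef_def by auto
        show "lef {1..m} p (inc ?u j)"
          using pq(1,2) le 1 l item4 by (auto simp: lef_def inc_def split: if_splits)
      qed simp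
    next
      case 2
      show ?thesis
        unfolding shift_ok_at_def
      proof (intro bexI[of _ ?v] ballI impI)
        fix p q assume pq: "p \<in> ?W" "q \<in> ?W" "lef {1..m} (inc ?v j) (\<lambda>x. p x + q x)"
        have le: "inc ?v j 1 \<le> p 1 + q 1"
          using pq(3) N unfolding lef_def by blast
        show "lef {1..m} p (inc ?v j)"
          using pq(1,2) le 2 item4 by (auto simp: lef_def inc_def split: if_splits)
      qed simp
    next
      case 3
      show ?thesis by (rule private_witness[of _ _ ?w]) (use j 3 in auto)
    next
      case 4
      show ?thesis by (rule private_witness[of _ _ ?u]) (use j 4 item4 in auto)
    qed
  qed
  moreover have "I = vanishing m (down_set m ?W)"
    unfolding item4(1) by (rule pow_ideal_Int3) (use item4 in auto)
  ultimately show ?thesis by (intro exI[of _ ?W]) simp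
next
  case (item5 s t a b c)
  let ?u = "\<lambda>i. (if i \<le> t then 1 else c i) - 1"
    and ?v = "\<lambda>i. (if s < i \<and> i \<le> t then b i else 1) - 1"
    and ?w = "\<lambda>i. (if i \<le> s then a i else 1) - 1"
  let ?W = "{?u, ?v, ?w}"
  have "shift_cond {1..m} ?W"
    unfolding shift_cond_def
  proof (intro ballI impI)
    fix j assume j: "j \<in> {1..m}"
    consider "j \<le> s" | "s < j \<and> j \<le> t" | "t < j" by linarith
    then show "shift_ok_at {1..m} ?W j"
    proof cases
      case 1
      show ?thesis by (rule private_witness[of _ _ ?w]) (use j 1 item5 in auto)
    next
      case 2
      show ?thesis by (rule private_witness[of _ _ ?v]) (use j 2 in auto)
    next
      case 3
      show ?thesis by (rule private_witness[of _ _ ?u]) (use j 3 item5 in auto)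
    qed
  qed
  moreover have "I = vanishing m (down_set m ?W)"
    unfolding item5(1) by (rule pow_ideal_Int3) (use item5 in auto)
  ultimately show ?thesis by (intro exI[of _ ?W]) simp
qed

section \<open>Ordering the variables so that three vectors become a listed ideal\<close>

lemma bij_betw_extend:
  fixes \<sigma> :: "nat \<Rightarrow> 'a"
  assumes \<sigma>: "bij_betw \<sigma> {1..s} A" and B: "finite B" "A \<inter> B = {}"
  obtains \<sigma>' where "bij_betw \<sigma>' {1..s + card B} (A \<union> B)" "\<And>i. i \<in> {1..s} \<Longrightarrow> \<sigma>' i = \<sigma> i"
    "\<sigma>' ` {s + 1..s + card B} = B"
proof -
  obtain h where h: "bij_betw h {1..card B} B" using ex_bij_betw_nat_finite_1[OF B(1)] by blast
  define \<sigma>' where "\<sigma>' i = (if i \<le> s then \<sigma> i else h (i - s))" for i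
  have "bij_betw \<sigma>' {1..s} A"
    using \<sigma> by (rule bij_betw_cong[THEN iffD1, rotated]) (simp add: \<sigma>'_def)
  moreover have b2: "bij_betw \<sigma>' {s + 1..s + card B} B"
  proof -
    have "bij_betw (\<lambda>i. i - s) {s + 1..s + card B} {1..card B}"
      by (rule bij_betw_byWitness[of _ "\<lambda>i. i + s"]) auto
    then have "bij_betw (h \<circ> (\<lambda>i. i - s)) {s + 1..s + card B} B" using h by (rule bij_betw_trans)
    then show ?thesis by (rule bij_betw_cong[THEN iffD1, rotated]) (simp add: \<sigma>'_def)
  qed
  ultimately have "bij_betw \<sigma>' ({1..s} \<union> {s + 1..s + card B}) (A \<union> B)" using B(2) by (rule bij_betw_combine)
  moreover have "{1..s} \<union> {s + 1..s + card B} = {1..s + card B}" by auto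
  ultimately show thesis using that[of \<sigma>'] b2 by (simp add: \<sigma>'_def bij_betw_def)
qed

text \<open>\<sigma> selects and renames the variables that are kept; the others have exponent zero
  in all vectors and vanish in the quotient. The \<open>itself\<close> argument carries the
  coefficient field, which the vectors do not mention.\<close>

definition realized :: "nat \<Rightarrow> 'k::field itself \<Rightarrow> 'i set \<Rightarrow> ('i \<Rightarrow> nat \<Rightarrow> nat) \<Rightarrow> bool" where
  "realized n k T w \<longleftrightarrow> (\<exists>m \<sigma>. inj_on \<sigma> {1..m} \<and> \<sigma> ` {1..m} \<subseteq> {1..n} \<and>
    (\<forall>x\<in>{1..n} - \<sigma> ` {1..m}. \<forall>p\<in>T. w p x = 0) \<and>
    listed_ideal m (vanishing m (down_set m ((\<lambda>p. w p \<circ> \<sigma>) ` T)) :: 'k mpoly set))"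

lemma realizedI:
  assumes "bij_betw \<sigma> {1..m} A" "A \<subseteq> {1..n}" "\<And>x p. x \<in> {1..n} \<Longrightarrow> x \<notin> A \<Longrightarrow> p \<in> T \<Longrightarrow> w p x = 0"
    and "listed_ideal m (I :: 'k::field mpoly set)" "I = vanishing m (down_set m W)"
    and "down_set m W = down_set m ((\<lambda>p. w p \<circ> \<sigma>) ` T)"
  shows "realized n TYPE('k) T w"
  unfolding realized_def using assms by (intro exI[of _ m] exI[of _ \<sigma>]) (auto simp: bij_betw_def)

lemma realized_pow_ideals:
  assumes "bij_betw \<sigma> {1..m} A" "A \<subseteq> {1..n}" and T: "T = {p, q, r}"
    and "\<And>x t. x \<in> {1..n} \<Longrightarrow> x \<notin> A \<Longrightarrow> t \<in> T \<Longrightarrow> w t x = 0"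
    and listed: "listed_ideal m (pow_ideal m e \<inter> pow_ideal m f \<inter> pow_ideal m g :: 'k::field mpoly set)"
    and efg: "\<And>x. x \<in> {1..m} \<Longrightarrow>
      e x = Suc (w p (\<sigma> x)) \<and> f x = Suc (w q (\<sigma> x)) \<and> g x = Suc (w r (\<sigma> x))"
  shows "realized n TYPE('k) T w"
proof (rule realizedI[OF assms(1,2) _ listed])
  show "pow_ideal m e \<inter> pow_ideal m f \<inter> pow_ideal m g =
      (vanishing m (down_set m {\<lambda>x. e x - 1, \<lambda>x. f x - 1, \<lambda>x. g x - 1}) :: 'k mpoly set)"
    by (rule pow_ideal_Int3) (use efg in simp_all)
  show "down_set m {\<lambda>x. e x - 1, \<lambda>x. f x - 1, \<lambda>x. g x - 1} = down_set m ((\<lambda>p. w p \<circ> \<sigma>) ` T)"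
    unfolding T by (rule down_set_cong) (use efg in auto)
qed (rule assms(4))

lemma realized_item1:
  assumes T: "T = {i, p, q}" and N: "j \<in> {1..n}" "k \<in> {1..n}" "l \<in> {1..n}"
    and ne: "k \<noteq> j" "l \<noteq> j" "l \<noteq> k"
    and ar: "arrow {1..n} j (w p) (w i)" "arrow {1..n} j (w q) (w i)"
      "arrow {1..n} k (w i) (w p)" "arrow {1..n} l (w i) (w q)"
    and z: "\<And>x. x \<in> {1..n} \<Longrightarrow> x \<notin> {j, k, l} \<Longrightarrow> w i x = 0 \<and> w p x = 0 \<and> w q x = 0"
  shows "realized n TYPE('k::field) T w"
proof -
  define \<sigma> where "\<sigma> = (\<lambda>x::nat. if x = 1 then j else if x = 2 then k else l)"
  \<comment> \<open>Chosen so that \<open>a - 1\<close> is the exponent vector of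
    \<open>x\<^sub>j x^(w i)\<close>, of which \<open>w i\<close>, \<open>w p\<close> and
    \<open>w q\<close> are the quotients by \<open>x\<^sub>j\<close>, \<open>x\<^sub>k\<close> and
    \<open>x\<^sub>l\<close>.\<close>
  define a where "a = (\<lambda>x::nat. if x = 1 then w i j + 2 else if x = 2 then w i k + 1 else w i l + 1)"
  have I3: "{1..3} = {1, 2, 3::nat}" by auto
  have pos: "0 < w i k" "0 < w i l" using ar unfolding arrow_def by auto
  have p: "w p j = Suc (w i j)" "w p k = w i k - 1" "w p l = w i l"
    using ar(1,3) N ne unfolding arrow_def by (auto intro: antisym)
  have q: "w q j = Suc (w i j)" "w q l = w i l - 1" "w q k = w i k"
    using ar(2,4) N ne unfolding arrow_def by (auto intro: antisym)
  let ?f = "\<lambda>x. (\<lambda>y. a y - 1)(x := a x - 2)"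
  have W: "{?f x | x. x \<in> {1..3} \<and> 2 \<le> a x} = {?f 1, ?f 2, ?f 3}"
  proof -
    have "2 \<le> a x" for x using pos by (simp add: a_def Suc_le_eq)
    then have "{?f x | x. x \<in> {1..3} \<and> 2 \<le> a x} = ?f ` {1..3}" by blast
    then show ?thesis unfolding I3 by (simp only: image_insert image_empty)
  qed
  show ?thesis
  proof (rule realizedI)
    show "bij_betw \<sigma> {1..3} {j, k, l}"
      unfolding I3 using ne by (auto simp: bij_betw_def inj_on_def \<sigma>_def)
    show "{j, k, l} \<subseteq> {1..n}" using N by simp
    show "w t x = 0" if "x \<in> {1..n}" "x \<notin> {j, k, l}" "t \<in> T" for x t
      using z[OF that(1,2)] that(3) T by blast
    show "listed_ideal 3 (Idl\<^bsub>mpoly_ring 3\<^esub> ({Var i ^ a i | i. i \<in> {1..3}} \<union> {\<Prod>i\<in>{1..3}. Var i ^ (a i - 1)}) :: 'k mpoly set)"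
      by (rule listed_ideal.item1) (simp add: a_def)
    show "Idl\<^bsub>mpoly_ring 3\<^esub> ({Var i ^ a i | i. i \<in> {1..3}} \<union> {\<Prod>i\<in>{1..3}. Var i ^ (a i - 1)}) =
        (vanishing 3 (down_set 3 {?f 1, ?f 2, ?f 3}) :: 'k mpoly set)"
      unfolding W[symmetric] by (rule Idl_item1) (simp add: a_def)
    show "down_set 3 {?f 1, ?f 2, ?f 3} = down_set 3 ((\<lambda>p. w p \<circ> \<sigma>) ` T)"
      unfolding T
    proof (rule down_set_cong)
      have *: "?f 1 x = w i (\<sigma> x) \<and> ?f 2 x = w p (\<sigma> x) \<and> ?f 3 x = w q (\<sigma> x)" if x: "x \<in> {1..3}" for x
      proof -
        consider "x = 1" | "x = 2" | "x = 3" using x unfolding I3 by blast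
        then show ?thesis by cases (use p q in \<open>simp_all add: a_def \<sigma>_def\<close>)
      qed
      show "\<exists>g\<in>(\<lambda>p. w p \<circ> \<sigma>) ` {i, p, q}. \<forall>x\<in>{1..3}. f x = g x" if "f \<in> {?f 1, ?f 2, ?f 3}" for f
        using that * by auto
      show "\<exists>f\<in>{?f 1, ?f 2, ?f 3}. \<forall>x\<in>{1..3}. f x = g x" if "g \<in> (\<lambda>p. w p \<circ> \<sigma>) ` {i, p, q}" for g
        using that * by auto
    qed
  qed
qed

lemma realized_item2:
  assumes T: "T = {p, i, s}" and N: "j \<in> {1..n}" "k \<in> {1..n}" "k \<noteq> j"
    and v: "w p j = Suc (w i j)" "w s k = Suc (w i k)"
    and z: "\<And>x. x \<in> {1..n} \<Longrightarrow> x \<noteq> j \<Longrightarrow> w p x = 0" "\<And>x. x \<in> {1..n} \<Longrightarrow> x \<noteq> k \<Longrightarrow> w s x = 0"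
    and ex: "\<exists>x\<in>{1..n}. x \<noteq> j \<and> x \<noteq> k \<and> 0 < w i x"
  shows "realized n TYPE('k::field) T w"
proof -
  \<comment> \<open>Item 2 demands exponents above 1 beyond its first two variables, so only
    variables occurring in \<open>w i\<close> are kept there.\<close>
  let ?C = "{x \<in> {1..n}. x \<noteq> j \<and> x \<noteq> k \<and> 0 < w i x}"
  let ?\<sigma>0 = "\<lambda>x::nat. if x = 1 then j else k"
  have I2: "{1..2} = {1, 2::nat}" by auto
  have "bij_betw ?\<sigma>0 {1..2} {j, k}" unfolding I2 using N by (auto simp: bij_betw_def inj_on_def)
  moreover have fC: "finite ?C" by simp
  ultimately obtain \<sigma> where \<sigma>: "bij_betw \<sigma> {1..2 + card ?C} ({j, k} \<union> ?C)"
    "\<And>x. x \<in> {1..2} \<Longrightarrow> \<sigma> x = ?\<sigma>0 x" "\<sigma> ` {2 + 1..2 + card ?C} = ?C"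
    by (rule bij_betw_extend) auto
  let ?m = "2 + card ?C"
  have "0 < card ?C" using ex fC by (metis (mono_tags, lifting) card_gt_0_iff empty_iff mem_Collect_eq)
  then have m: "3 \<le> ?m" by linarith
  have \<sigma>1: "\<sigma> 1 = j" "\<sigma> 2 = k" using \<sigma>(2)[of 1] \<sigma>(2)[of 2] by simp_all
  have \<sigma>3: "\<sigma> x \<in> ?C" if "x \<in> {1..?m}" "x \<noteq> 1" "x \<noteq> 2" for x
  proof -
    have "x \<in> {2 + 1..?m}" using that by auto
    then show ?thesis using \<sigma>(3) by blast
  qed
  define c where "c x = w i (\<sigma> x) + 1" for x
  let ?a = "w i j + 1" and ?b = "w i k + 1"
  show ?thesis
  proof (rule realized_pow_ideals[OF \<sigma>(1)])
    show "T = {i, p, s}" using T by blast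
    show "{j, k} \<union> ?C \<subseteq> {1..n}" using N by auto
    show "w t x = 0" if "x \<in> {1..n}" "x \<notin> {j, k} \<union> ?C" "t \<in> T" for x t
      using that z T by auto
    show "listed_ideal ?m (pow_ideal ?m (c(1 := ?a, 2 := ?b)) \<inter> pow_ideal ?m ((\<lambda>_. 1)(1 := ?a + 1)) \<inter>
        pow_ideal ?m ((\<lambda>_. 1)(2 := ?b + 1)) :: 'k mpoly set)"
    proof (rule listed_ideal.item2)
      show "\<forall>x\<in>{3..?m}. 1 < c x"
      proof
        fix x assume "x \<in> {3..?m}"
        then show "1 < c x" using \<sigma>3[of x] by (auto simp: c_def)
      qed
    qed (use m in auto)
    fix x assume x: "x \<in> {1..?m}"
    show "(c(1 := ?a, 2 := ?b)) x = Suc (w i (\<sigma> x)) \<and> ((\<lambda>_. 1)(1 := ?a + 1)) x = Suc (w p (\<sigma> x)) \<and>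
      ((\<lambda>_. 1)(2 := ?b + 1)) x = Suc (w s (\<sigma> x))"
    proof (cases "x = 1 \<or> x = 2")
      case True
      have "w p k = 0" "w s j = 0" using z(1)[of k] z(2)[of j] N by simp_all
      then show ?thesis using True \<sigma>1 v by auto
    next
      case False
      then have "\<sigma> x \<in> ?C" using \<sigma>3[OF x] by blast
      then have "w p (\<sigma> x) = 0" "w s (\<sigma> x) = 0" using z(1)[of "\<sigma> x"] z(2)[of "\<sigma> x"] by simp_all
      then show ?thesis using False by (simp add: c_def)
    qed
  qed
qed

lemma realized_item3:
  assumes T: "T = {p, i, s}" and N: "j \<in> {1..n}" "k \<in> {1..n}" "k \<noteq> j"
    and v: "w p j = Suc (w i j)" "w i k = Suc (w p k)" "w s j = 0" "w s k = 0"
    and z: "\<And>x. x \<in> {1..n} \<Longrightarrow> x \<notin> {j, k} \<Longrightarrow> w p x = 0 \<and> w i x = 0"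
    and ex: "\<exists>x\<in>{1..n}. 0 < w s x"
  shows "realized n TYPE('k::field) T w"
proof -
  let ?C = "{x \<in> {1..n}. 0 < w s x}"
  let ?\<sigma>0 = "\<lambda>x::nat. if x = 1 then j else k"
  have I2: "{1..2} = {1, 2::nat}" by auto
  have "bij_betw ?\<sigma>0 {1..2} {j, k}" unfolding I2 using N by (auto simp: bij_betw_def inj_on_def)
  moreover have fC: "finite ?C" by simp
  ultimately obtain \<sigma> where \<sigma>: "bij_betw \<sigma> {1..2 + card ?C} ({j, k} \<union> ?C)"
    "\<And>x. x \<in> {1..2} \<Longrightarrow> \<sigma> x = ?\<sigma>0 x" "\<sigma> ` {2 + 1..2 + card ?C} = ?C"
    by (rule bij_betw_extend) (use v in auto)
  let ?m = "2 + card ?C"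
  have "0 < card ?C" using ex fC by (metis (mono_tags, lifting) card_gt_0_iff empty_iff mem_Collect_eq)
  then have m: "3 \<le> ?m" by linarith
  have \<sigma>1: "\<sigma> 1 = j" "\<sigma> 2 = k" using \<sigma>(2)[of 1] \<sigma>(2)[of 2] by simp_all
  have \<sigma>3: "\<sigma> x \<in> {1..n} \<and> \<sigma> x \<notin> {j, k}" if "x \<in> {1..?m}" "x \<noteq> 1" "x \<noteq> 2" for x
  proof -
    have "x \<in> {2 + 1..?m}" using that by auto
    then have "\<sigma> x \<in> ?C" using \<sigma>(3) by blast
    then show ?thesis using v by auto
  qed
  define c where "c x = w s (\<sigma> x) + 1" for x
  let ?a = "w i j + 1" and ?b = "w p k + 1"
  show ?thesis
  proof (rule realized_pow_ideals[OF \<sigma>(1)])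
    show "T = {i, p, s}" using T by blast
    show "{j, k} \<union> ?C \<subseteq> {1..n}" using N by auto
    show "w t x = 0" if "x \<in> {1..n}" "x \<notin> {j, k} \<union> ?C" "t \<in> T" for x t
      using that z T by auto
    show "listed_ideal ?m (pow_ideal ?m ((\<lambda>_. 1)(1 := ?a, 2 := ?b + 1)) \<inter>
        pow_ideal ?m ((\<lambda>_. 1)(1 := ?a + 1, 2 := ?b)) \<inter> pow_ideal ?m (c(1 := 1, 2 := 1)) :: 'k mpoly set)"
      by (rule listed_ideal.item3) (use m in \<open>auto simp: c_def\<close>)
    fix x assume x: "x \<in> {1..?m}"
    show "((\<lambda>_. 1)(1 := ?a, 2 := ?b + 1)) x = Suc (w i (\<sigma> x)) \<and>
      ((\<lambda>_. 1)(1 := ?a + 1, 2 := ?b)) x = Suc (w p (\<sigma> x)) \<and> (c(1 := 1, 2 := 1)) x = Suc (w s (\<sigma> x))"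
    proof (cases "x = 1 \<or> x = 2")
      case True
      then show ?thesis using \<sigma>1 v by auto
    next
      case False
      then have "w p (\<sigma> x) = 0" "w i (\<sigma> x) = 0" using \<sigma>3[OF x] z[of "\<sigma> x"] by simp_all
      then show ?thesis using False by (simp add: c_def)
    qed
  qed
qed

lemma realized_item4:
  assumes T: "T = {p, i, s}" and N: "j \<in> {1..n}"
    and v: "w p j = Suc (w i j)" "w s j = 0"
    and z: "\<And>x. x \<in> {1..n} \<Longrightarrow> x \<noteq> j \<Longrightarrow> w p x = 0"
      "\<And>x. x \<in> {1..n} \<Longrightarrow> x \<noteq> j \<Longrightarrow> w i x = 0 \<or> w s x = 0"
    and ex: "\<exists>x\<in>{1..n}. 0 < w s x" "\<exists>x\<in>{1..n}. x \<noteq> j \<and> 0 < w i x"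
  shows "realized n TYPE('k::field) T w"
proof -
  \<comment> \<open>These become the blocks \<open>2..s\<close> and \<open>s+1..m\<close> of item 4.
    They are disjoint because off \<open>j\<close> no variable occurs in both \<open>w i\<close> and
    \<open>w s\<close>.\<close>
  let ?C = "{x \<in> {1..n}. 0 < w s x}" and ?D = "{x \<in> {1..n}. x \<noteq> j \<and> 0 < w i x}"
  have fin: "finite ?C" "finite ?D" by simp_all
  have "bij_betw (\<lambda>_. j) {1..1::nat} {j}" by (auto simp: bij_betw_def)
  then obtain \<sigma>1 where \<sigma>1: "bij_betw \<sigma>1 {1..1 + card ?C} ({j} \<union> ?C)"
    "\<And>x. x \<in> {1..1::nat} \<Longrightarrow> \<sigma>1 x = j" "\<sigma>1 ` {1 + 1..1 + card ?C} = ?C"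
    by (rule bij_betw_extend[OF _ fin(1)]) (use v in auto)
  let ?s = "1 + card ?C"
  have "x \<notin> ?D" if x: "x \<in> {j} \<union> ?C" for x
  proof
    assume D: "x \<in> ?D"
    then have "w s x = 0" using z(2)[of x] by simp
    then show False using x D by simp
  qed
  then have dj: "({j} \<union> ?C) \<inter> ?D = {}" by blast
  obtain \<sigma> where \<sigma>: "bij_betw \<sigma> {1..?s + card ?D} (({j} \<union> ?C) \<union> ?D)"
    "\<And>x. x \<in> {1..?s} \<Longrightarrow> \<sigma> x = \<sigma>1 x" "\<sigma> ` {?s + 1..?s + card ?D} = ?D"
    by (rule bij_betw_extend[OF \<sigma>1(1) fin(2) dj]) blast
  let ?m = "?s + card ?D"
  have cards: "0 < card ?C" "0 < card ?D"
    using ex fin by (metis (mono_tags, lifting) card_gt_0_iff empty_iff mem_Collect_eq)+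
  have \<sigma>j: "\<sigma> 1 = j" using \<sigma>(2)[of 1] \<sigma>1(2)[of 1] by simp
  have \<sigma>C: "\<sigma> x \<in> ?C" if "2 \<le> x" "x \<le> ?s" for x
  proof -
    have "x \<in> {1 + 1..?s}" "x \<in> {1..?s}" using that by auto
    then show ?thesis using \<sigma>1(3) \<sigma>(2) by blast
  qed
  have \<sigma>D: "\<sigma> x \<in> ?D" if "?s < x" "x \<le> ?m" for x
  proof -
    have "x \<in> {?s + 1..?m}" using that by auto
    then show ?thesis using \<sigma>(3) by blast
  qed
  define b where "b x = w i (\<sigma> x) + 1" for x
  define c where "c x = w s (\<sigma> x) + 1" for x
  let ?a = "w i j + 1"
  let ?u = "\<lambda>x. if x = 1 then ?a else if x \<le> ?s then 1 else b x"
    and ?v = "(\<lambda>_. 1)(1 := ?a + 1)" and ?w = "\<lambda>x. if 2 \<le> x \<and> x \<le> ?s then c x else 1"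
  show ?thesis
  proof (rule realized_pow_ideals[OF \<sigma>(1)])
    show "T = {i, p, s}" using T by blast
    show "({j} \<union> ?C) \<union> ?D \<subseteq> {1..n}" using N by auto
    show "w t x = 0" if "x \<in> {1..n}" "x \<notin> ({j} \<union> ?C) \<union> ?D" "t \<in> T" for x t
      using that z T by auto
    show "listed_ideal ?m (pow_ideal ?m ?u \<inter> pow_ideal ?m ?v \<inter> pow_ideal ?m ?w :: 'k mpoly set)"
      by (rule listed_ideal.item4) (use cards in \<open>auto simp: b_def c_def\<close>)
    fix x assume x: "x \<in> {1..?m}"
    consider "x = 1" | "2 \<le> x" "x \<le> ?s" "\<sigma> x \<in> ?C" | "?s < x" "x \<noteq> 1" "\<sigma> x \<in> ?D"
    proof -
      have "x = 1 \<or> (2 \<le> x \<and> x \<le> ?s) \<or> (?s < x \<and> x \<noteq> 1 \<and> x \<le> ?m)" using x by auto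
      then show thesis using that \<sigma>C[of x] \<sigma>D[of x] by blast
    qed
    then show "?u x = Suc (w i (\<sigma> x)) \<and> ?v x = Suc (w p (\<sigma> x)) \<and> ?w x = Suc (w s (\<sigma> x))"
    proof cases
      case 1
      then show ?thesis using \<sigma>j v by simp
    next
      case 2
      have "\<sigma> x \<noteq> j" using 2(3) v(2) by (metis (mono_tags, lifting) mem_Collect_eq less_irrefl)
      then have "w i (\<sigma> x) = 0" "w p (\<sigma> x) = 0" using 2(3) z(1)[of "\<sigma> x"] z(2)[of "\<sigma> x"] by simp_all
      then show ?thesis using 2(1,2) by (simp add: c_def)
    next
      case 3
      then have "w s (\<sigma> x) = 0" "w p (\<sigma> x) = 0" using z(1)[of "\<sigma> x"] z(2)[of "\<sigma> x"] by simp_all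
      then show ?thesis using 3(1,2) by (simp add: b_def)
    qed
  qed
qed

lemma realized_item5:
  assumes T: "T = {p, q, r}" and dist: "p \<noteq> q" "p \<noteq> r" "q \<noteq> r"
    and z: "\<And>x p q. x \<in> {1..n} \<Longrightarrow> p \<in> T \<Longrightarrow> q \<in> T \<Longrightarrow> p \<noteq> q \<Longrightarrow> w p x = 0 \<or> w q x = 0"
    and ex: "\<And>p. p \<in> T \<Longrightarrow> \<exists>x\<in>{1..n}. 0 < w p x"
  shows "realized n TYPE('k::field) T w"
proof -
  let ?C = "\<lambda>p. {x \<in> {1..n}. 0 < w p x}"
  have mem: "p \<in> T" "q \<in> T" "r \<in> T" using T by auto
  have disj: "w p x = 0 \<or> w q x = 0" "w p x = 0 \<or> w r x = 0" "w q x = 0 \<or> w r x = 0" if "x \<in> {1..n}" for x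
    using z[OF that mem(1,2) dist(1)] z[OF that mem(1,3) dist(2)] z[OF that mem(2,3) dist(3)] .
  have fin: "finite (?C t)" for t by simp
  obtain \<sigma>1 where \<sigma>1: "bij_betw \<sigma>1 {1..card (?C p)} (?C p)"
    using ex_bij_betw_nat_finite_1[OF fin] by blast
  have dj: "?C p \<inter> ?C q = {}" "(?C p \<union> ?C q) \<inter> ?C r = {}"
  proof -
    show "?C p \<inter> ?C q = {}"
    proof (rule equals0I)
      show False if "x \<in> ?C p \<inter> ?C q" for x using that disj(1)[of x] by simp
    qed
    show "(?C p \<union> ?C q) \<inter> ?C r = {}"
    proof (rule equals0I)
      show False if "x \<in> (?C p \<union> ?C q) \<inter> ?C r" for x using that disj(2,3)[of x] by auto
    qed
  qed
  obtain \<sigma>2 where \<sigma>2: "bij_betw \<sigma>2 {1..card (?C p) + card (?C q)} (?C p \<union> ?C q)"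
    "\<And>x. x \<in> {1..card (?C p)} \<Longrightarrow> \<sigma>2 x = \<sigma>1 x"
    "\<sigma>2 ` {card (?C p) + 1..card (?C p) + card (?C q)} = ?C q"
    by (rule bij_betw_extend[OF \<sigma>1 fin[of q] dj(1)]) blast
  let ?s = "card (?C p)" let ?t = "?s + card (?C q)"
  obtain \<sigma> where \<sigma>: "bij_betw \<sigma> {1..?t + card (?C r)} ((?C p \<union> ?C q) \<union> ?C r)"
    "\<And>x. x \<in> {1..?t} \<Longrightarrow> \<sigma> x = \<sigma>2 x" "\<sigma> ` {?t + 1..?t + card (?C r)} = ?C r"
    by (rule bij_betw_extend[OF \<sigma>2(1) fin[of r] dj(2)]) blast
  let ?m = "?t + card (?C r)"
  have cards: "0 < card (?C t)" if "t \<in> T" for t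
    using ex[OF that] fin[of t] by (metis (mono_tags, lifting) card_gt_0_iff empty_iff mem_Collect_eq)
  have P: "\<sigma> x \<in> ?C p" if "1 \<le> x" "x \<le> ?s" for x
  proof -
    have "x \<in> {1..?s}" "x \<in> {1..?t}" using that by auto
    then have "\<sigma> x = \<sigma>1 x" "\<sigma>1 x \<in> ?C p" using \<sigma>(2) \<sigma>2(2) bij_betwE[OF \<sigma>1] by simp_all
    then show ?thesis by simp
  qed
  have Q: "\<sigma> x \<in> ?C q" if "?s < x" "x \<le> ?t" for x
  proof -
    have "x \<in> {?s + 1..?t}" "x \<in> {1..?t}" using that by auto
    then show ?thesis using \<sigma>2(3) \<sigma>(2) by blast
  qed
  have R: "\<sigma> x \<in> ?C r" if "?t < x" "x \<le> ?m" for x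
  proof -
    have "x \<in> {?t + 1..?m}" using that by auto
    then show ?thesis using \<sigma>(3) by blast
  qed
  define a where "a x = w p (\<sigma> x) + 1" for x
  define b where "b x = w q (\<sigma> x) + 1" for x
  define c where "c x = w r (\<sigma> x) + 1" for x
  let ?u = "\<lambda>x. if x \<le> ?t then 1 else c x" and ?v = "\<lambda>x. if ?s < x \<and> x \<le> ?t then b x else 1"
    and ?w = "\<lambda>x. if x \<le> ?s then a x else 1"
  show ?thesis
  proof (rule realized_pow_ideals[OF \<sigma>(1)])
    \<comment> \<open>In item 5 the first ideal belongs to the last block of variables.\<close>
    show "T = {r, q, p}" using T by blast
    show "(?C p \<union> ?C q) \<union> ?C r \<subseteq> {1..n}" by auto
    show "w t x = 0" if "x \<in> {1..n}" "x \<notin> (?C p \<union> ?C q) \<union> ?C r" "t \<in> T" for x t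
      using that T by auto
    show "listed_ideal ?m (pow_ideal ?m ?u \<inter> pow_ideal ?m ?v \<inter> pow_ideal ?m ?w :: 'k mpoly set)"
      by (rule listed_ideal.item5)
        (use cards[OF mem(1)] cards[OF mem(2)] cards[OF mem(3)] in \<open>auto simp: a_def b_def c_def\<close>)
    fix x assume x: "x \<in> {1..?m}"
    consider "x \<le> ?s" | "?s < x" "x \<le> ?t" | "?t < x" by linarith
    then show "?u x = Suc (w r (\<sigma> x)) \<and> ?v x = Suc (w q (\<sigma> x)) \<and> ?w x = Suc (w p (\<sigma> x))"
    proof cases
      case 1
      then have *: "\<sigma> x \<in> ?C p" using P x by simp
      then have "w q (\<sigma> x) = 0" "w r (\<sigma> x) = 0" using disj[of "\<sigma> x"] by auto
      then show ?thesis using 1 by (simp add: a_def)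
    next
      case 2
      then have *: "\<sigma> x \<in> ?C q" using Q by blast
      then have "w p (\<sigma> x) = 0" "w r (\<sigma> x) = 0" using disj[of "\<sigma> x"] by auto
      then show ?thesis using 2 by (simp add: b_def)
    next
      case 3
      then have *: "\<sigma> x \<in> ?C r" using R x by simp
      then have "w p (\<sigma> x) = 0" "w q (\<sigma> x) = 0" using disj[of "\<sigma> x"] by auto
      then show ?thesis using 3 by (simp add: c_def)
    qed
  qed
qed

lemma (in antichain3) realized_of_colon_cond:
  assumes N: "N = {1..n}" and T: "T = {p1, p2, p3}" and dist: "p1 \<noteq> p2" "p1 \<noteq> p3" "p2 \<noteq> p3"
  shows "realized n TYPE('k::field) T w"
proof -
  note c = classification[OF T dist]
  show ?thesis
  proof (rule c)
    fix i p q j k l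
    assume "T = {i, p, q}" "j \<in> N" "k \<in> N" "l \<in> N" "k \<noteq> j" "l \<noteq> j" "l \<noteq> k"
      "arrow N j (w p) (w i)" "arrow N j (w q) (w i)" "arrow N k (w i) (w p)" "arrow N l (w i) (w q)"
      "\<And>x. x \<in> N \<Longrightarrow> x \<notin> {j, k, l} \<Longrightarrow> w i x = 0 \<and> w p x = 0 \<and> w q x = 0"
    then show ?thesis unfolding N by (rule realized_item1)
  next
    fix p i s j k
    assume "T = {p, i, s}" "j \<in> N" "k \<in> N" "k \<noteq> j"
      "w p j = Suc (w i j)" "w s k = Suc (w i k)" "\<And>x. x \<in> N \<Longrightarrow> x \<noteq> j \<Longrightarrow> w p x = 0"
      "\<And>x. x \<in> N \<Longrightarrow> x \<noteq> k \<Longrightarrow> w s x = 0" "\<exists>x\<in>N. x \<noteq> j \<and> x \<noteq> k \<and> 0 < w i x"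
    then show ?thesis unfolding N by (rule realized_item2)
  next
    fix p i s j k
    assume "T = {p, i, s}" "j \<in> N" "k \<in> N" "k \<noteq> j"
      "w p j = Suc (w i j)" "w i k = Suc (w p k)" "w s j = 0" "w s k = 0"
      "\<And>x. x \<in> N \<Longrightarrow> x \<notin> {j, k} \<Longrightarrow> w p x = 0 \<and> w i x = 0" "\<exists>x\<in>N. 0 < w s x"
    then show ?thesis unfolding N by (rule realized_item3)
  next
    fix p i s j
    assume "T = {p, i, s}" "j \<in> N" "w p j = Suc (w i j)" "w s j = 0"
      "\<And>x. x \<in> N \<Longrightarrow> x \<noteq> j \<Longrightarrow> w p x = 0" "\<And>x. x \<in> N \<Longrightarrow> x \<noteq> j \<Longrightarrow> w i x = 0 \<or> w s x = 0"
      "\<exists>x\<in>N. 0 < w s x" "\<exists>x\<in>N. x \<noteq> j \<and> 0 < w i x"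
    then show ?thesis unfolding N by (rule realized_item4)
  next
    assume "\<And>x p q. x \<in> N \<Longrightarrow> p \<in> T \<Longrightarrow> q \<in> T \<Longrightarrow> p \<noteq> q \<Longrightarrow> w p x = 0 \<or> w q x = 0"
      "\<And>p. p \<in> T \<Longrightarrow> \<exists>x\<in>N. 0 < w p x"
    then show ?thesis unfolding N by (rule realized_item5[OF T dist])
  qed
qed

section \<open>Change of presentation and the equivalences\<close>

lemma quotient_map:
  fixes I :: "'k::field mpoly set"
  assumes I: "ideal I (mpoly_ring n)"
  defines "\<pi> \<equiv> (+>\<^bsub>mpoly_ring n\<^esub>) I"
  shows "\<pi> \<in> ring_hom (mpoly_ring n) (mpoly_ring n Quot I)"
    and "\<pi> ` carrier (mpoly_ring n) = carrier (mpoly_ring n Quot I)"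
    and "\<And>p. p \<in> carrier (mpoly_ring n) \<Longrightarrow> \<pi> p = \<zero>\<^bsub>mpoly_ring n Quot I\<^esub> \<longleftrightarrow> p \<in> I"
proof -
  interpret I: ideal I "mpoly_ring n" by (rule I)
  show hom: "\<pi> \<in> ring_hom (mpoly_ring n) (mpoly_ring n Quot I)" unfolding \<pi>_def by (rule I.rcos_ring_hom)
  show "\<pi> ` carrier (mpoly_ring n) = carrier (mpoly_ring n Quot I)"
    using ring_hom_closed[OF hom] FactRing_rep[of _ "mpoly_ring n" I] unfolding \<pi>_def by blast
  fix p :: "'k mpoly" assume p: "p \<in> carrier (mpoly_ring n)"
  have "\<zero>\<^bsub>mpoly_ring n Quot I\<^esub> = I" by (simp add: FactRing_def)
  then show "\<pi> p = \<zero>\<^bsub>mpoly_ring n Quot I\<^esub> \<longleftrightarrow> p \<in> I"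
    using I.a_rcos_self[OF p] I.a_rcos_const unfolding \<pi>_def by auto
qed

text \<open>Variables outside the range of \<sigma> occur in no member of \<open>B\<close>, so they
  are zero in \<open>R\<close>, and the polynomials in the remaining ones still map onto it.\<close>

lemma (in monomial_quotient) relabel:
  assumes B: "B = down_set n (w ` T)" and T: "finite T"
    and \<sigma>: "inj_on \<sigma> {1..m}" "\<sigma> ` {1..m} \<subseteq> {1..n}"
    and z: "\<forall>x\<in>{1..n} - \<sigma> ` {1..m}. \<forall>p\<in>T. w p x = 0"
  shows "monomial_quotient R m (down_set m ((\<lambda>p. w p \<circ> \<sigma>) ` T)) (\<psi> \<circ> push (push \<sigma>))"
proof -
  let ?E = "{t. keys t \<subseteq> {1..m}}" and ?B = "down_set m ((\<lambda>p. w p \<circ> \<sigma>) ` T)"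
  let ?g = "push \<sigma> :: (nat \<Rightarrow>\<^sub>0 nat) \<Rightarrow> (nat \<Rightarrow>\<^sub>0 nat)"
  have lk: "lookup (?g t) (\<sigma> i) = lookup t i" if "t \<in> ?E" "i \<in> {1..m}" for t i
    using lookup_push[OF \<sigma>(1) _ that(2)] that(1) by blast
  have ks: "keys (?g t) = \<sigma> ` keys t" if "t \<in> ?E" for t
    using keys_push[OF \<sigma>(1)] that by blast
  have g_inj: "inj_on ?g ?E"
  proof (rule inj_onI)
    fix s t assume st: "s \<in> ?E" "t \<in> ?E" "?g s = ?g t"
    have "lookup s i = lookup t i" for i
    proof (cases "i \<in> {1..m}")
      case True
      then show ?thesis using lk[OF st(1)] lk[OF st(2)] st(3) by metis
    next
      case False
      then show ?thesis using lookup_outside[of s m i] lookup_outside[of t m i] st(1,2) by simp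
    qed
    then show "s = t" by (rule poly_mapping_eqI)
  qed
  have pE: "keys p \<subseteq> ?E" if "p \<in> carrier (mpoly_ring m)" for p :: "'k mpoly"
    using that by (auto simp: carrier_mpoly_iff)
  have kp: "keys (push ?g p) = ?g ` keys p" if "p \<in> carrier (mpoly_ring m)" for p :: "'k mpoly"
    by (rule keys_push[OF g_inj pE[OF that]])
  have pS: "push ?g p \<in> S" if p: "p \<in> carrier (mpoly_ring m)" for p :: "'k mpoly"
    unfolding carrier_mpoly_iff kp[OF p]
  proof
    fix t assume "t \<in> ?g ` keys p"
    then obtain s where "s \<in> keys p" "t = ?g s" by blast
    then show "keys t \<subseteq> {1..n}" using ks[of s] pE[OF p] \<sigma>(2) by blast
  qed
  have gB: "?g t \<in> B \<longleftrightarrow> t \<in> ?B" if t: "t \<in> ?E" for t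
  proof -
    have "(\<forall>x\<in>{1..n}. lookup (?g t) x \<le> w p x) \<longleftrightarrow> (\<forall>i\<in>{1..m}. lookup t i \<le> w p (\<sigma> i))" for p
    proof
      assume h: "\<forall>x\<in>{1..n}. lookup (?g t) x \<le> w p x"
      show "\<forall>i\<in>{1..m}. lookup t i \<le> w p (\<sigma> i)"
      proof
        fix i assume i: "i \<in> {1..m}"
        then have "\<sigma> i \<in> {1..n}" using \<sigma>(2) by blast
        then have "lookup (?g t) (\<sigma> i) \<le> w p (\<sigma> i)" using h by blast
        then show "lookup t i \<le> w p (\<sigma> i)" using lk[OF t i] by simp
      qed
    next
      assume h: "\<forall>i\<in>{1..m}. lookup t i \<le> w p (\<sigma> i)"
      show "\<forall>x\<in>{1..n}. lookup (?g t) x \<le> w p x"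
      proof
        fix x
        show "lookup (?g t) x \<le> w p x"
        proof (cases "x \<in> \<sigma> ` {1..m}")
          case True
          then obtain i where i: "i \<in> {1..m}" "x = \<sigma> i" by blast
          then show ?thesis using lk[OF t i(1)] h by simp
        next
          case False
          then have "x \<notin> keys (?g t)" using ks[OF t] t by blast
          then show ?thesis by (simp add: in_keys_iff)
        qed
      qed
    qed
    moreover have "keys (?g t) \<subseteq> {1..n}" using ks[OF t] t \<sigma>(2) by blast
    ultimately show ?thesis unfolding B down_set_def using t by simp
  qed
  show ?thesis
  proof (rule monomial_quotientI)
    show "cring R" by unfold_locales
    show "finite ((\<lambda>p. w p \<circ> \<sigma>) ` T)" using T by simp
    show "\<psi> \<circ> push ?g \<in> ring_hom (mpoly_ring m) R"
    proof (rule ring_hom_memI)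
      fix p q :: "'k mpoly" assume p: "p \<in> carrier (mpoly_ring m)" and q: "q \<in> carrier (mpoly_ring m)"
      show "(\<psi> \<circ> push ?g) p \<in> carrier R" using pS[OF p] by simp
      show "(\<psi> \<circ> push ?g) (p \<otimes>\<^bsub>mpoly_ring m\<^esub> q) = (\<psi> \<circ> push ?g) p \<otimes> (\<psi> \<circ> push ?g) q"
        using psi_mult[OF pS[OF p] pS[OF q]] by (simp add: push_mult[of ?g, OF push_add])
      show "(\<psi> \<circ> push ?g) (p \<oplus>\<^bsub>mpoly_ring m\<^esub> q) = (\<psi> \<circ> push ?g) p \<oplus> (\<psi> \<circ> push ?g) q"
        using psi_add[OF pS[OF p] pS[OF q]] by (simp add: push_add)
    next
      have "push ?g (1 :: 'k mpoly) = 1" unfolding single_one[symmetric] push_single push_zero ..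
      then show "(\<psi> \<circ> push ?g) \<one>\<^bsub>mpoly_ring m\<^esub> = \<one>" by simp
    qed
    show "(\<psi> \<circ> push ?g) ` carrier (mpoly_ring m) = carrier R"
    proof
      show "(\<psi> \<circ> push ?g) ` carrier (mpoly_ring m) \<subseteq> carrier R" using pS by auto
      show "carrier R \<subseteq> (\<psi> \<circ> push ?g) ` carrier (mpoly_ring m)"
      proof
        fix r assume "r \<in> carrier R"
        then obtain q where q: "q \<in> S" "r = \<psi> q" by (rule obtain_rep)
        \<comment> \<open>Pulls an exponent vector back along \<sigma>; on \<open>B\<close> this
          undoes the renaming, since its members are supported in the range of \<sigma>.\<close>
        let ?h = "\<lambda>t. expv m (\<lambda>i. lookup t (\<sigma> i))"
        have gh: "?g (?h t) = t" if t: "t \<in> B" for t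
        proof (rule poly_mapping_eqI)
          fix x
          have hE: "?h t \<in> ?E" using keys_expv by blast
          show "lookup (?g (?h t)) x = lookup t x"
          proof (cases "x \<in> \<sigma> ` {1..m}")
            case True
            then obtain i where i: "i \<in> {1..m}" "x = \<sigma> i" by blast
            then show ?thesis using lk[OF hE i(1)] by (simp add: lookup_expv)
          next
            case False
            then have "x \<notin> keys (?g (?h t))" using ks[OF hE] hE by blast
            moreover have "lookup t x = 0"
            proof (cases "x \<in> {1..n}")
              case True
              obtain p where "p \<in> T" "\<forall>x\<in>{1..n}. lookup t x \<le> w p x"
                using t unfolding B down_set_def by blast
              then show ?thesis using z True False by (metis DiffI bot_nat_0.extremum_unique)
            next
              case False
              then show ?thesis using lookup_outside[OF keys_B[OF t]] by blast
            qed
            ultimately show ?thesis by (simp add: in_keys_iff)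
          qed
        qed
        let ?p = "\<Sum>t\<in>B. single (?h t) (lookup q t)"
        have pm: "?p \<in> carrier (mpoly_ring m)"
          by (intro sum_in_mpoly single_in_mpoly keys_expv)
        have push_p: "push ?g ?p = (\<Sum>t\<in>B. single t (lookup q t))"
          unfolding push_sum push_single by (rule sum.cong[OF refl]) (simp only: gh)
        have "lookup (push ?g ?p) t = lookup q t" if "t \<in> B" for t
          unfolding push_p using that by (rule lookup_sum_singles[OF finite_B])
        then have "\<psi> (push ?g ?p) = \<psi> q" using psi_eq_iff[OF pS[OF pm] q(1)] by blast
        then have "r = (\<psi> \<circ> push ?g) ?p" unfolding q(2) comp_apply by (rule sym)
        then show "r \<in> (\<psi> \<circ> push ?g) ` carrier (mpoly_ring m)" by (rule image_eqI[OF _ pm])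
      qed
    qed
    fix p :: "'k mpoly" assume p: "p \<in> carrier (mpoly_ring m)"
    have "keys (push ?g p) \<inter> B = {} \<longleftrightarrow> (\<forall>t\<in>keys p. ?g t \<notin> B)" unfolding kp[OF p] by blast
    also have "\<dots> \<longleftrightarrow> (\<forall>t\<in>keys p. t \<notin> ?B)"
      by (rule ball_cong[OF refl]) (use gB pE[OF p] in blast)
    also have "\<dots> \<longleftrightarrow> p \<in> vanishing m ?B" using p unfolding vanishing_def by blast
    finally show "(\<psi> \<circ> push ?g) p = \<zero> \<longleftrightarrow> p \<in> vanishing m ?B" using ker[OF pS[OF p]] by simp
  qed (rule one_not_zero)
qed

text \<open>The isomorphism is inverted and composed with the quotient map, which presents
  \<open>R\<close> itself over the listed ideal. The shifts therefore act on the given \<omega>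
  directly.\<close>

lemma trace_of_listed:
  fixes R :: "'r ring" and I :: "'k::field mpoly set" and \<omega> :: "('r, 'w) module"
  assumes R: "cring R" "maximalideal M R" and I: "listed_ideal m I" and iso: "R \<simeq> (mpoly_ring m Quot I)"
    and can: "canonical_module R M \<omega>"
  shows "M \<subseteq> trace_ideal R \<omega>"
proof -
  interpret R: cring R by (rule R(1))
  interpret M: maximalideal M R by (rule R(2))
  obtain W where W: "finite W" "shift_cond {1..m} W" "I = vanishing m (down_set m W)"
    using listed_ideal_shift_cond[OF I] by blast
  have idI: "ideal I (mpoly_ring m)" unfolding W(3) by (rule ideal_vanishing) (rule down_set_down)
  note \<pi> = quotient_map[OF idI]
  have Qr: "ring (mpoly_ring m Quot I)" by (rule ideal.quotient_is_ring[OF idI])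
  have "(mpoly_ring m Quot I) \<simeq> R" using ring_iso_sym[OF R.ring_axioms iso] .
  then obtain g where g: "g \<in> ring_iso (mpoly_ring m Quot I) R" unfolding is_ring_iso_def by blast
  have gh: "g \<in> ring_hom (mpoly_ring m Quot I) R" and gb: "bij_betw g (carrier (mpoly_ring m Quot I)) (carrier R)"
    using g unfolding ring_iso_def by blast+
  let ?\<psi> = "g \<circ> (+>\<^bsub>mpoly_ring m\<^esub>) I"
  have one: "\<one>\<^bsub>R\<^esub> \<noteq> \<zero>\<^bsub>R\<^esub>" using M.one_imp_carrier M.I_notcarr M.zero_closed by auto
  interpret G: ring_hom_ring "mpoly_ring m Quot I" R g by (rule ring_hom_ringI2[OF Qr R.ring_axioms gh])
  have "monomial_quotient R m (down_set m W) ?\<psi>"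
  proof (rule monomial_quotientI[OF R(1) W(1) _ _ _ one])
    show "?\<psi> \<in> ring_hom (mpoly_ring m) R" using ring_hom_trans[OF \<pi>(1) gh] .
    show "?\<psi> ` carrier (mpoly_ring m) = carrier R"
      using \<pi>(2) gb unfolding bij_betw_def by (metis image_comp)
    fix p :: "'k mpoly" assume p: "p \<in> carrier (mpoly_ring m)"
    have c: "I +>\<^bsub>mpoly_ring m\<^esub> p \<in> carrier (mpoly_ring m Quot I)" using ring_hom_closed[OF \<pi>(1) p] .
    have "g (I +>\<^bsub>mpoly_ring m\<^esub> p) = \<zero>\<^bsub>R\<^esub> \<longleftrightarrow> I +>\<^bsub>mpoly_ring m\<^esub> p = \<zero>\<^bsub>mpoly_ring m Quot I\<^esub>"
      using gb c G.hom_zero ring.ring_simprules(2)[OF Qr] unfolding bij_betw_def inj_on_def by metis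
    then show "?\<psi> p = \<zero>\<^bsub>R\<^esub> \<longleftrightarrow> p \<in> vanishing m (down_set m W)" using \<pi>(3)[OF p] W(3) by simp
  qed
  then interpret L: monomial_quotient R m "down_set m W" ?\<psi> .
  have M0: "M = L.m0" by (rule L.maximal_eq_m0[OF R(2)])
  obtain \<tau> e where "dual_module R m (down_set m W) ?\<psi> \<omega> \<tau> e"
    using L.canonical_dual_module[of \<omega>] R(2) can M0 by blast
  then interpret D: dual_module R m "down_set m W" ?\<psi> \<omega> \<tau> e .
  show ?thesis
    unfolding M0 by (rule D.m0_subset_trace) (rule L.shift_ok_exists[OF refl W(2)])
qed

theorem theorem5p4:
  fixes n :: nat
    and a :: "nat \<Rightarrow> nat \<Rightarrow> nat"
    and I :: "'k::field mpoly set"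
    and R :: "'k mpoly set ring"
    and \<mm> :: "'k mpoly set set"
    and \<omega> :: "('k mpoly set, 'w) module"
    and P :: "'k mpoly set set set"
  assumes "\<forall>i\<in>{1..3}. \<forall>j\<in>{1..n}. 1 \<le> a i j"
    and "I = pow_ideal n (a 1) \<inter> pow_ideal n (a 2) \<inter> pow_ideal n (a 3)"
    and "monomial_ideal n I"
    and "primary_to (mpoly_ring n) I (Idl\<^bsub>mpoly_ring n\<^esub> {Var i | i. i \<in> {1..n}})"
    and "R = mpoly_ring n Quot I"
    and "maximalideal \<mm> R"
    and "ring_type R \<mm> = 3"
    and "canonical_module R \<mm> \<omega>"
    and "\<forall>p\<in>P. primeideal p R \<and> p \<noteq> \<mm>"
    and "finite P \<or> (countable P \<and> (adically_complete R \<mm> \<or> uncountable (UNIV :: 'k set)))"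
  shows "(\<mm> \<subseteq> trace_ideal R \<omega> \<longleftrightarrow>
           (\<forall>xs K \<aa>. system_of_parameters R \<mm> xs \<and> K = Idl\<^bsub>R\<^esub> (set xs) \<and> ideal \<aa> R \<and> K \<subseteq> \<aa> \<longrightarrow>
              colon R K (colon R K \<aa>) \<subseteq> colon R \<aa> \<mm>)) \<and>
         (\<mm> \<subseteq> trace_ideal R \<omega> \<longleftrightarrow>
           (\<forall>xs K \<aa>. system_of_parameters R \<mm> xs \<and> (\<forall>x\<in>set xs. \<forall>p\<in>P. x \<notin> p) \<and>
              K = Idl\<^bsub>R\<^esub> (set xs) \<and> ideal \<aa> R \<and> K \<subseteq> \<aa> \<longrightarrow>
              colon R K (colon R K \<aa>) \<subseteq> colon R \<aa> \<mm>)) \<and>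
         (\<mm> \<subseteq> trace_ideal R \<omega> \<longleftrightarrow>
           (\<exists>m (I' :: 'k mpoly set). listed_ideal m I' \<and> R \<simeq> (mpoly_ring m Quot I')))"
proof -
  note max = assms(6)
  define w where "w i x = a i x - 1" for i x
  let ?T = "{1, 2, 3::nat}"
  let ?B = "down_set n (w ` ?T)"
  have "I = vanishing n (down_set n {\<lambda>x. a 1 x - 1, \<lambda>x. a 2 x - 1, \<lambda>x. a 3 x - 1})"
    unfolding assms(2) by (rule pow_ideal_Int3) (use assms(1) in auto)
  then have I: "I = vanishing n ?B" by (simp add: w_def[abs_def])
  have idI: "ideal I (mpoly_ring n)" unfolding I by (rule ideal_vanishing) (rule down_set_down)
  note \<pi> = quotient_map[OF idI, folded assms(5)]
  have R: "cring R" unfolding assms(5) by (rule ideal.quotient_is_cring[OF idI cring_mpoly_ring])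
  interpret R: cring R by (rule R)
  interpret M: maximalideal \<mm> R by (rule max)
  have one: "\<one>\<^bsub>R\<^esub> \<noteq> \<zero>\<^bsub>R\<^esub>" using M.one_imp_carrier M.I_notcarr M.zero_closed by auto
  let ?\<psi> = "(+>\<^bsub>mpoly_ring n\<^esub>) I"
  interpret L: monomial_quotient R n ?B ?\<psi>
    by (rule monomial_quotientI[OF R _ \<pi>(1,2) _ one]) (use \<pi>(3) I in auto)
  have M0: "\<mm> = L.m0" by (rule L.maximal_eq_m0[OF max])
  have max0: "maximalideal L.m0 R" using max M0 by simp
  obtain \<tau> e where "dual_module R n ?B ?\<psi> \<omega> \<tau> e"
    using L.canonical_dual_module[of \<omega>] max assms(8) M0 by blast
  then interpret D: dual_module R n ?B ?\<psi> \<omega> \<tau> e .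
  have 12: "\<mm> \<subseteq> trace_ideal R \<omega> \<Longrightarrow> L.double_colon_cond"
    unfolding M0 by (rule D.double_colon_of_trace)
  have 24: "\<exists>m (I' :: 'k mpoly set). listed_ideal m I' \<and> R \<simeq> (mpoly_ring m Quot I')" if Q: "L.double_colon_cond"
  proof -
    have type: "ring_type R L.m0 = card ?T" using assms(7) M0 by simp
    interpret antichain3 "{1..n}" ?T w
    proof
      show "\<not> lef {1..n} (w p) (w q)" if "p \<in> ?T" "q \<in> ?T" "p \<noteq> q" for p q
        by (rule L.antichain_of_type[OF max0 refl _ type that]) simp
      show "colon_cond {1..n} ?T w" by (rule L.colon_cond_of_double_colon[OF refl Q])
    qed
    have "realized n TYPE('k) ?T w" by (rule realized_of_colon_cond[OF refl refl]) simp_all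
    then obtain m \<sigma> where \<sigma>: "inj_on \<sigma> {1..m}" "\<sigma> ` {1..m} \<subseteq> {1..n}"
        "\<forall>x\<in>{1..n} - \<sigma> ` {1..m}. \<forall>p\<in>?T. w p x = 0"
        and li: "listed_ideal m (vanishing m (down_set m ((\<lambda>p. w p \<circ> \<sigma>) ` ?T)) :: 'k mpoly set)"
      unfolding realized_def by blast
    have "monomial_quotient R m (down_set m ((\<lambda>p. w p \<circ> \<sigma>) ` ?T)) (?\<psi> \<circ> push (push \<sigma>))"
      by (rule L.relabel[OF refl _ \<sigma>]) simp
    from monomial_quotient.iso_quotient[OF this refl] li show ?thesis by blast
  qed
  have 41: "\<mm> \<subseteq> trace_ideal R \<omega>" if "listed_ideal m I'" "R \<simeq> (mpoly_ring m Quot I')" for m and I' :: "'k mpoly set"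
    by (rule trace_of_listed[OF R max that assms(8)])
  note 2 = L.double_colon_cond_iff[OF max, of "\<lambda>_. True", simplified ball_triv simp_thms]
    and 3 = L.double_colon_cond_iff[OF max]
  have "\<mm> \<subseteq> trace_ideal R \<omega> \<longleftrightarrow> L.double_colon_cond" using 12 24 41 by metis
  moreover have "\<mm> \<subseteq> trace_ideal R \<omega> \<longleftrightarrow>
      (\<exists>m (I' :: 'k mpoly set). listed_ideal m I' \<and> R \<simeq> (mpoly_ring m Quot I'))"
    using 12 24 41 by metis
  ultimately show ?thesis unfolding 2 3 by (intro conjI)
qed

end
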